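(* Let $f:\mathbb C\to\mathbb C$ be a surjective entire function with no exceptional points, and let $Q:\mathbb C\to[0,1]$ be a weakly continuous weight function for $f$ which is normal, tight, and nowhere zero. Let $A$ be the associated transfer operator. Then for every $\varphi\in C_b(\mathbb C)$ the sequence of functions $(A^n(\varphi))_n$ converges locally uniformly to a constant function $\varphi_\infty$, and the functional in $(C_b(\mathbb C))^*$ defined by $\varphi\mapsto\varphi_\infty$ is (integration against) a Borel probability measure $\mu$ on $\mathbb C$ whose support equals the Julia set $J(f)$. Moreover, $\mu$ is $A^*$-invariant (and thus $f$-invariant) and mixing for $f$, and if $\nu$ is an arbitrary Borel probability measure on $\mathbb C$, then the sequence of probability measures $((A^* )^n(\nu))_n$ converges weakly to $\mu$. In particular, for all $w\in\mathbb C$ the sequence $(Q^n_w)_n$ converges weakly to $\mu$.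
   Context: Let $f:\mathbb C\to\mathbb C$ be a surjective entire function. A point $z$ is exceptional if its backward orbit $\bigcup_{n\ge0}f^{-n}(z)$ is finite. Sums over preimages count multiplicity. $C_b(\mathbb C)$ is the Banach space of bounded continuous complex-valued functions on $\mathbb C$ with the sup norm. A weight function for $f$ is a function $Q:\mathbb C\to[0,1]$ such that $\sum_{z\in f^{-1}(w)}Q(z)=1$ for every $w\in\mathbb C$. Put $Q_w:=\sum_{z\in f^{-1}(w)}Q(z)\delta_z$ and, for $\varphi\in C_b(\mathbb C)$, $A(\varphi)(w):=\sum_{z\in f^{-1}(w)}Q(z)\varphi(z)$. The weight function $Q$ is weakly continuous if $A(\varphi)$ is continuous for every $\varphi\in C_b(\mathbb C)$; then $A:C_b(\mathbb C)\to C_b(\mathbb C)$ is a bounded operator with $\|A\|\le1$, called the transfer operator, and $A^*$ denotes its transpose on $(C_b(\mathbb C))^*$. For $n\ge1$ put $Q^n(z)=\prod_{j=0}^{n-1}Q(f^j(z))$ and $Q^n_w=(A^* )^n\delta_w=\sum_{z\in f^{-n}(w)}Q^n(z)\delta_z$. A weakly continuous weight function $Q$ is normal if for every $\varphi\in C_b(\mathbb C)$ the family $(A^n(\varphi))_{n\in\mathbb N}$ is equicontinuous on $\mathbb C$. It is tight if for every $\epsilon>0$ there is a compact $K\subset\mathbb C$ such that for every $w\in\mathbb C$ there is $n_0\in\mathbb N$ with $Q^n_w(K)\ge1-\epsilon$ for all $n\ge n_0$. *)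

theory Defs
  imports "HOL-Probability.Probability" "HOL-Complex_Analysis.Complex_Analysis"
begin

section \<open>Preimages, multiplicities, exceptional points\<close>

definition exceptional :: "(complex \<Rightarrow> complex) \<Rightarrow> complex \<Rightarrow> bool" where
  "exceptional f z \<longleftrightarrow> finite (\<Union>n. (f ^^ n) -` {z})"

text \<open>The local degree of a nonconstant entire function \<open>f\<close> at \<open>z\<close>; sums over \<open>f -` {w}\<close> that
  count multiplicity are weighted by it.\<close>

definition local_degree :: "(complex \<Rightarrow> complex) \<Rightarrow> complex \<Rightarrow> nat" where
  "local_degree f z = nat (zorder (\<lambda>u. f u - f z) z)"

section \<open>Locally uniform convergence and the Julia set\<close>

definition locally_uniform_limit ::
    "complex set \<Rightarrow> (nat \<Rightarrow> complex \<Rightarrow> complex) \<Rightarrow> (complex \<Rightarrow> complex) \<Rightarrow> bool" where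
  "locally_uniform_limit U s g \<longleftrightarrow>
     (\<forall>z\<in>U. \<exists>V. open V \<and> z \<in> V \<and> uniform_limit (V \<inter> U) s g sequentially)"

definition locally_uniform_limit_infinity ::
    "complex set \<Rightarrow> (nat \<Rightarrow> complex \<Rightarrow> complex) \<Rightarrow> bool" where
  "locally_uniform_limit_infinity U s \<longleftrightarrow>
     (\<forall>z\<in>U. \<exists>V. open V \<and> z \<in> V \<and> (\<forall>M. \<forall>\<^sub>F n in sequentially. \<forall>x\<in>V \<inter> U. norm (s n x) \<ge> M))"

text \<open>Normality in the sense of Montel, with the constant \<open>\<infinity>\<close> allowed as a limit.\<close>

definition normal_family :: "complex set \<Rightarrow> (complex \<Rightarrow> complex) set \<Rightarrow> bool" where
  "normal_family U F \<longleftrightarrow>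
     (\<forall>s :: nat \<Rightarrow> complex \<Rightarrow> complex. range s \<subseteq> F \<longrightarrow>
        (\<exists>r :: nat \<Rightarrow> nat. strict_mono r \<and>
           ((\<exists>g. g holomorphic_on U \<and> locally_uniform_limit U (s \<circ> r) g) \<or>
            locally_uniform_limit_infinity U (s \<circ> r))))"

text \<open>The neighbourhood is taken connected because on a disconnected set a subsequence may tend to
  \<open>\<infinity>\<close> on one component only.\<close>

definition fatou_set :: "(complex \<Rightarrow> complex) \<Rightarrow> complex set" where
  "fatou_set f =
     {z. \<exists>U. open U \<and> connected U \<and> z \<in> U \<and> normal_family U (range (\<lambda>n. f ^^ n))}"

definition julia_set :: "(complex \<Rightarrow> complex) \<Rightarrow> complex set" where
  "julia_set f = - fatou_set f"

section \<open>Weight functions and the transfer operator\<close>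

definition weight_function :: "(complex \<Rightarrow> complex) \<Rightarrow> (complex \<Rightarrow> real) \<Rightarrow> bool" where
  "weight_function f Q \<longleftrightarrow>
     (\<forall>z. 0 \<le> Q z \<and> Q z \<le> 1) \<and>
     (\<forall>w. ((\<lambda>z. real (local_degree f z) * Q z) has_sum 1) (f -` {w}))"

definition transfer_fun ::
    "(complex \<Rightarrow> complex) \<Rightarrow> (complex \<Rightarrow> real) \<Rightarrow> (complex \<Rightarrow> complex) \<Rightarrow> complex \<Rightarrow> complex" where
  "transfer_fun f Q \<phi> w = (\<Sum>\<^sub>\<infinity>z\<in>f -` {w}. complex_of_real (real (local_degree f z) * Q z) * \<phi> z)"

definition weakly_continuous :: "(complex \<Rightarrow> complex) \<Rightarrow> (complex \<Rightarrow> real) \<Rightarrow> bool" where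
  "weakly_continuous f Q \<longleftrightarrow>
     (\<forall>\<phi> :: complex \<Rightarrow>\<^sub>C complex. continuous_on UNIV (transfer_fun f Q (apply_bcontfun \<phi>)))"

text \<open>\<open>Bcontfun\<close> and \<open>Blinfun\<close> are meaningful here for weakly continuous weight functions; see
  \<open>transfer_op_apply\<close> and \<open>norm_transfer_op_le\<close> below.\<close>

definition transfer_op ::
    "(complex \<Rightarrow> complex) \<Rightarrow> (complex \<Rightarrow> real) \<Rightarrow>
     (complex \<Rightarrow>\<^sub>C complex) \<Rightarrow>\<^sub>L (complex \<Rightarrow>\<^sub>C complex)" where
  "transfer_op f Q = Blinfun (\<lambda>\<phi>. Bcontfun (transfer_fun f Q (apply_bcontfun \<phi>)))"

text \<open>Bounded linear maps in the library are real-linear, so complex-linearity is imposed separately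
  in the definition of the dual space.\<close>

definition Cb_dual :: "((complex \<Rightarrow>\<^sub>C complex) \<Rightarrow>\<^sub>L complex) set" where
  "Cb_dual = {L. \<forall>c \<phi> \<psi>. (\<forall>z. apply_bcontfun \<psi> z = c * apply_bcontfun \<phi> z)
                    \<longrightarrow> blinfun_apply L \<psi> = c * blinfun_apply L \<phi>}"

definition transpose_op ::
    "((complex \<Rightarrow>\<^sub>C complex) \<Rightarrow>\<^sub>L (complex \<Rightarrow>\<^sub>C complex)) \<Rightarrow>
     ((complex \<Rightarrow>\<^sub>C complex) \<Rightarrow>\<^sub>L complex) \<Rightarrow> ((complex \<Rightarrow>\<^sub>C complex) \<Rightarrow>\<^sub>L complex)" where
  "transpose_op T L = L o\<^sub>L T"

definition iter_weight ::
    "(complex \<Rightarrow> complex) \<Rightarrow> (complex \<Rightarrow> real) \<Rightarrow> nat \<Rightarrow> complex \<Rightarrow> real" where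
  "iter_weight f Q n z = (\<Prod>j<n. Q ((f ^^ j) z))"

text \<open>The Borel measure \<open>Q\<^sup>n\<^sub>w\<close>: the sum of the point masses \<open>Q\<^sup>n(z)\<close> at the points \<open>z\<close> of
  \<open>f\<^sup>-\<^sup>n(w)\<close>, counted with the multiplicity of \<open>f\<^sup>n\<close>.\<close>

definition iter_weight_measure ::
    "(complex \<Rightarrow> complex) \<Rightarrow> (complex \<Rightarrow> real) \<Rightarrow> nat \<Rightarrow> complex \<Rightarrow> complex measure" where
  "iter_weight_measure f Q n w =
     distr (point_measure ((f ^^ n) -` {w})
              (\<lambda>z. ennreal (real (local_degree (f ^^ n) z) * iter_weight f Q n z)))
           borel (\<lambda>z. z)"

definition normal_weight :: "(complex \<Rightarrow> complex) \<Rightarrow> (complex \<Rightarrow> real) \<Rightarrow> bool" where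
  "normal_weight f Q \<longleftrightarrow>
     (\<forall>\<phi> :: complex \<Rightarrow>\<^sub>C complex. \<forall>w. \<forall>\<epsilon>>0. \<exists>\<delta>>0. \<forall>w'. dist w' w < \<delta> \<longrightarrow>
        (\<forall>n. dist (apply_bcontfun ((blinfun_apply (transfer_op f Q) ^^ n) \<phi>) w')
                  (apply_bcontfun ((blinfun_apply (transfer_op f Q) ^^ n) \<phi>) w) < \<epsilon>))"

definition tight_weight :: "(complex \<Rightarrow> complex) \<Rightarrow> (complex \<Rightarrow> real) \<Rightarrow> bool" where
  "tight_weight f Q \<longleftrightarrow>
     (\<forall>\<epsilon>>0. \<exists>K. compact K \<and>
        (\<forall>w. \<exists>n0. \<forall>n\<ge>n0. measure (iter_weight_measure f Q n w) K \<ge> 1 - \<epsilon>))"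

section \<open>Borel probability measures on the plane\<close>

definition borel_prob :: "complex measure \<Rightarrow> bool" where
  "borel_prob \<mu> \<longleftrightarrow> prob_space \<mu> \<and> sets \<mu> = sets borel"

definition measure_functional :: "complex measure \<Rightarrow> (complex \<Rightarrow>\<^sub>C complex) \<Rightarrow>\<^sub>L complex" where
  "measure_functional \<mu> = Blinfun (\<lambda>\<phi>. LINT z|\<mu>. apply_bcontfun \<phi> z)"

definition measure_support :: "complex measure \<Rightarrow> complex set" where
  "measure_support \<mu> = {z. \<forall>U. open U \<and> z \<in> U \<longrightarrow> emeasure \<mu> U > 0}"

definition converges_weakly :: "(nat \<Rightarrow> complex measure) \<Rightarrow> complex measure \<Rightarrow> bool" where
  "converges_weakly N \<mu> \<longleftrightarrow>
     (\<forall>n. borel_prob (N n)) \<and> borel_prob \<mu> \<and>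
     (\<forall>\<phi> :: complex \<Rightarrow>\<^sub>C complex.
        (\<lambda>n. LINT z|N n. apply_bcontfun \<phi> z) \<longlonglongrightarrow> (LINT z|\<mu>. apply_bcontfun \<phi> z))"

definition invariant_measure :: "(complex \<Rightarrow> complex) \<Rightarrow> complex measure \<Rightarrow> bool" where
  "invariant_measure f \<mu> \<longleftrightarrow> distr \<mu> borel f = \<mu>"

definition mixing :: "(complex \<Rightarrow> complex) \<Rightarrow> complex measure \<Rightarrow> bool" where
  "mixing f \<mu> \<longleftrightarrow>
     (\<forall>B\<in>sets borel. \<forall>C\<in>sets borel.
        (\<lambda>n. measure \<mu> ((f ^^ n) -` B \<inter> C)) \<longlonglongrightarrow> measure \<mu> B * measure \<mu> C)"

section \<open>Well-definedness\<close>

lemma weighted_sum_bounds: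
  fixes \<phi> :: "complex \<Rightarrow>\<^sub>C complex"
  assumes "weight_function f Q"
  shows "(\<lambda>z. complex_of_real (real (local_degree f z) * Q z) * apply_bcontfun \<phi> z) summable_on (f -` {w})"
    and "norm (transfer_fun f Q (apply_bcontfun \<phi>) w) \<le> norm \<phi>"
proof -
  let ?c = "\<lambda>z. real (local_degree f z) * Q z"
  let ?g = "\<lambda>z. complex_of_real (?c z) * apply_bcontfun \<phi> z"
  have c: "(?c has_sum 1) (f -` {w})" and c0: "\<And>z. ?c z \<ge> 0"
    using assms by (auto simp: weight_function_def)
  have d: "((\<lambda>z. ?c z * norm \<phi>) has_sum 1 * norm \<phi>) (f -` {w})"
    using c by (rule has_sum_cmult_left)
  have le: "norm (?g z) \<le> ?c z * norm \<phi>" for z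
    using c0[of z] norm_bounded[of \<phi> z] assms
    by (auto simp: norm_mult weight_function_def intro!: mult_left_mono)
  have abs: "(\<lambda>z. norm (?g z)) summable_on (f -` {w})"
    by (rule Infinite_Sum.abs_summable_on_comparison_test'[OF has_sum_imp_summable[OF d] le])
  then show "?g summable_on (f -` {w})"
    by (rule abs_summable_summable)
  show "norm (transfer_fun f Q (apply_bcontfun \<phi>) w) \<le> norm \<phi>"
    unfolding transfer_fun_def
    using norm_infsum_le[OF has_sum_infsum[OF abs_summable_summable[OF abs]] d le] by simp
qed

lemma transfer_fun_bcontfun:
  assumes "weight_function f Q" "weakly_continuous f Q"
  shows "transfer_fun f Q (apply_bcontfun \<phi>) \<in> bcontfun"
  using assms weighted_sum_bounds(2)[OF assms(1)]
  by (auto simp: bcontfun_def weakly_continuous_def bounded_iff)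

lemma bounded_linear_transfer:
  assumes "weight_function f Q" "weakly_continuous f Q"
  shows "bounded_linear (\<lambda>\<phi>. Bcontfun (transfer_fun f Q (apply_bcontfun \<phi>)))"
    (is "bounded_linear ?T")
proof (rule bounded_linear_intro[where K = 1])
  have T: "apply_bcontfun (?T \<phi>) = transfer_fun f Q (apply_bcontfun \<phi>)" for \<phi>
    by (rule Bcontfun_inverse[OF transfer_fun_bcontfun[OF assms]])
  show "?T (\<phi> + \<psi>) = ?T \<phi> + ?T \<psi>" for \<phi> \<psi>
    by (rule bcontfun_eqI, simp only: T plus_bcontfun.rep_eq[of "?T \<phi>"])
       (simp only: plus_bcontfun.rep_eq transfer_fun_def distrib_left
          infsum_add[OF weighted_sum_bounds(1)[OF assms(1)] weighted_sum_bounds(1)[OF assms(1)]])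
  show "?T (r *\<^sub>R \<phi>) = r *\<^sub>R ?T \<phi>" for r \<phi>
    by (rule bcontfun_eqI, simp only: T scaleR_bcontfun.rep_eq[of _ "?T \<phi>"])
       (simp only: scaleR_bcontfun.rep_eq transfer_fun_def mult_scaleR_right infsum_scaleR_right)
  show "norm (?T \<phi>) \<le> norm \<phi> * 1" for \<phi>
    by (rule norm_bound) (simp add: T weighted_sum_bounds(2)[OF assms(1)])
qed

lemma transfer_op_apply:
  assumes "weight_function f Q" "weakly_continuous f Q"
  shows "apply_bcontfun (blinfun_apply (transfer_op f Q) \<phi>) = transfer_fun f Q (apply_bcontfun \<phi>)"
  by (simp add: transfer_op_def bounded_linear_Blinfun_apply[OF bounded_linear_transfer[OF assms]]
      Bcontfun_inverse[OF transfer_fun_bcontfun[OF assms]])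

lemma norm_transfer_op_le:
  assumes "weight_function f Q" "weakly_continuous f Q"
  shows "norm (transfer_op f Q) \<le> 1"
  by (rule norm_blinfun_bound)
     (auto intro!: norm_bound simp: transfer_op_apply[OF assms] weighted_sum_bounds(2)[OF assms(1)])

lemma integrable_bcontfun:
  assumes "borel_prob \<mu>"
  shows "integrable \<mu> (apply_bcontfun (\<phi> :: complex \<Rightarrow>\<^sub>C complex))"
proof -
  interpret prob_space \<mu> using assms by (simp add: borel_prob_def)
  have "apply_bcontfun \<phi> \<in> borel_measurable borel"
    by (intro borel_measurable_continuous_onI) simp
  then have "apply_bcontfun \<phi> \<in> borel_measurable \<mu>"
    using assms by (simp add: borel_prob_def cong: measurable_cong_sets)
  then show ?thesis
    by (intro integrable_const_bound[where B = "norm \<phi>"]) (auto simp: norm_bounded)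
qed

lemma measure_functional_apply:
  assumes "borel_prob \<mu>"
  shows "blinfun_apply (measure_functional \<mu>) \<phi> = (LINT z|\<mu>. apply_bcontfun \<phi> z)"
proof -
  interpret prob_space \<mu> using assms by (simp add: borel_prob_def)
  have "bounded_linear (\<lambda>\<phi> :: complex \<Rightarrow>\<^sub>C complex. LINT z|\<mu>. apply_bcontfun \<phi> z)"
  proof (rule bounded_linear_intro[where K = 1])
    fix \<phi> :: "complex \<Rightarrow>\<^sub>C complex"
    have "norm (LINT z|\<mu>. apply_bcontfun \<phi> z) \<le> (LINT z|\<mu>. norm (apply_bcontfun \<phi> z))"
      by (rule integral_norm_bound)
    also have "\<dots> \<le> (LINT z|\<mu>. norm \<phi>)"
      by (intro integral_mono integrable_norm integrable_bcontfun assms) (auto simp: norm_bounded)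
    finally show "norm (LINT z|\<mu>. apply_bcontfun \<phi> z) \<le> norm \<phi> * 1"
      by (simp add: prob_space)
  qed (simp_all add: integrable_bcontfun[OF assms])
  then show ?thesis
    by (simp add: measure_functional_def bounded_linear_Blinfun_apply)
qed

end

theory Submission
  imports Defs "HOL-Computational_Algebra.Fundamental_Theorem_Algebra"
begin

text \<open>
  The measures \<open>Q\<^sup>n\<^sub>w\<close> are the laws of the backward random walk with transition weights \<open>Q\<close>, and
  \<open>A\<^sup>n \<phi>\<close> is the expectation of \<open>\<phi>\<close> under them. By equicontinuity and tightness, a suitable limit \<open>g\<close> of
  iterates \<open>A\<^sup>n \<phi>\<close> (\<open>\<phi>\<close> real) is recurrent, \<open>A\<^sup>m g \<rightarrow> g\<close> along a sequence of times \<open>m\<close>, so that all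
  functions \<open>A\<^sup>n g\<close> have the same maximum \<open>S\<close>, attained on one compact set. As \<open>Q\<close> vanishes nowhere,
  the level sets \<open>{A\<^sup>n g = S}\<close> pull back into each other under \<open>f\<close>. If the iterates \<open>f\<^sup>n\<close> avoid these sets
  on some disc, they omit two well separated values there for every \<open>n\<close>, because some fixed
  iterate of \<open>f\<close> has two preimages over each point of the compact set; the disc then lies in the Fatou
  set by Montel's theorem. Hence \<open>g = S\<close> on the Julia set, and the same for the minimum shows that
  \<open>g\<close> is constant. The same argument, applied to the backward invariant support of the limit
  measure \<open>\<mu>\<close>, gives \<open>J(f) \<subseteq> supp \<mu>\<close>; conversely, mixing forbids normality of the iterates near a point
  of the support, unless the support is a single exceptional point.
\<close>

section \<open>The backward random walk\<close>

text \<open>Two obstacles come from the plane not being compact. Suprema need not be attained and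
  locally uniform convergence is not uniform, so every maximum and every exchange of limits is
  controlled by tightness. And weak limits of functionals on \<open>C_b\<close> need not be
  measures, so \<open>\<mu>\<close> is extracted from the laws \<open>Q^n_0\<close> by a Prokhorov
  argument, coding the plane into the line. The recurrence times are the gaps
  \<open>r (k+1) - r k\<close> of a subsequence along which \<open>A^(r k) \<phi>\<close> converges.
  The values omitted by the iterates on a disc change with the iterate, hence a version of Montel's
  theorem in which the omitted values move and only their limits must be distinct. Two preimages
  fail to exist only over a point whose backward orbit never branches. If that orbit is infinite,
  Picard's great theorem forces \<open>f\<close> to be affine. An affine map with multiplier other
  than 1 has an exceptional fixed point; a translation has no exceptional point and is excluded by
  tightness, since its backward orbits tend to infinity.\<close>

lemma surj_holomorphic_iterate:
  assumes "f holomorphic_on UNIV" "surj f"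
  shows "(f ^^ n) holomorphic_on UNIV" "surj (f ^^ n)"
proof (induction n)
  case 0
  { case 1 show ?case by (simp add: holomorphic_on_ident) }
  { case 2 show ?case by simp }
next
  case (Suc n)
  { case 1 show ?case
      using holomorphic_on_compose[OF Suc(1) holomorphic_on_subset[OF assms(1) subset_UNIV]]
      by (simp add: o_def) }
  { case 2 show ?case using comp_surj[OF Suc(2) assms(2)] by (simp add: o_def) }
qed

text \<open>By surjectivity \<open>f - f z\<close> is not identically zero, so its zero at
  \<open>z\<close> has a finite positive order. Together with the nonvanishing of \<open>Q\<close>
  this gives every preimage a positive weight.\<close>

lemma local_degree_pos:
  assumes "f holomorphic_on UNIV" "surj f"
  shows "local_degree f z > 0"
proof -
  obtain u where "f u = f z + 1" using assms(2) by (metis surj_def)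
  then have nc: "\<exists>w\<in>UNIV. f w - f z \<noteq> 0" by (intro bexI[of _ u]) auto
  have "(\<lambda>u. f u - f z) holomorphic_on UNIV"
    by (intro holomorphic_intros assms)
  from zorder_exist_zero[OF this open_UNIV connected_UNIV UNIV_I nc, of z]
  show ?thesis by (simp add: local_degree_def)
qed

lemma eventually_surj_holomorphic_neq:
  assumes "f holomorphic_on UNIV" "surj f"
  shows "eventually (\<lambda>w. f w \<noteq> a) (at z)"
proof -
  obtain u where u: "f u = a + 1" using assms(2) by (metis surj_def)
  have h: "(\<lambda>u. f u - a) holomorphic_on UNIV"
    by (intro holomorphic_intros assms)
  show ?thesis
    using non_zero_neighbour_alt[OF h open_UNIV connected_UNIV UNIV_I UNIV_I, of u z] u by simp
qed

text \<open>The chain rule for multiplicities. It matches the weight of a composite backward step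
  with the product of the weights of its parts.\<close>

lemma local_degree_compose:
  assumes "f holomorphic_on UNIV" "surj f" "g holomorphic_on UNIV" "surj g"
  shows "local_degree (f \<circ> g) z = local_degree f (g z) * local_degree g z"
proof -
  let ?F = "\<lambda>u. f u - f (g z)"
  have an: "?F analytic_on {g z}" "g analytic_on {z}"
    using assms by (auto intro!: analytic_intros simp: analytic_on_open[symmetric] intro: analytic_on_subset[OF _ subset_UNIV])
  have "zorder (?F \<circ> g) z = zorder ?F (g z) * zorder (\<lambda>x. g x - g z) z"
  proof (rule zorder_compose')
    show "isolated_singularity_at ?F (g z)" "not_essential ?F (g z)"
      using an by (auto intro: isolated_singularity_at_analytic not_essential_analytic)
    show "eventually (\<lambda>w. ?F w \<noteq> 0) (at (g z))"
      using eventually_surj_holomorphic_neq[OF assms(1,2)] by simp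
    show "eventually (\<lambda>w. g w \<noteq> g z) (at z)"
      using eventually_surj_holomorphic_neq[OF assms(3,4)] by simp
  qed (use an in auto)
  moreover have "zorder ?F (g z) > 0"
    using local_degree_pos[OF assms(1,2), of "g z"] by (simp add: local_degree_def)
  ultimately show ?thesis
    by (simp add: local_degree_def o_def nat_mult_distrib)
qed

section \<open>Expectations of bounded functions under discrete laws\<close>

lemma integral_bind_pmf_bounded_real:
  fixes \<phi> :: "'b \<Rightarrow> real"
  assumes "\<And>x. \<bar>\<phi> x\<bar> \<le> B"
  shows "measure_pmf.expectation (bind_pmf p q) \<phi> =
    measure_pmf.expectation p (\<lambda>x. measure_pmf.expectation (q x) \<phi>)"
  unfolding measure_pmf_bind
  by (rule integral_bind[where B=B and B'=1 and K="count_space UNIV"])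
     (auto simp: assms measure_pmf.emeasure_space_1 measure_subprob measure_pmf.finite_measure)

lemma integrable_pmf_bounded:
  fixes \<phi> :: "'b \<Rightarrow> 'c::{banach, second_countable_topology}"
  assumes "\<And>x. norm (\<phi> x) \<le> B"
  shows "integrable (measure_pmf p) \<phi>"
  by (rule measure_pmf.integrable_const_bound[where B=B]) (use assms in auto)

lemma expectation_pmf_norm_le:
  fixes \<phi> :: "'b \<Rightarrow> 'c::{banach, second_countable_topology}"
  assumes "\<And>x. norm (\<phi> x) \<le> B"
  shows "norm (measure_pmf.expectation p \<phi>) \<le> B"
proof -
  have "norm (measure_pmf.expectation p \<phi>) \<le> measure_pmf.expectation p (\<lambda>x. norm (\<phi> x))"
    by (rule integral_norm_bound)
  also have "\<dots> \<le> measure_pmf.expectation p (\<lambda>x. B)"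
    by (intro integral_mono integrable_pmf_bounded[where B=B])
       (auto simp: assms intro: order_trans[OF norm_ge_zero assms])
  finally show ?thesis by (simp add: measure_pmf.prob_space)
qed

lemma integral_bind_pmf_bounded:
  fixes \<phi> :: "'b \<Rightarrow> complex"
  assumes B: "\<And>x. norm (\<phi> x) \<le> B"
  shows "measure_pmf.expectation (bind_pmf p q) \<phi> =
    measure_pmf.expectation p (\<lambda>x. measure_pmf.expectation (q x) \<phi>)"
proof (rule complex_eqI)
  have Re: "\<bar>Re (\<phi> x)\<bar> \<le> B" and Im: "\<bar>Im (\<phi> x)\<bar> \<le> B" for x
    using B[of x] abs_Re_le_cmod abs_Im_le_cmod order_trans by blast+
  note i = integrable_pmf_bounded[OF B] integrable_pmf_bounded[OF expectation_pmf_norm_le[OF B]]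
  show "Re (measure_pmf.expectation (bind_pmf p q) \<phi>) =
      Re (measure_pmf.expectation p (\<lambda>x. measure_pmf.expectation (q x) \<phi>))"
    by (simp flip: integral_Re add: i integral_bind_pmf_bounded_real[OF Re])
  show "Im (measure_pmf.expectation (bind_pmf p q) \<phi>) =
      Im (measure_pmf.expectation p (\<lambda>x. measure_pmf.expectation (q x) \<phi>))"
    by (simp flip: integral_Im add: i integral_bind_pmf_bounded_real[OF Im])
qed

text \<open>\<open>S - h\<close> is nonnegative with mean 0, so it vanishes at every atom. This
  turns a maximum attained by an average into a maximum attained at each preimage.\<close>

lemma expectation_pmf_eq_upper_bound:
  fixes h :: "'a \<Rightarrow> real"
  assumes "\<And>x. h x \<le> S" "\<And>x. \<bar>h x\<bar> \<le> B" "measure_pmf.expectation p h = S" "x \<in> set_pmf p"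
  shows "h x = S"
proof -
  have int: "integrable p h" 
    by (rule measure_pmf.integrable_const_bound[where B=B]) (use assms in auto)
  have "measure_pmf.expectation p (\<lambda>x. S - h x) = 0"
    using int assms(3) by simp
  then have "AE x in p. S - h x = 0"
    using assms(1) int by (subst (asm) integral_nonneg_eq_0_iff_AE) auto
  then show ?thesis using assms(4) by (auto simp: AE_measure_pmf_iff)
qed

section \<open>The kernel of the walk and its iterates\<close>

definition weight_kernel :: "(complex \<Rightarrow> complex) \<Rightarrow> (complex \<Rightarrow> real) \<Rightarrow> complex \<Rightarrow> complex pmf" where
  "weight_kernel f Q w =
     embed_pmf (\<lambda>z. if f z = w then real (local_degree f z) * Q z else 0)"

primrec iter_kernel :: "(complex \<Rightarrow> complex) \<Rightarrow> (complex \<Rightarrow> real) \<Rightarrow> nat \<Rightarrow> complex \<Rightarrow> complex pmf" where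
  "iter_kernel f Q 0 w = return_pmf w"
| "iter_kernel f Q (Suc n) w = bind_pmf (weight_kernel f Q w) (iter_kernel f Q n)"

lemma iter_kernel_1 [simp]: "iter_kernel f Q (Suc 0) = weight_kernel f Q"
proof -
  have "iter_kernel f Q 0 = return_pmf" by (rule ext) simp
  then show ?thesis by (intro ext) (simp add: bind_return_pmf')
qed

lemma iter_kernel_add:
  "iter_kernel f Q (m + n) w = bind_pmf (iter_kernel f Q m w) (iter_kernel f Q n)"
  by (induction m arbitrary: w) (simp_all add: bind_return_pmf bind_assoc_pmf cong: bind_pmf_cong)

text \<open>The weights over a fibre sum to 1, which makes the \<open>embed_pmf\<close> in the
  definition meaningful.\<close>

lemma pmf_weight_kernel:
  assumes "weight_function f Q"
  shows "pmf (weight_kernel f Q w) z = (if f z = w then real (local_degree f z) * Q z else 0)"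
  unfolding weight_kernel_def
proof (rule pmf_embed_pmf)
  let ?c = "\<lambda>z. real (local_degree f z) * Q z"
  have c0: "\<And>z. 0 \<le> ?c z" and hs: "(?c has_sum 1) (f -` {w})"
    using assms by (auto simp: weight_function_def)
  then show "0 \<le> (if f z = w then ?c z else 0)" for z by simp
  have as: "(\<lambda>z. norm (?c z)) summable_on (f -` {w})"
    using has_sum_imp_summable[OF hs] c0 by (simp only: real_norm_def abs_of_nonneg)
  then have "integrable (count_space (f -` {w})) ?c"
    unfolding abs_summable_equivalent abs_summable_on_def .
  then have "(\<integral>\<^sup>+z. ennreal (?c z) \<partial>count_space (f -` {w})) = ennreal (infsetsum ?c (f -` {w}))"
    unfolding infsetsum_def by (rule nn_integral_eq_integral) (use c0 in auto)
  also have "\<dots> = 1"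
    using infsetsum_infsum[OF as[unfolded abs_summable_equivalent]] hs by (simp add: infsumI)
  finally show "(\<integral>\<^sup>+z. ennreal (if f z = w then ?c z else 0) \<partial>count_space UNIV) = 1"
    by (subst (asm) nn_integral_count_space_indicator)
       (auto intro!: nn_integral_cong elim!: trans[rotated] split: split_indicator)
qed

text \<open>To end at \<open>z\<close> after \<open>n + 1\<close> backward steps from
  \<open>w\<close>, the walk must go to \<open>f^n z\<close> in its first step. The integral over
  first steps therefore has at most one nonzero term, in which degrees and weights multiply.\<close>

lemma pmf_iter_kernel:
  assumes "f holomorphic_on UNIV" "surj f" "weight_function f Q"
  shows "pmf (iter_kernel f Q n w) z =
    (if (f ^^ n) z = w then real (local_degree (f ^^ n) z) * iter_weight f Q n z else 0)"
proof (induction n arbitrary: w)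
  case 0
  have "local_degree (\<lambda>x. x) z = 1" for z
  proof -
    have "zorder (\<lambda>u. u - z) z = 1"
      by (rule zorder_eqI[where S=UNIV and g="\<lambda>_. 1"]) (auto simp: power_int_def)
    then show ?thesis by (simp add: local_degree_def)
  qed
  then show ?case by (auto simp: iter_weight_def pmf_return id_def indicator_def)
next
  case (Suc n)
  let ?y = "(f ^^ n) z" and ?a = "real (local_degree (f ^^ n) z) * iter_weight f Q n z"
  have "pmf (iter_kernel f Q (Suc n) w) z =
      (\<integral>y. pmf (iter_kernel f Q n y) z \<partial>weight_kernel f Q w)"
    by (simp add: pmf_bind)
  also have "\<dots> = (\<integral>y. ?a * indicator {?y} y \<partial>weight_kernel f Q w)"
    by (rule Bochner_Integration.integral_cong) (auto simp: Suc)
  also have "\<dots> = ?a * pmf (weight_kernel f Q w) ?y"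
    by (simp add: measure_pmf_single)
  also have "\<dots> = (if (f ^^ Suc n) z = w then ?a * (real (local_degree f ?y) * Q ?y) else 0)"
    by (simp add: pmf_weight_kernel[OF assms(3)])
  finally show ?case
    using local_degree_compose[OF assms(1,2) surj_holomorphic_iterate[OF assms(1,2)], of n z]
    by (simp add: iter_weight_def o_def)
qed

text \<open>The nonvanishing of \<open>Q\<close> enters here: the walk reaches every preimage, so a
  statement about all atoms is a statement about the whole fibre.\<close>

lemma set_iter_kernel:
  assumes "f holomorphic_on UNIV" "surj f" "weight_function f Q" "\<forall>z. Q z \<noteq> 0"
  shows "set_pmf (iter_kernel f Q n w) = (f ^^ n) -` {w}"
  using local_degree_pos[OF surj_holomorphic_iterate[OF assms(1,2)], of n] assms(4)
  by (auto simp: set_pmf_eq pmf_iter_kernel[OF assms(1-3)] iter_weight_def)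

lemma iter_weight_measure_eq:
  assumes "f holomorphic_on UNIV" "surj f" "weight_function f Q"
  shows "iter_weight_measure f Q n w = distr (measure_pmf (iter_kernel f Q n w)) borel (\<lambda>z. z)"
proof (rule measure_eqI)
  let ?c = "\<lambda>z. real (local_degree (f ^^ n) z) * iter_weight f Q n z"
  fix A assume "A \<in> sets (iter_weight_measure f Q n w)"
  then have A: "A \<in> sets borel" by (simp add: iter_weight_measure_def)
  have "emeasure (iter_weight_measure f Q n w) A =
      emeasure (point_measure ((f ^^ n) -` {w}) (\<lambda>z. ennreal (?c z))) (A \<inter> (f ^^ n) -` {w})"
    unfolding iter_weight_measure_def using A
    by (subst emeasure_distr) (auto simp: space_point_measure measurable_def sets_point_measure)
  also have "\<dots> = (\<integral>\<^sup>+z. ennreal (?c z) * indicator (A \<inter> (f ^^ n) -` {w}) z \<partial>count_space ((f ^^ n) -` {w}))"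
    unfolding point_measure_def by (subst emeasure_density) auto
  also have "\<dots> = (\<integral>\<^sup>+z. ennreal (pmf (iter_kernel f Q n w) z) * indicator A z \<partial>count_space UNIV)"
    by (subst nn_integral_count_space_indicator)
       (auto intro!: nn_integral_cong simp: pmf_iter_kernel[OF assms] split: split_indicator)
  also have "\<dots> = emeasure (measure_pmf (iter_kernel f Q n w)) A"
    by (subst measure_pmf_eq_density, subst emeasure_density) auto
  finally show "emeasure (iter_weight_measure f Q n w) A =
      emeasure (distr (measure_pmf (iter_kernel f Q n w)) borel (\<lambda>z. z)) A"
    using A by (subst emeasure_distr) auto
qed (simp add: iter_weight_measure_def)

lemma transfer_fun_eq_expectation:
  assumes "weight_function f Q"
  shows "transfer_fun f Q (apply_bcontfun \<phi>) w =
    measure_pmf.expectation (weight_kernel f Q w) (apply_bcontfun \<phi>)"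
proof -
  let ?c = "\<lambda>z. real (local_degree f z) * Q z"
  let ?g = "\<lambda>z. complex_of_real (?c z) * apply_bcontfun \<phi> z"
  have c: "(?c has_sum 1) (f -` {w})" and c0: "\<And>z. ?c z \<ge> 0"
    using assms by (auto simp: weight_function_def)
  have abs: "(\<lambda>z. norm (?g z)) summable_on (f -` {w})"
  proof (rule Infinite_Sum.abs_summable_on_comparison_test')
    show "(\<lambda>z. ?c z * norm \<phi>) summable_on (f -` {w})"
      using has_sum_imp_summable[OF has_sum_cmult_left[OF c]] .
    show "norm (?g z) \<le> ?c z * norm \<phi>" for z
      using c0[of z] norm_bounded[of \<phi> z] assms
      by (auto simp: norm_mult weight_function_def intro!: mult_left_mono)
  qed
  have "transfer_fun f Q (apply_bcontfun \<phi>) w = infsetsum ?g (f -` {w})"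
    unfolding transfer_fun_def by (rule infsetsum_infsum[OF abs[unfolded abs_summable_equivalent], symmetric])
  also have "\<dots> = (\<integral>z. indicator (f -` {w}) z *\<^sub>R ?g z \<partial>count_space UNIV)"
    unfolding infsetsum_def
    by (simp add: integral_restrict_space[symmetric] restrict_count_space)
  also have "\<dots> = (\<integral>z. pmf (weight_kernel f Q w) z *\<^sub>R apply_bcontfun \<phi> z \<partial>count_space UNIV)"
    by (rule Bochner_Integration.integral_cong)
       (auto simp: pmf_weight_kernel[OF assms] scaleR_conv_of_real split: split_indicator)
  also have "\<dots> = measure_pmf.expectation (weight_kernel f Q w) (apply_bcontfun \<phi>)"
    by (subst measure_pmf_eq_density, subst integral_density) auto
  finally show ?thesis .
qed

text \<open>\<open>A\<close> averages over one backward step, so iterating it composes the kernels.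
  The identity trades operator powers for expectations, where estimates by mass on a compact set are
  available.\<close>

lemma transfer_op_power_apply:
  assumes "weight_function f Q" "weakly_continuous f Q"
  shows "apply_bcontfun ((blinfun_apply (transfer_op f Q) ^^ n) \<phi>) w =
    measure_pmf.expectation (iter_kernel f Q n w) (apply_bcontfun \<phi>)"
proof (induction n arbitrary: w)
  case (Suc n)
  have "apply_bcontfun ((blinfun_apply (transfer_op f Q) ^^ Suc n) \<phi>) w =
      measure_pmf.expectation (weight_kernel f Q w)
        (apply_bcontfun ((blinfun_apply (transfer_op f Q) ^^ n) \<phi>))"
    by (simp add: transfer_op_apply[OF assms] transfer_fun_eq_expectation[OF assms(1)])
  also have "\<dots> = measure_pmf.expectation (iter_kernel f Q (Suc n) w) (apply_bcontfun \<phi>)"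
    by (simp add: Suc[abs_def] integral_bind_pmf_bounded[where B="norm \<phi>"] norm_bounded cong: Bochner_Integration.integral_cong)
  finally show ?case .
qed simp

section \<open>Montel's theorem with moving omitted values\<close>

text \<open>The conclusion that \<open>normal_family\<close> demands of each sequence, split off so
  that it can be proved along a subsequence and then lifted.\<close>

definition subsequence_normal :: "complex set \<Rightarrow> (nat \<Rightarrow> complex \<Rightarrow> complex) \<Rightarrow> bool" where
  "subsequence_normal U s \<longleftrightarrow>
     (\<exists>r :: nat \<Rightarrow> nat. strict_mono r \<and>
        ((\<exists>g. g holomorphic_on U \<and> locally_uniform_limit U (s \<circ> r) g) \<or>
         locally_uniform_limit_infinity U (s \<circ> r)))"

lemma normal_familyI:
  assumes "\<And>s. range s \<subseteq> F \<Longrightarrow> subsequence_normal U s"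
  shows "normal_family U F"
  using assms by (simp add: normal_family_def subsequence_normal_def)

lemma subsequence_normal_subseq:
  assumes "strict_mono r" "subsequence_normal U (s \<circ> r)"
  shows "subsequence_normal U s"
proof -
  obtain q where q: "strict_mono (q::nat\<Rightarrow>nat)"
    "(\<exists>g. g holomorphic_on U \<and> locally_uniform_limit U (s \<circ> r \<circ> q) g) \<or>
         locally_uniform_limit_infinity U (s \<circ> r \<circ> q)"
    using assms(2) unfolding subsequence_normal_def by blast
  then show ?thesis
    unfolding subsequence_normal_def using strict_mono_o[OF assms(1) q(1)]
    by (intro exI[of _ "r \<circ> q"]) (simp add: o_assoc)
qed

lemma ball_neighbourhood:
  fixes z :: complex
  assumes "open U" "z \<in> U"
  obtains e where "e > 0" "cball z e \<subseteq> U" "ball z e \<inter> U \<subseteq> cball z e"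
  using assms open_contains_cball[of U] by (meson IntD1 ball_subset_cball subset_iff)

lemma locally_uniform_limitI:
  assumes "open U" "\<And>K. compact K \<Longrightarrow> K \<subseteq> U \<Longrightarrow> uniform_limit K s g sequentially"
  shows "locally_uniform_limit U s g"
  unfolding locally_uniform_limit_def
proof
  fix z assume "z \<in> U"
  then obtain e where e: "e > 0" "cball z e \<subseteq> U" "ball z e \<inter> U \<subseteq> cball z e"
    using ball_neighbourhood assms(1) by metis
  have "uniform_limit (cball z e) s g sequentially" using assms(2) e by auto
  from uniform_limit_on_subset[OF this e(3)] e(1)
  show "\<exists>V. open V \<and> z \<in> V \<and> uniform_limit (V \<inter> U) s g sequentially"
    by (intro exI[of _ "ball z e"]) auto
qed

lemma locally_uniform_limit_infinityI:
  assumes "open U"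
    "\<And>K M. compact K \<Longrightarrow> K \<subseteq> U \<Longrightarrow> \<forall>\<^sub>F n in sequentially. \<forall>x\<in>K. norm (s n x) \<ge> M"
  shows "locally_uniform_limit_infinity U s"
  unfolding locally_uniform_limit_infinity_def
proof
  fix z assume "z \<in> U"
  then obtain e where e: "e > 0" "cball z e \<subseteq> U" "ball z e \<inter> U \<subseteq> cball z e"
    using ball_neighbourhood assms(1) by metis
  have "\<forall>\<^sub>F n in sequentially. \<forall>x\<in>ball z e \<inter> U. norm (s n x) \<ge> M" for M
    using assms(2)[of "cball z e" M] e by (auto elim!: eventually_mono)
  then show "\<exists>V. open V \<and> z \<in> V \<and> (\<forall>M. \<forall>\<^sub>F n in sequentially. \<forall>x\<in>V \<inter> U. norm (s n x) \<ge> M)"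
    using e(1) by (intro exI[of _ "ball z e"]) auto
qed

text \<open>Functions that omit 0 and 1 and are bounded by 1 at a single point are locally uniformly
  bounded (Schottky), so Montel's theorem for locally bounded families applies.\<close>

lemma omit_01_bounded_subsequence:
  assumes U: "open U" "connected U" "w0 \<in> U"
    and hol: "\<And>i. h i holomorphic_on U" and om: "\<And>i x. x \<in> U \<Longrightarrow> h i x \<noteq> 0 \<and> h i x \<noteq> 1"
    and le: "\<And>i :: nat. norm (h i w0) \<le> 1"
  obtains g r where "g holomorphic_on U" "strict_mono (r :: nat \<Rightarrow> nat)"
    "\<And>K. \<lbrakk>compact K; K \<subseteq> U\<rbrakk> \<Longrightarrow> uniform_limit K (h \<circ> r) g sequentially"
proof (rule Montel[OF U(1), of "range h" h])
  fix K assume K: "compact K" "K \<subseteq> U"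
  obtain B where "\<And>k z. k \<in> range h \<Longrightarrow> z \<in> K \<Longrightarrow> norm (k z) \<le> B"
  proof (rule GPicard3[OF U order_refl _ _ _ K, of "range h"])
    show "k holomorphic_on U" if "k \<in> range h" for k using that hol by auto
    show "k z \<noteq> 0 \<and> k z \<noteq> 1" if "k \<in> range h" "z \<in> U" for k z using that om by auto
    show "norm (k w0) \<le> 1" if "k \<in> range h" for k using that le by auto
  qed blast
  then show "\<exists>B. \<forall>h\<in>range h. \<forall>z\<in>K. norm (h z) \<le> B" by blast
qed (use hol that in auto)

text \<open>Infinitely many values at \<open>w0\<close> lie in the unit disc, or else infinitely
  many reciprocals do, and the reciprocals omit 0 and 1 as well. By Hurwitz, a limit of the
  zero-free reciprocals is zero-free or identically 0. The first case can be inverted back; the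
  second is convergence to infinity.\<close>

theorem Montel_omit_01:
  assumes U: "open U" "connected U" "w0 \<in> U"
    and hol: "\<And>i. h i holomorphic_on U" and om: "\<And>i x. x \<in> U \<Longrightarrow> h i x \<noteq> 0 \<and> h i x \<noteq> 1"
  obtains r where "strict_mono (r :: nat \<Rightarrow> nat)"
    "(\<exists>g. g holomorphic_on U \<and> (\<forall>K. compact K \<and> K \<subseteq> U \<longrightarrow> uniform_limit K (h \<circ> r) g sequentially)) \<or>
     (\<forall>K M. compact K \<and> K \<subseteq> U \<longrightarrow> (\<forall>\<^sub>F n in sequentially. \<forall>x\<in>K. norm (h (r n) x) \<ge> M))"
proof (cases "infinite {i. norm (h i w0) \<le> 1}")
  case True
  then obtain r0 :: "nat \<Rightarrow> nat" where r0: "strict_mono r0" "\<And>i. norm (h (r0 i) w0) \<le> 1"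
    using infinite_enumerate[OF True] by blast
  obtain g r where "g holomorphic_on U" "strict_mono (r :: nat \<Rightarrow> nat)"
      "\<And>K. \<lbrakk>compact K; K \<subseteq> U\<rbrakk> \<Longrightarrow> uniform_limit K ((\<lambda>i. h (r0 i)) \<circ> r) g sequentially"
    by (rule omit_01_bounded_subsequence[OF U, of "\<lambda>i. h (r0 i)"]) (use hol om r0 in auto)
  then show ?thesis
    by (intro that[of "r0 \<circ> r"] strict_mono_o r0(1) disjI1 exI[of _ g]) (auto simp: o_def)
next
  case False
  then have "infinite {i. \<not> norm (h i w0) \<le> 1}"
    using finite_Collect_not by blast
  then obtain r0 :: "nat \<Rightarrow> nat" where r0: "strict_mono r0" "\<And>i. \<not> norm (h (r0 i) w0) \<le> 1"
    using infinite_enumerate by blast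
  define k where "k i x = inverse (h (r0 i) x)" for i x
  have k: "k i holomorphic_on U" "x \<in> U \<Longrightarrow> k i x \<noteq> 0 \<and> k i x \<noteq> 1" for i x
    unfolding k_def
    by (intro holomorphic_intros hol) (use om in blast, use om[of x "r0 i"] in simp)
  have kle: "norm (k i w0) \<le> 1" for i
  proof -
    have "1 \<le> norm (h (r0 i) w0)" using r0(2)[of i] by linarith
    then show ?thesis unfolding k_def norm_inverse by (rule le_imp_inverse_le[of 1, simplified]) 
  qed
  obtain g r where g: "g holomorphic_on U" "strict_mono (r :: nat \<Rightarrow> nat)"
      "\<And>K. \<lbrakk>compact K; K \<subseteq> U\<rbrakk> \<Longrightarrow> uniform_limit K (k \<circ> r) g sequentially"
    by (rule omit_01_bounded_subsequence[where h=k, OF U k(1) k(2) kle]) (assumption, rule that)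
  have sm: "strict_mono (r0 \<circ> r)" using r0(1) g(2) by (rule strict_mono_o)
  show ?thesis
  proof (cases "\<forall>x\<in>U. g x = 0")
    case True
    have "\<forall>\<^sub>F n in sequentially. \<forall>x\<in>K. norm (h ((r0 \<circ> r) n) x) \<ge> M" if K: "compact K" "K \<subseteq> U" for K M
    proof -
      have "\<forall>\<^sub>F n in sequentially. \<forall>x\<in>K. dist ((k \<circ> r) n x) (g x) < 1 / (\<bar>M\<bar> + 1)"
        by (rule uniform_limitD[OF g(3)[OF K]]) simp
      then show ?thesis
      proof (rule eventually_mono, intro ballI)
        fix n x assume n: "\<forall>x\<in>K. dist ((k \<circ> r) n x) (g x) < 1 / (\<bar>M\<bar> + 1)" and x: "x \<in> K"
        then have "inverse (norm (h (r0 (r n)) x)) < inverse (\<bar>M\<bar> + 1)"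
          using bspec[OF n x] True K(2)
          by (simp add: k_def norm_inverse inverse_eq_divide norm_divide subset_eq)
        moreover have "norm (h (r0 (r n)) x) > 0" using om x K(2) by auto
        ultimately show "norm (h ((r0 \<circ> r) n) x) \<ge> M"
          by (subst (asm) inverse_less_iff_less) auto
      qed
    qed
    with that[OF sm] show ?thesis by blast
  next
    case False
    have gnz: "g x \<noteq> 0" if "x \<in> U" for x
    proof (cases "g constant_on U")
      case True
      then show ?thesis using \<open>\<not> (\<forall>x\<in>U. g x = 0)\<close> that by (metis constant_on_def)
    next
      case False
      show ?thesis
        by (rule Hurwitz_no_zeros[OF U(1,2) _ g(1) g(3) False _ that])
           (use k in \<open>auto simp: o_def\<close>)
    qed
    have "uniform_limit K (h \<circ> (r0 \<circ> r)) (\<lambda>x. inverse (g x)) sequentially" if K: "compact K" "K \<subseteq> U" for K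
    proof (cases "K = {}")
      case False
      have "continuous_on K (\<lambda>x. norm (g x))"
        by (intro continuous_intros holomorphic_on_imp_continuous_on holomorphic_on_subset[OF g(1) K(2)])
      then obtain x0 where x0: "x0 \<in> K" "\<And>x. x \<in> K \<Longrightarrow> norm (g x0) \<le> norm (g x)"
        using continuous_attains_inf[OF K(1) False] by blast
      have "uniform_limit K (\<lambda>i x. inverse ((k \<circ> r) i x)) (inverse \<circ> g) sequentially"
        by (rule uniform_lim_inverse[OF g(3)[OF K] x0(2)]) (use gnz x0 K in auto)
      then show ?thesis by (simp add: k_def o_def)
    qed simp
    moreover have "(\<lambda>x. inverse (g x)) holomorphic_on U"
      using g(1) gnz by (intro holomorphic_intros) auto
    ultimately show ?thesis using that[OF sm] by blast
  qed
qed

text \<open>An affine change of the values, depending on \<open>i\<close>, moves \<open>a i\<close>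
  and \<open>b i\<close> to 0 and 1. As \<open>a0\<close> and \<open>b0\<close> differ, these
  changes converge to an invertible one, so either alternative of Montel's theorem survives undoing
  them.\<close>

theorem Montel_moving_values:
  fixes a b :: "nat \<Rightarrow> complex"
  assumes U: "open U" "connected U" "w0 \<in> U"
    and hol: "\<And>i. s i holomorphic_on U" and om: "\<And>i x. x \<in> U \<Longrightarrow> s i x \<noteq> a i \<and> s i x \<noteq> b i"
    and ne: "\<And>i. a i \<noteq> b i" and lim: "a \<longlonglongrightarrow> a0" "b \<longlonglongrightarrow> b0" "a0 \<noteq> b0"
  shows "subsequence_normal U s"
proof -
  define h where "h i x = (s i x - a i) / (b i - a i)" for i x
  have h: "h i holomorphic_on U" "x \<in> U \<Longrightarrow> h i x \<noteq> 0 \<and> h i x \<noteq> 1" for i x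
    unfolding h_def
    by (intro holomorphic_intros hol) (use ne[of i] in simp, use ne[of i] om[of x i] in \<open>auto simp: divide_eq_eq\<close>)
  obtain r where r: "strict_mono (r :: nat \<Rightarrow> nat)"
    "(\<exists>g. g holomorphic_on U \<and> (\<forall>K. compact K \<and> K \<subseteq> U \<longrightarrow> uniform_limit K (h \<circ> r) g sequentially)) \<or>
     (\<forall>K M. compact K \<and> K \<subseteq> U \<longrightarrow> (\<forall>\<^sub>F n in sequentially. \<forall>x\<in>K. norm (h (r n) x) \<ge> M))"
    by (rule Montel_omit_01[where h=h, OF U h(1) h(2)]) (assumption, rule that)
  have s: "s i x = a i + (b i - a i) * h i x" for i x
    using ne[of i] by (simp add: h_def)
  have ra: "(\<lambda>n. a (r n)) \<longlonglongrightarrow> a0" and rb: "(\<lambda>n. b (r n)) \<longlonglongrightarrow> b0"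
    using lim r(1) LIMSEQ_subseq_LIMSEQ[unfolded o_def] by blast+
  have rd: "(\<lambda>n. b (r n) - a (r n)) \<longlonglongrightarrow> b0 - a0" using ra rb by (intro tendsto_intros)
  show ?thesis
  proof (cases "\<exists>g. g holomorphic_on U \<and> (\<forall>K. compact K \<and> K \<subseteq> U \<longrightarrow> uniform_limit K (h \<circ> r) g sequentially)")
    case True
    then obtain g where g: "g holomorphic_on U"
      "\<And>K. compact K \<Longrightarrow> K \<subseteq> U \<Longrightarrow> uniform_limit K (h \<circ> r) g sequentially" by blast
    have "locally_uniform_limit U (s \<circ> r) (\<lambda>x. a0 + (b0 - a0) * g x)"
    proof (rule locally_uniform_limitI[OF U(1)])
      fix K assume K: "compact K" "K \<subseteq> U"
      have cl: "uniform_limit K (\<lambda>n x. c (r n)) (\<lambda>x. c0) sequentially" 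
        if "(\<lambda>n. c (r n)) \<longlonglongrightarrow> c0" for c :: "nat \<Rightarrow> complex" and c0
        using that unfolding uniform_limit_iff tendsto_iff by (auto elim: eventually_mono)
      have "bounded (g ` K)"
        by (intro compact_imp_bounded compact_continuous_image K
            holomorphic_on_imp_continuous_on holomorphic_on_subset[OF g(1) K(2)])
      then have "uniform_limit K (\<lambda>n x. (b (r n) - a (r n)) * (h \<circ> r) n x) (\<lambda>x. (b0 - a0) * g x) sequentially"
        by (intro uniform_lim_mult[OF cl[of "\<lambda>i. b i - a i", OF rd] g(2)[OF K]]) (auto simp: image_constant_conv)
      from uniform_limit_add[OF cl[OF ra] this]
      show "uniform_limit K (s \<circ> r) (\<lambda>x. a0 + (b0 - a0) * g x) sequentially"
        by (simp add: s[abs_def] o_def)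
    qed
    moreover have "(\<lambda>x. a0 + (b0 - a0) * g x) holomorphic_on U"
      using g(1) by (intro holomorphic_intros)
    ultimately show ?thesis unfolding subsequence_normal_def using r(1) by blast
  next
    case False
    then have inf: "\<And>K M. compact K \<Longrightarrow> K \<subseteq> U \<Longrightarrow> \<forall>\<^sub>F n in sequentially. \<forall>x\<in>K. norm (h (r n) x) \<ge> M"
      using r(2) by blast
    have "locally_uniform_limit_infinity U (s \<circ> r)"
    proof (rule locally_uniform_limit_infinityI[OF U(1)])
      fix K M assume K: "compact K" "K \<subseteq> U"
      \<comment> \<open>Half of the limiting distance is eventually a lower bound for the stretching
        factor \<open>norm (b - a)\<close>.\<close>
      let ?c = "norm (b0 - a0) / 2"
      have c: "?c > 0" using lim(3) by simp
      have "\<forall>\<^sub>F n in sequentially. norm (b (r n) - a (r n)) > ?c"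
        using tendsto_norm[OF rd] lim(3) by (intro order_tendstoD(1)) auto
      moreover have "\<forall>\<^sub>F n in sequentially. norm (a (r n)) < norm a0 + 1"
        using tendsto_norm[OF ra] by (intro order_tendstoD(2)) auto
      moreover note inf[OF K, of "(\<bar>M\<bar> + norm a0 + 1) / ?c"]
      ultimately show "\<forall>\<^sub>F n in sequentially. \<forall>x\<in>K. norm ((s \<circ> r) n x) \<ge> M"
      proof eventually_elim
        case (elim n)
        show ?case
        proof
          fix x assume "x \<in> K"
          then have "(\<bar>M\<bar> + norm a0 + 1) / ?c \<le> norm (h (r n) x)" using elim by blast
          then have "\<bar>M\<bar> + norm a0 + 1 \<le> ?c * norm (h (r n) x)"
            using c by (simp only: pos_divide_le_eq mult.commute)
          also have "\<dots> \<le> norm (b (r n) - a (r n)) * norm (h (r n) x)"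
            using elim(1) by (intro mult_right_mono) auto
          finally have "\<bar>M\<bar> + norm a0 + 1 \<le> norm ((b (r n) - a (r n)) * h (r n) x)"
            by (simp add: norm_mult)
          moreover have "norm ((b (r n) - a (r n)) * h (r n) x) - norm (a (r n)) \<le> norm (s (r n) x)"
            unfolding s by (metis add.commute norm_diff_ineq)
          ultimately show "M \<le> norm ((s \<circ> r) n x)" using elim(2) by simp
        qed
      qed
    qed
    then show ?thesis unfolding subsequence_normal_def using r(1) by blast
  qed
qed

section \<open>Backward invariant targets and the Julia set\<close>

text \<open>A multiple preimage counts once: the point is to have two different values for the
  iterates to omit.\<close>

definition two_preimages :: "(complex \<Rightarrow> complex) \<Rightarrow> nat \<Rightarrow> complex \<Rightarrow> bool" where
  "two_preimages f k w \<longleftrightarrow> (\<exists>a b. a \<noteq> b \<and> (f ^^ k) a = w \<and> (f ^^ k) b = w)"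

lemma open_image_surj_holomorphic:
  assumes "f holomorphic_on UNIV" "surj f" "open U"
  shows "open (f ` U)"
proof (rule open_mapping_thm[OF assms(1) open_UNIV connected_UNIV assms(3) subset_UNIV])
  have "(0::complex) = 1" if "\<And>x. f x = c" for c
    using that assms(2) by (metis surj_def)
  then show "\<not> f constant_on UNIV" by (auto simp: constant_on_def)
qed

lemma two_preimages_mono:
  assumes "surj f" "two_preimages f k w" "k \<le> l"
  shows "two_preimages f l w"
  using assms(3,2)
proof (induction l rule: dec_induct)
  case (step n)
  then obtain a b where ab: "a \<noteq> b" "(f ^^ n) a = w" "(f ^^ n) b = w"
    by (auto simp: two_preimages_def)
  obtain a' b' where "f a' = a" "f b' = b" using assms(1) by (metis surjD)
  with ab show ?case
    unfolding two_preimages_def by (intro exI[of _ a'] exI[of _ b']) (auto simp: funpow_swap1)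
qed

text \<open>By the open mapping theorem, all points near \<open>w\<close> have preimages close to
  \<open>a\<close> and close to \<open>b\<close>. The factor 3 leaves a distance of at least
  \<open>d\<close> between the two discs of radius \<open>d\<close>.\<close>

lemma two_preimages_nearby:
  assumes "f holomorphic_on UNIV" "surj f" "two_preimages f k w"
  obtains a b d where "d > 0" "dist a b = 3 * d" "\<forall>\<^sub>F v in nhds w. v \<in> (f ^^ k) ` ball a d \<inter> (f ^^ k) ` ball b d"
proof -
  obtain a b where ab: "a \<noteq> b" "(f ^^ k) a = w" "(f ^^ k) b = w"
    using assms(3) by (auto simp: two_preimages_def)
  define d where "d = dist a b / 3"
  have d: "d > 0" "dist a b = 3 * d" using ab by (auto simp: d_def)
  have "\<forall>\<^sub>F v in nhds w. v \<in> (f ^^ k) ` ball c d" if "(f ^^ k) c = w" for c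
    using that d(1) open_image_surj_holomorphic[OF surj_holomorphic_iterate[OF assms(1,2)] open_ball]
    by (intro eventually_nhds_in_open) auto
  from eventually_conj[OF this[OF ab(2)] this[OF ab(3)]] d show ?thesis
    by (intro that[of d a b]) auto
qed

text \<open>Having two preimages is an open condition, and by surjectivity it persists as
  \<open>k\<close> grows. A finite subcover and its largest index give a single
  \<open>k\<close>.\<close>

lemma two_preimages_uniform:
  assumes "f holomorphic_on UNIV" "surj f" "compact K" "\<And>w. w \<in> K \<Longrightarrow> \<exists>k. two_preimages f k w"
  obtains k where "\<And>w. w \<in> K \<Longrightarrow> two_preimages f k w"
proof -
  define O' where "O' k = interior {w. two_preimages f k w}" for k
  have cov: "K \<subseteq> (\<Union>k\<in>UNIV. O' k)"
  proof
    fix w assume "w \<in> K"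
    then obtain k where k: "two_preimages f k w" using assms(4) by blast
    obtain a b d where d: "d > 0" "dist a b = 3 * d"
      "\<forall>\<^sub>F v in nhds w. v \<in> (f ^^ k) ` ball a d \<inter> (f ^^ k) ` ball b d"
      using two_preimages_nearby[OF assms(1,2) k] .
    have "ball a d \<inter> ball b d = {}"
      by (rule disjoint_ballI) (use d(1,2) in linarith)
    have "two_preimages f k v" if v: "v \<in> (f ^^ k) ` ball a d \<inter> (f ^^ k) ` ball b d" for v
    proof -
      obtain x y where "x \<in> ball a d" "y \<in> ball b d" "(f ^^ k) x = v" "(f ^^ k) y = v"
        using v by (elim IntE imageE) (metis (no_types))
      moreover from this have "x \<noteq> y" using \<open>ball a d \<inter> ball b d = {}\<close> by (metis IntI emptyE)
      ultimately show ?thesis unfolding two_preimages_def by (metis (no_types))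
    qed
    then have "\<forall>\<^sub>F v in nhds w. two_preimages f k v"
      by (rule eventually_mono[OF d(3)])
    then have "w \<in> O' k"
      unfolding O'_def interior_def eventually_nhds by blast
    then show "w \<in> (\<Union>k\<in>UNIV. O' k)" by blast
  qed
  obtain F where F: "finite F" "K \<subseteq> (\<Union>k\<in>F. O' k)"
    by (rule compactE_image[OF assms(3) _ cov]) (auto simp: O'_def)
  show ?thesis
  proof (rule that[of "Max F"])
    fix w assume "w \<in> K"
    then obtain k where "k \<in> F" "w \<in> O' k" using F by blast
    then have "two_preimages f k w" using interior_subset by (auto simp: O'_def)
    then show "two_preimages f (Max F) w"
      by (rule two_preimages_mono[OF assms(2)]) (use F \<open>k \<in> F\<close> in simp)
  qed
qed

text \<open>A disc that misses \<open>E 0\<close> is mapped by \<open>f^m\<close> into the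
  complement of \<open>E m\<close>. A point of \<open>E (m + k)\<close> in \<open>K\<close> has two
  preimages under \<open>f^k\<close>; both lie in \<open>E m\<close>, so both are omitted by
  \<open>f^m\<close> on the disc. Compactness of \<open>K\<close> makes the omitted pairs converge
  along a subsequence.\<close>

theorem julia_subset_closure_targets:
  assumes f: "f holomorphic_on UNIV" "surj f" and K: "compact K"
    and two: "\<And>w. w \<in> K \<Longrightarrow> \<exists>k. two_preimages f k w"
    and E: "\<And>n z. f z \<in> E (Suc n) \<Longrightarrow> z \<in> E n" "\<And>n. E n \<inter> K \<noteq> {}"
  shows "julia_set f \<subseteq> closure (E 0)"
proof
  fix z assume "z \<in> julia_set f"
  show "z \<in> closure (E 0)"
  proof (rule ccontr)
    assume "z \<notin> closure (E 0)"
    then obtain e where e: "e > 0" "ball z e \<inter> E 0 = {}"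
      using open_contains_ball[of "- closure (E 0)"] closure_subset[of "E 0"] by blast
    have Ek: "(f ^^ k) x \<in> E (n + k) \<Longrightarrow> x \<in> E n" for n k x
      by (induction k arbitrary: n) (auto dest: E(1))
    obtain k where k: "\<And>w. w \<in> K \<Longrightarrow> two_preimages f k w"
      using two_preimages_uniform[OF f K two] by blast
    have "normal_family (ball z e) (range (\<lambda>n. f ^^ n))"
    proof (rule normal_familyI)
      fix s :: "nat \<Rightarrow> complex \<Rightarrow> complex" assume "range s \<subseteq> range (\<lambda>n. f ^^ n)"
      then have "\<forall>i. \<exists>m. s i = f ^^ m" by auto
      then obtain m where m: "\<And>i. s i = f ^^ m i" by metis
      have "\<forall>i. \<exists>w. w \<in> E (m i + k) \<inter> K" using E(2) by blast
      then obtain w where w: "\<And>i. w i \<in> E (m i + k)" "\<And>i. w i \<in> K" by (metis IntE)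
      obtain w' r where r: "w' \<in> K" "strict_mono (r :: nat \<Rightarrow> nat)" "(w \<circ> r) \<longlonglongrightarrow> w'"
        using w(2) by (rule_tac seq_compactE[OF compact_imp_seq_compact[OF K], of w]) (auto intro: that)
      obtain a b d where d: "d > 0" "dist a b = 3 * d"
        "\<forall>\<^sub>F v in nhds w'. v \<in> (f ^^ k) ` ball a d \<inter> (f ^^ k) ` ball b d"
        using two_preimages_nearby[OF f k[OF r(1)]] .
      have "\<forall>\<^sub>F i in sequentially. w (r i) \<in> (f ^^ k) ` ball a d \<inter> (f ^^ k) ` ball b d"
        using eventually_compose_filterlim[OF d(3) r(3)] by simp
      then obtain i0 where i0: "\<And>i. w (r (i + i0)) \<in> (f ^^ k) ` ball a d \<inter> (f ^^ k) ` ball b d"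
        unfolding eventually_sequentially by (metis le_add2)
      define q where "q i = r (i + i0)" for i
      have q: "strict_mono q" using r(2) by (auto simp: q_def strict_mono_def)
      have "\<exists>a'. a' \<in> ball a d \<and> (f ^^ k) a' = w (q i)"
        "\<exists>b'. b' \<in> ball b d \<and> (f ^^ k) b' = w (q i)" for i
        using i0[of i] unfolding q_def by (elim IntE imageE; metis)+
      then obtain a' b' where ab: "\<And>i. a' i \<in> ball a d" "\<And>i. b' i \<in> ball b d"
        "\<And>i. (f ^^ k) (a' i) = w (q i)" "\<And>i. (f ^^ k) (b' i) = w (q i)" by metis
      \<comment> \<open>The pairs are extracted jointly because both sequences must converge along
        the same indices. The closed discs are still disjoint, which keeps the limits
        distinct.\<close>
      have "compact (cball a d \<times> cball b d)" by (intro compact_Times compact_cball)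
      moreover have "\<forall>i. (a' i, b' i) \<in> cball a d \<times> cball b d"
        using ab(1,2) by (auto simp: less_imp_le)
      ultimately obtain l p where p: "l \<in> cball a d \<times> cball b d" "strict_mono (p :: nat \<Rightarrow> nat)"
          "((\<lambda>i. (a' i, b' i)) \<circ> p) \<longlonglongrightarrow> l"
        by (rule seq_compactE[OF compact_imp_seq_compact]) (rule that)
      have ne: "x \<noteq> y" if "x \<in> cball a d" "y \<in> cball b d" for x y
        using that d(1,2) dist_triangle2[of a b x] by (auto simp: dist_commute)
      have om: "(f ^^ m i) x \<noteq> c" if "x \<in> ball z e" "c \<in> E (m i)" for i x c
        using that e(2) Ek[of "m i" x 0] by auto
      have "subsequence_normal (ball z e) (s \<circ> (q \<circ> p))"
      proof (rule Montel_moving_values[where a = "a' \<circ> p" and b = "b' \<circ> p" and ?w0.0 = z])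
        show "(a' \<circ> p) \<longlonglongrightarrow> fst l" "(b' \<circ> p) \<longlonglongrightarrow> snd l"
          using tendsto_fst[OF p(3)] tendsto_snd[OF p(3)] by (auto simp: o_def)
        show "fst l \<noteq> snd l" using p(1) by (intro ne) (auto simp: mem_Times_iff)
        show "(a' \<circ> p) i \<noteq> (b' \<circ> p) i" for i
          using ab(1,2)[of "p i"] by (intro ne) (auto simp: less_imp_le)
        show "(s \<circ> (q \<circ> p)) i holomorphic_on ball z e" for i
          using surj_holomorphic_iterate(1)[OF f] by (auto simp: m intro: holomorphic_on_subset)
        fix i x assume x: "x \<in> ball z e"
        have "a' (p i) \<in> E (m (q (p i)))" "b' (p i) \<in> E (m (q (p i)))"
          by (rule Ek[where k=k], simp only: ab w)+
        then show "(s \<circ> (q \<circ> p)) i x \<noteq> (a' \<circ> p) i \<and> (s \<circ> (q \<circ> p)) i x \<noteq> (b' \<circ> p) i"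
          using om[OF x] by (auto simp: m)
      qed (use e in auto)
      then show "subsequence_normal (ball z e) s"
        by (rule subsequence_normal_subseq[OF strict_mono_o[OF q p(2)]])
    qed
    then have "z \<in> fatou_set f"
      unfolding fatou_set_def using e(1) by (intro CollectI exI[of _ "ball z e"]) auto
    then show False using \<open>z \<in> julia_set f\<close> by (simp add: julia_set_def)
  qed
qed

text \<open>Infinitely many points have a one-point fibre. An essential singularity of
  \<open>f\<close> at infinity would contradict Picard's great theorem, so \<open>f\<close> is a
  polynomial, and \<open>f - x k\<close> has the only root \<open>x (Suc k)\<close>, hence is a
  multiple of a power of a linear factor. Two such forms for one \<open>f\<close> leave only the
  exponent 1.\<close>

lemma single_preimages_poly:
  assumes f: "f holomorphic_on UNIV" "surj f"
    and x: "\<And>k u. f u = x k \<longleftrightarrow> u = x (Suc k)" and inj: "inj x"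
  obtains c d where "c \<noteq> 0" "\<And>z. f z = c * z + d"
proof -
  have inf: False if lim: "(f \<longlongrightarrow> l) at_infinity" for l
    using Liouville_weak[OF f(1) lim] f(2) by (metis surjD zero_neq_one)
  \<comment> \<open>This moves the singularity at infinity to 0. A finite limit is excluded by
    Liouville; a limit of \<open>1 / F\<close> would mean that \<open>f\<close> is a
    polynomial.\<close>
  define F where "F z = f (inverse z)" for z
  have "\<exists>l. ((inverse \<circ> F) \<longlongrightarrow> l) (at 0)"
  proof (rule ccontr)
    assume no: "\<not> ?thesis"
    have hol: "F holomorphic_on (UNIV - {0})"
      unfolding F_def
      by (rule holomorphic_on_compose_gen[unfolded o_def, OF _ f(1)]) (auto intro!: holomorphic_intros)
    have non: "\<not> (F \<longlongrightarrow> l) (at 0)" for l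
      using inf[of l] lim_at_infinity_0[of f l] by (auto simp: F_def[abs_def] o_def)
    obtain a where a: "\<And>w. w \<noteq> a \<Longrightarrow> infinite {z. z \<in> UNIV - {0} \<and> F z = w}"
      by (rule great_Picard_infinite[OF open_UNIV UNIV_I hol non]) (use no in auto)
    obtain k where k: "x k \<noteq> a"
      using injD[OF inj, of 0 1] by (metis zero_neq_one)
    have "{z. z \<in> UNIV - {0} \<and> F z = x k} \<subseteq> {inverse (x (Suc k))}"
    proof
      fix z assume "z \<in> {z. z \<in> UNIV - {0} \<and> F z = x k}"
      then have "inverse z = x (Suc k)" by (simp add: F_def x)
      then show "z \<in> {inverse (x (Suc k))}" by (metis inverse_inverse_eq singletonI)
    qed
    then show False using a[OF k] finite_subset by blast
  qed
  then obtain l where "((inverse \<circ> F) \<longlongrightarrow> l) (at 0)" by blast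
  then have "((inverse \<circ> f) \<longlongrightarrow> l) at_infinity"
    by (simp add: lim_at_infinity_0 F_def[abs_def] o_def)
  then obtain cf n where cf: "\<And>z. f z = (\<Sum>i\<le>n. cf i * z ^ i)"
    using pole_at_infinity[OF f(1)] by blast
  define p where "p = (\<Sum>i\<le>n. monom (cf i) i)"
  have p: "f z = poly p z" for z by (simp add: p_def poly_sum poly_monom cf)
  have form: "\<exists>c m. c \<noteq> 0 \<and> m > 0 \<and> (\<forall>z. f z = c * (z - x (Suc k)) ^ m + x k)" for k
  proof -
    define q where "q = p - [:x k:]"
    have q: "poly q z = f z - x k" for z by (simp add: q_def p)
    have rt: "{z. poly q z = 0} = {x (Suc k)}" by (auto simp: q x)
    define m where "m = order (x (Suc k)) q"
    have "smult (lead_coeff q) ([:- x (Suc k), 1:] ^ m) = q"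
      using complex_poly_decompose[of q] by (simp add: rt m_def)
    then have *: "f z = lead_coeff q * (z - x (Suc k)) ^ m + x k" for z
      using arg_cong[of _ _ "\<lambda>r. poly r z", of _ q] q[of z]
      by (metis (no_types, lifting) add.commute diff_add_cancel poly_pCons poly_0 poly_power poly_smult mult.right_neutral mult_zero_right add_0_right diff_conv_add_uminus add.commute mult_1_right)
    obtain u where "f u = x k + 1" using f(2) by (metis surjD)
    then have "lead_coeff q \<noteq> 0" using *[of u] by auto
    moreover have "m > 0"
      using *[of "x (Suc k)"] x[of "x (Suc k)" k] calculation by (cases m) auto
    ultimately show ?thesis using * by blast
  qed
  obtain c m where c: "c \<noteq> 0" "m > 0" "\<And>z. f z = c * (z - x 1) ^ m + x 0"
    using form[of 0] by auto
  obtain c' m' where c': "c' \<noteq> 0" "m' > 0" "\<And>z. f z = c' * (z - x 2) ^ m' + x 1"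
    using form[of 1] by (auto simp: numeral_2_eq_2)
  \<comment> \<open>If \<open>m > 1\<close>, the form obtained from \<open>x 0\<close> makes
    \<open>x 1\<close> a critical point, while the form obtained from \<open>x 1\<close> has a
    nonzero derivative there because \<open>x 1\<close> and \<open>x 2\<close> differ.\<close>
  have "m = 1"
  proof (rule ccontr)
    assume "m \<noteq> 1"
    have "f = (\<lambda>z. c * (z - x 1) ^ m + x 0)" using c(3) by blast
    then have "(f has_field_derivative c * (of_nat m * (x 1 - x 1) ^ (m - 1))) (at (x 1))"
      by (auto intro!: derivative_eq_intros)
    moreover have "f = (\<lambda>z. c' * (z - x 2) ^ m' + x 1)" using c'(3) by blast
    then have "(f has_field_derivative c' * (of_nat m' * (x 1 - x 2) ^ (m' - 1))) (at (x 1))"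
      by (auto intro!: derivative_eq_intros)
    ultimately have "c * (of_nat m * (x 1 - x 1) ^ (m - 1)) = c' * (of_nat m' * (x 1 - x 2) ^ (m' - 1))"
      by (rule DERIV_unique)
    moreover have "x 1 \<noteq> x 2" using injD[OF inj, of 1 2] by auto
    ultimately show False using c' c(2) \<open>m \<noteq> 1\<close> by (auto simp: power_0_left)
  qed
  then show ?thesis using c by (intro that[of c "x 0 - c * x 1"]) (auto simp: algebra_simps)
qed

text \<open>Otherwise the backward orbit of \<open>w\<close> is a sequence \<open>x\<close> without
  branching. It is infinite because \<open>w\<close> is not exceptional, hence injective, hence
  \<open>f\<close> is affine. The second hypothesis on \<open>K\<close> excludes translations, the
  first on exceptional points all other affine maps.\<close>

lemma exists_two_preimages:
  assumes f: "f holomorphic_on UNIV" "surj f" and ex: "\<forall>z. \<not> exceptional f z"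
    and K: "bounded K" "\<forall>\<^sub>F n in sequentially. (f ^^ n) -` {w} \<inter> K \<noteq> {}"
  shows "\<exists>k. two_preimages f k w"
proof (rule ccontr)
  assume no: "\<not> ?thesis"
  have "\<exists>u. (f ^^ k) u = w" for k
    using surj_holomorphic_iterate(2)[OF f] by (metis surjD)
  then obtain x where x: "\<And>k. (f ^^ k) (x k) = w" by metis
  have uniq: "u = x k" if "(f ^^ k) u = w" for k u
    using no that x unfolding two_preimages_def by metis
  have step: "f u = x k \<longleftrightarrow> u = x (Suc k)" for k u
  proof
    show "f u = x k \<Longrightarrow> u = x (Suc k)"
      using x[of k] by (intro uniq) (simp add: funpow_swap1)
    show "u = x (Suc k) \<Longrightarrow> f u = x k"
      using x[of "Suc k"] by (intro uniq) (simp add: funpow_swap1)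
  qed
  have orb: "(\<Union>n. (f ^^ n) -` {w}) = range x"
    using uniq x by auto
  have inf: "infinite (range x)" using ex orb unfolding exceptional_def by metis
  have inj: "inj x"
  proof (rule ccontr)
    assume "\<not> inj x"
    then obtain i j where ij: "i < j" "x i = x j"
      unfolding inj_def by (metis linorder_neqE_nat)
    \<comment> \<open>A repetition persists, because each point has only one preimage; the orbit is
      then confined to its first \<open>j\<close> points.\<close>
    have per: "x (i + n) = x (j + n)" for n
    proof (induction n)
      case (Suc n)
      have "f (x (i + Suc n)) = x (i + n)" using step[of "x (i + Suc n)" "i + n"] by simp
      then have "f (x (i + Suc n)) = x (j + n)" using Suc by simp
      then show ?case using step[of "x (i + Suc n)" "j + n"] by simp
    qed (use ij in simp)
    have "x n \<in> x ` {..<j}" for n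
    proof (induction n rule: less_induct)
      case (less n)
      show ?case
      proof (cases "n < j")
        case False
        then have "x n = x (i + (n - j))" using per[of "n - j"] by simp
        moreover have "i + (n - j) < n" using False ij by simp
        ultimately show ?thesis using less by metis
      qed simp
    qed
    then have "range x \<subseteq> x ` {..<j}" by auto
    then show False using inf finite_subset by blast
  qed
  obtain c d where c: "c \<noteq> 0" "\<And>z. f z = c * z + d"
    by (rule single_preimages_poly[OF f step inj]) (rule that)
  show False
  proof (cases "c = 1")
    case False
    \<comment> \<open>The fixed point of an affine map with multiplier other than 1; being its own
      only preimage, it is exceptional.\<close>
    define p where "p = d / (1 - c)"
    have fp: "f u = p \<longleftrightarrow> u = p" for u
    proof -
      have "c * p + d = p" using False by (simp add: p_def field_simps)
      then have "f u = p \<longleftrightarrow> c * u = c * p" by (metis c(2) add_right_cancel)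
      then show ?thesis using c(1) by simp
    qed
    have "(f ^^ n) u = p \<longleftrightarrow> u = p" for n u
      by (induction n arbitrary: u) (auto simp: fp)
    then have "(\<Union>n. (f ^^ n) -` {p}) \<subseteq> {p}" by auto
    then show False using ex finite_subset unfolding exceptional_def by blast
  next
    case True
    \<comment> \<open>For a translation the backward orbit tends to infinity, against its staying in
      the bounded set \<open>K\<close> from some index on.\<close>
    have xk: "x k = x 0 - of_nat k * d" for k
    proof (induction k)
      case (Suc k)
      have "x k = x (Suc k) + d" using step[of "x (Suc k)" k] c(2) True by simp
      then show ?case using Suc by (simp add: algebra_simps)
    qed simp
    obtain B where B: "\<And>z. z \<in> K \<Longrightarrow> norm z \<le> B" using K(1) by (auto simp: bounded_iff)
    obtain n0 where n0: "\<And>n. n \<ge> n0 \<Longrightarrow> norm (x n) \<le> B"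
      using K(2) B uniq unfolding eventually_sequentially by blast
    have "d \<noteq> 0" using xk[of 1] injD[OF inj, of 0 1] by auto
    obtain n :: nat where n: "real n > (B + norm (x 0)) / norm d"
      using reals_Archimedean2 by blast
    then have "real (max n n0) > (B + norm (x 0)) / norm d" by linarith
    then have "real (max n n0) * norm d > B + norm (x 0)"
      using \<open>d \<noteq> 0\<close> by (simp add: field_simps)
    moreover have "real (max n n0) * norm d \<le> norm (x (max n n0)) + norm (x 0)"
    proof -
      have "real (max n n0) * norm d = norm (x 0 - x (max n n0))"
        by (simp add: xk[of "max n n0"] norm_mult del: of_nat_max)
      then show ?thesis using norm_triangle_ineq4[of "x 0" "x (max n n0)"] by simp
    qed
    ultimately show False using n0[of "max n n0"] by simp
  qed
qed

section \<open>Nonemptiness of the Julia set\<close>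

text \<open>\<open>bounded_near\<close> and \<open>infinite_near\<close> are pointwise forms of the
  two alternatives in Montel's theorem. They are open, mutually exclusive and inherited by
  subsequences, as the connectedness argument requires.\<close>

definition bounded_near :: "(nat \<Rightarrow> complex \<Rightarrow> complex) \<Rightarrow> complex \<Rightarrow> bool" where
  "bounded_near s p \<longleftrightarrow> (\<exists>V M. open V \<and> p \<in> V \<and> (\<forall>\<^sub>F n in sequentially. \<forall>x\<in>V. norm (s n x) \<le> M))"

definition infinite_near :: "(nat \<Rightarrow> complex \<Rightarrow> complex) \<Rightarrow> complex \<Rightarrow> bool" where
  "infinite_near s p \<longleftrightarrow> (\<exists>V. open V \<and> p \<in> V \<and> (\<forall>M. \<forall>\<^sub>F n in sequentially. \<forall>x\<in>V. norm (s n x) \<ge> M))"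

lemma bounded_infinite_near_subseq:
  assumes "strict_mono r"
  shows "bounded_near s p \<Longrightarrow> bounded_near (s \<circ> r) p"
    and "infinite_near s p \<Longrightarrow> infinite_near (s \<circ> r) p"
  using eventually_subseq[OF assms] unfolding bounded_near_def infinite_near_def by fastforce+

lemma not_bounded_and_infinite_near: "\<not> (bounded_near s p \<and> infinite_near s p)"
proof
  assume *: "bounded_near s p \<and> infinite_near s p"
  then obtain V M where "p \<in> V" "\<forall>\<^sub>F n in sequentially. \<forall>x\<in>V. norm (s n x) \<le> M"
    by (auto simp: bounded_near_def)
  moreover obtain W where "p \<in> W" "\<forall>\<^sub>F n in sequentially. \<forall>x\<in>W. norm (s n x) \<ge> M + 1"
    using * unfolding infinite_near_def by metis
  ultimately have "\<forall>\<^sub>F n in sequentially. norm (s n p) \<le> M \<and> norm (s n p) \<ge> M + 1"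
    by (auto elim: eventually_elim2)
  then show False by (auto simp: eventually_sequentially)
qed

lemma open_near: "open {p. bounded_near s p}" "open {p. infinite_near s p}"
  by (subst open_subopen; force simp: bounded_near_def infinite_near_def)+

lemma normal_family_near:
  assumes "open U" "normal_family U F" "range s \<subseteq> F"
  obtains r where "strict_mono (r :: nat \<Rightarrow> nat)"
    "(\<forall>p\<in>U. bounded_near (s \<circ> r) p) \<or> (\<forall>p\<in>U. infinite_near (s \<circ> r) p)"
proof -
  obtain r where r: "strict_mono (r :: nat \<Rightarrow> nat)"
    "(\<exists>g. g holomorphic_on U \<and> locally_uniform_limit U (s \<circ> r) g) \<or>
         locally_uniform_limit_infinity U (s \<circ> r)"
    using assms(2,3) unfolding normal_family_def by blast
  have "bounded_near (s \<circ> r) p"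
    if g: "g holomorphic_on U" "locally_uniform_limit U (s \<circ> r) g" "p \<in> U" for g p
  proof -
    obtain V where V: "open V" "p \<in> V" "uniform_limit (V \<inter> U) (s \<circ> r) g sequentially"
      using g(2,3) unfolding locally_uniform_limit_def by blast
    have "\<forall>\<^sub>F x in nhds p. norm (g x) < norm (g p) + 1"
    proof (rule order_tendstoD(2))
      have "continuous (at p) g"
        using holomorphic_on_imp_continuous_on[OF g(1)] assms(1) g(3) continuous_on_eq_continuous_at by blast
      then show "((\<lambda>x. norm (g x)) \<longlongrightarrow> norm (g p)) (nhds p)"
        by (intro tendsto_norm) (simp add: continuous_at tendsto_nhds_iff)
    qed simp
    then obtain W where W: "open W" "p \<in> W" "\<And>x. x \<in> W \<Longrightarrow> norm (g x) < norm (g p) + 1"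
      by (auto simp: eventually_nhds)
    have "\<forall>\<^sub>F n in sequentially. \<forall>x\<in>V \<inter> U. dist ((s \<circ> r) n x) (g x) < 1"
      by (rule uniform_limitD[OF V(3)]) simp
    then have "\<forall>\<^sub>F n in sequentially. \<forall>x\<in>V \<inter> U \<inter> W. norm ((s \<circ> r) n x) \<le> norm (g p) + 2"
    proof (rule eventually_mono, intro ballI)
      fix n x assume *: "\<forall>x\<in>V \<inter> U. dist ((s \<circ> r) n x) (g x) < 1" "x \<in> V \<inter> U \<inter> W"
      have "norm ((s \<circ> r) n x) \<le> norm (g x) + dist ((s \<circ> r) n x) (g x)"
        by (metis add.commute dist_norm norm_triangle_sub)
      then show "norm ((s \<circ> r) n x) \<le> norm (g p) + 2" using bspec[OF *(1), of x] *(2) W(3)[of x] by simp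
    qed
    then show ?thesis unfolding bounded_near_def using V W assms(1) g(3)
      by (intro exI[of _ "V \<inter> U \<inter> W"] exI[of _ "norm (g p) + 2"]) auto
  qed
  moreover have "infinite_near (s \<circ> r) p" if g: "locally_uniform_limit_infinity U (s \<circ> r)" "p \<in> U" for p
  proof -
    obtain V where V: "open V" "p \<in> V" "\<And>M. \<forall>\<^sub>F n in sequentially. \<forall>x\<in>V \<inter> U. norm ((s \<circ> r) n x) \<ge> M"
      using g unfolding locally_uniform_limit_infinity_def by blast
    then show ?thesis unfolding infinite_near_def using assms(1) g(2)
      by (intro exI[of _ "V \<inter> U"]) auto
  qed
  ultimately show ?thesis using r that by blast
qed

text \<open>If all points were normal, finitely many neighbourhoods would cover a disc
  \<open>D\<close> around \<open>K\<close>, and on the connected \<open>D\<close> one alternative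
  would hold throughout. So along a subsequence the iterates would be uniformly bounded on
  \<open>D\<close> or tend to infinity uniformly there, although \<open>f^n D\<close> eventually
  contains any prescribed point.\<close>

lemma julia_set_nonempty:
  assumes f: "f holomorphic_on UNIV" "surj f" and K: "bounded K"
    and hit: "\<And>w. \<forall>\<^sub>F n in sequentially. (f ^^ n) -` {w} \<inter> K \<noteq> {}"
  shows "julia_set f \<noteq> {}"
proof
  assume J: "julia_set f = {}"
  obtain R where "\<And>x. x \<in> K \<Longrightarrow> norm x \<le> R" using K by (auto simp: bounded_iff)
  then have "K \<subseteq> cball 0 R" by auto
  define D where "D = cball (0::complex) (max R 1)"
  have D: "compact D" "connected D" "K \<subseteq> D" "D \<noteq> {}"
    using \<open>K \<subseteq> cball 0 R\<close> by (auto simp: D_def)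
  have "\<forall>z. \<exists>U. open U \<and> z \<in> U \<and> normal_family U (range (\<lambda>n. f ^^ n))"
    using J unfolding julia_set_def fatou_set_def by blast
  then obtain U where U: "\<And>z. open (U z)" "\<And>z. z \<in> U z" "\<And>z. normal_family (U z) (range (\<lambda>n. f ^^ n))"
    by metis
  obtain F where F: "finite F" "D \<subseteq> (\<Union>z\<in>F. U z)"
    by (rule compactE_image[OF D(1), of D U]) (use U in auto)
  \<comment> \<open>The neighbourhoods are treated one at a time, each refining the subsequence
    found before.\<close>
  have "\<exists>r :: nat \<Rightarrow> nat. strict_mono r \<and>
      (\<forall>p\<in>(\<Union>z\<in>F. U z). bounded_near (\<lambda>n. f ^^ r n) p \<or> infinite_near (\<lambda>n. f ^^ r n) p)"
    using F(1)
  proof induction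
    case empty
    show ?case using strict_mono_id by auto
  next
    case (insert z F)
    then obtain r where r: "strict_mono (r :: nat \<Rightarrow> nat)"
      "\<forall>p\<in>(\<Union>z\<in>F. U z). bounded_near (\<lambda>n. f ^^ r n) p \<or> infinite_near (\<lambda>n. f ^^ r n) p" by blast
    obtain q where q: "strict_mono (q :: nat \<Rightarrow> nat)"
      "(\<forall>p\<in>U z. bounded_near ((\<lambda>n. f ^^ r n) \<circ> q) p) \<or> (\<forall>p\<in>U z. infinite_near ((\<lambda>n. f ^^ r n) \<circ> q) p)"
      by (rule normal_family_near[OF U(1,3), of "\<lambda>n. f ^^ r n" z]) auto
    have "bounded_near ((\<lambda>n. f ^^ r n) \<circ> q) p \<or> infinite_near ((\<lambda>n. f ^^ r n) \<circ> q) p"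
      if "p \<in> (\<Union>z\<in>F. U z)" for p
      using r(2) that bounded_infinite_near_subseq[OF q(1)] by blast
    with q(2) have "\<forall>p\<in>(\<Union>z\<in>insert z F. U z). bounded_near ((\<lambda>n. f ^^ r n) \<circ> q) p \<or> infinite_near ((\<lambda>n. f ^^ r n) \<circ> q) p"
      by blast
    then show ?case
      using strict_mono_o[OF r(1) q(1)] by (intro exI[of _ "r \<circ> q"]) (simp add: o_def)
  qed
  then obtain r where r: "strict_mono (r :: nat \<Rightarrow> nat)"
      "\<And>p. p \<in> D \<Longrightarrow> bounded_near (\<lambda>n. f ^^ r n) p \<or> infinite_near (\<lambda>n. f ^^ r n) p"
    using F(2) by blast
  define s where "s n = f ^^ r n" for n
  have hit': "\<forall>\<^sub>F n in sequentially. \<exists>x\<in>D. s n x = w" for w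
    using eventually_subseq[OF r(1) hit[of w]] D(3) by (auto simp: s_def elim!: eventually_mono)
  have "{p. bounded_near s p} \<inter> D = {} \<or> {p. infinite_near s p} \<inter> D = {}"
    by (rule connectedD[OF D(2) open_near])
       (use not_bounded_and_infinite_near[of s] r(2) in \<open>auto simp: s_def[abs_def]\<close>)
  then consider "\<And>p. p \<in> D \<Longrightarrow> infinite_near s p" | "\<And>p. p \<in> D \<Longrightarrow> bounded_near s p"
    using r(2) unfolding s_def[abs_def, symmetric] by blast
  then show False
  proof cases
    case 1
    then have "\<forall>p\<in>D. \<exists>V. open V \<and> p \<in> V \<and> (\<forall>\<^sub>F n in sequentially. \<forall>x\<in>V. norm (s n x) \<ge> 1)"
      unfolding infinite_near_def by blast
    from bchoice[OF this] obtain V where V: "\<And>p. p \<in> D \<Longrightarrow> open (V p)" "\<And>p. p \<in> D \<Longrightarrow> p \<in> V p"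
      "\<And>p. p \<in> D \<Longrightarrow> \<forall>\<^sub>F n in sequentially. \<forall>x\<in>V p. norm (s n x) \<ge> 1" by blast
    obtain F where F: "finite F" "F \<subseteq> D" "D \<subseteq> (\<Union>z\<in>F. V z)"
      by (rule compactE_image[OF D(1), of D V]) (use V in auto)
    have "\<forall>\<^sub>F n in sequentially. \<forall>p\<in>F. \<forall>x\<in>V p. norm (s n x) \<ge> 1"
      using F(1,2) V(3) by (intro eventually_ball_finite) auto
    with hit'[of 0] have "\<forall>\<^sub>F n in sequentially. False"
      by eventually_elim (use F(3) in force)
    then show False by simp
  next
    case 2
    then have "\<forall>p\<in>D. \<exists>V M. open V \<and> p \<in> V \<and> (\<forall>\<^sub>F n in sequentially. \<forall>x\<in>V. norm (s n x) \<le> M)"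
      unfolding bounded_near_def by (intro ballI)
    from bchoice[OF this] obtain V where "\<forall>p\<in>D. \<exists>M. open (V p) \<and> p \<in> V p \<and>
        (\<forall>\<^sub>F n in sequentially. \<forall>x\<in>V p. norm (s n x) \<le> M)" ..
    from bchoice[OF this] obtain M where VM: "\<forall>p\<in>D. open (V p) \<and> p \<in> V p \<and>
        (\<forall>\<^sub>F n in sequentially. \<forall>x\<in>V p. norm (s n x) \<le> M p)" ..
    have V: "\<And>p. p \<in> D \<Longrightarrow> open (V p)" "\<And>p. p \<in> D \<Longrightarrow> p \<in> V p"
      "\<And>p. p \<in> D \<Longrightarrow> \<forall>\<^sub>F n in sequentially. \<forall>x\<in>V p. norm (s n x) \<le> M p"
      using bspec[OF VM] by simp_all
    obtain F where F: "finite F" "F \<subseteq> D" "D \<subseteq> (\<Union>z\<in>F. V z)"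
      by (rule compactE_image[OF D(1), of D V]) (use V in auto)
    have M: "M p \<le> (\<Sum>p\<in>F. \<bar>M p\<bar>)" if "p \<in> F" for p
      using member_le_sum[of p F "\<lambda>p. \<bar>M p\<bar>"] that F(1) by fastforce
    have "\<forall>\<^sub>F n in sequentially. \<forall>p\<in>F. \<forall>x\<in>V p. norm (s n x) \<le> M p"
      using F(1,2) V(3) by (intro eventually_ball_finite) auto
    with hit'[of "of_real ((\<Sum>p\<in>F. \<bar>M p\<bar>) + 1)"] have "\<forall>\<^sub>F n in sequentially. False"
    proof eventually_elim
      case (elim n)
      then obtain x p where x: "s n x = of_real ((\<Sum>p\<in>F. \<bar>M p\<bar>) + 1)" "p \<in> F" "x \<in> V p"
        using F(3) by blast
      then have "norm (s n x) \<le> (\<Sum>p\<in>F. \<bar>M p\<bar>)" using elim M[of p] by fastforce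
      moreover have "norm (s n x) = (\<Sum>p\<in>F. \<bar>M p\<bar>) + 1"
        unfolding x(1) norm_of_real by (simp add: sum_nonneg)
      ultimately show False by simp
    qed
    then show False by simp
  qed
qed

section \<open>Convergence of the iterated transfer operator\<close>

lemma equicontinuous_imp_uniform_limit:
  fixes u :: "nat \<Rightarrow> 'a::metric_space \<Rightarrow> 'b::metric_space"
  assumes eq: "\<And>w e. e > 0 \<Longrightarrow> \<exists>d>0. \<forall>w'. dist w' w < d \<longrightarrow> (\<forall>n. dist (u n w') (u n w) < e)"
    and pw: "\<And>w. (\<lambda>n. u n w) \<longlonglongrightarrow> g w"
  shows "continuous_on UNIV g" and "compact K \<Longrightarrow> uniform_limit K u g sequentially"
proof -
  have eqg: "dist (g w') (g w) \<le> e" if "\<And>n. dist (u n w') (u n w) < e" for w w' e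
    by (rule tendsto_upperbound[OF tendsto_dist[OF pw pw]])
       (use that in \<open>auto intro!: always_eventually less_imp_le\<close>)
  show "continuous_on UNIV g"
    unfolding continuous_on_iff
  proof (intro ballI allI impI)
    fix w and e :: real assume "e > 0"
    then obtain d where d: "d > 0" "\<And>w' n. dist w' w < d \<Longrightarrow> dist (u n w') (u n w) < e / 2"
      using eq[of "e / 2" w] by auto
    then show "\<exists>d>0. \<forall>w'\<in>UNIV. dist w' w < d \<longrightarrow> dist (g w') (g w) < e"
      using \<open>e > 0\<close> eqg[of _ w "e / 2"] by (intro exI[of _ d]) fastforce
  qed
  assume K: "compact K"
  show "uniform_limit K u g sequentially"
    unfolding uniform_limit_iff
  proof (intro allI impI)
    fix e :: real assume "e > 0"
    then have "\<forall>w. \<exists>d>0. \<forall>w'. dist w' w < d \<longrightarrow> (\<forall>n. dist (u n w') (u n w) < e / 3)"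
      using eq[of "e / 3"] by simp
    then obtain d where d: "\<And>w. d w > 0" "\<And>w w' n. dist w' w < d w \<Longrightarrow> dist (u n w') (u n w) < e / 3"
      by metis
    obtain F where F: "finite F" "K \<subseteq> (\<Union>w\<in>F. ball w (d w))"
      by (rule compactE_image[OF K, of K "\<lambda>w. ball w (d w)"]) (use d(1) in auto)
    have "\<forall>\<^sub>F n in sequentially. \<forall>w\<in>F. dist (u n w) (g w) < e / 3"
      using F(1) tendstoD[OF pw, of "e / 3"] \<open>e > 0\<close> by (intro eventually_ball_finite) simp_all
    then show "\<forall>\<^sub>F n in sequentially. \<forall>x\<in>K. dist (u n x) (g x) < e"
    proof (rule eventually_mono, intro ballI)
      fix n x assume n: "\<forall>w\<in>F. dist (u n w) (g w) < e / 3" and "x \<in> K"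
      then obtain w where w: "w \<in> F" "dist x w < d w" using F(2) by (force simp: dist_commute)
      have "dist (u n x) (g x) \<le> dist (u n x) (u n w) + dist (u n w) (g w) + dist (g x) (g w)"
        by (metis add.assoc add_left_mono dist_commute dist_triangle dist_triangle_le order_refl)
      also have "\<dots> < e / 3 + e / 3 + e / 3"
        using d(2)[OF w(2), of n] bspec[OF n w(1)] eqg[OF d(2)[OF w(2)]] by linarith
      finally show "dist (u n x) (g x) < e" by simp
    qed
  qed
qed

text \<open>The selection step of Arzela-Ascoli: a diagonal subsequence converges on a countable
  dense set, and equicontinuity spreads the Cauchy property to every point.\<close>

lemma equicontinuous_convergent_subsequence:
  fixes u :: "nat \<Rightarrow> 'a::{metric_space, second_countable_topology} \<Rightarrow> real"
  assumes eq: "\<And>w e. e > 0 \<Longrightarrow> \<exists>d>0. \<forall>w'. dist w' w < d \<longrightarrow> (\<forall>n. dist (u n w') (u n w) < e)"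
    and B: "\<And>n w. \<bar>u n w\<bar> \<le> B"
  obtains r g where "strict_mono (r :: nat \<Rightarrow> nat)" "\<And>w. (\<lambda>n. u (r n) w) \<longlonglongrightarrow> g w"
proof -
  obtain X :: "'a set" where X: "countable X" "\<And>Y. open Y \<Longrightarrow> Y \<noteq> {} \<Longrightarrow> \<exists>d\<in>X. d \<in> Y"
    using countable_dense_setE by metis
  obtain r where r: "strict_mono (r :: nat \<Rightarrow> nat)" "\<And>x. x \<in> X \<Longrightarrow> \<exists>l. (\<lambda>n. u (r n) x) \<longlonglongrightarrow> l"
    by (rule function_convergent_subsequence[OF X(1), of u B]) (use B in auto)
  have "convergent (\<lambda>n. u (r n) w)" for w
  proof (rule Cauchy_convergent, rule metric_CauchyI)
    fix e :: real assume "e > 0"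
    then obtain d where d: "d > 0" "\<And>w' n. dist w' w < d \<Longrightarrow> dist (u n w') (u n w) < e / 3"
      using eq[of "e / 3" w] by auto
    obtain x where x: "x \<in> X" "dist x w < d"
      using X(2)[of "ball w d"] d(1) by (auto simp: dist_commute)
    have "Cauchy (\<lambda>n. u (r n) x)" using r(2)[OF x(1)] LIMSEQ_imp_Cauchy by blast
    then obtain M where M: "\<And>m n. m \<ge> M \<Longrightarrow> n \<ge> M \<Longrightarrow> dist (u (r m) x) (u (r n) x) < e / 3"
      using \<open>e > 0\<close> metric_CauchyD[of _ "e / 3"] by (metis zero_less_divide_iff zero_less_numeral)
    have "dist (u (r m) w) (u (r n) w) < e" if "m \<ge> M" "n \<ge> M" for m n
      using M[OF that] d(2)[OF x(2), of "r m"] d(2)[OF x(2), of "r n"]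
      unfolding dist_real_def by linarith
    then show "\<exists>M. \<forall>m\<ge>M. \<forall>n\<ge>M. dist (u (r m) w) (u (r n) w) < e" by blast
  qed
  then show ?thesis using r(1) by (intro that[of r "\<lambda>w. lim (\<lambda>n. u (r n) w)"]) (simp_all add: convergent_LIMSEQ_iff)
qed

text \<open>The bound charges \<open>a\<close> for the mass on \<open>K\<close> and \<open>b\<close>
  for the rest. Since \<open>a \<le> b\<close>, it only decreases as \<open>K\<close> gains mass, so
  a lower bound for that mass suffices.\<close>

lemma expectation_pmf_le_split:
  fixes h :: "'a \<Rightarrow> real"
  assumes "\<And>x. \<bar>h x\<bar> \<le> B" "\<And>x. x \<in> K \<Longrightarrow> h x \<le> a" "\<And>x. h x \<le> b" "a \<le> b"
    "measure (measure_pmf p) K \<ge> 1 - \<epsilon>"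
  shows "measure_pmf.expectation p h \<le> (1 - \<epsilon>) * a + \<epsilon> * b"
proof -
  have i: "integrable p (\<lambda>x. indicator K x :: real)"
    by (rule integrable_pmf_bounded[where B=1]) (auto split: split_indicator)
  have "measure_pmf.expectation p h \<le> measure_pmf.expectation p (\<lambda>x. b - (b - a) * indicator K x)"
    using assms integrable_pmf_bounded[of h B p] i
    by (intro integral_mono Bochner_Integration.integrable_diff integrable_mult_right)
       (auto split: split_indicator)
  also have "\<dots> = b - (b - a) * measure (measure_pmf p) K"
    using i by (subst Bochner_Integration.integral_diff) (auto simp: measure_pmf.prob_space)
  also have "\<dots> \<le> b - (b - a) * (1 - \<epsilon>)"
    using assms(4,5) by (intro diff_left_mono mult_left_mono) auto
  finally show ?thesis by (simp add: algebra_simps)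
qed

lemma expectation_pmf_dominated_convergence:
  fixes h :: "nat \<Rightarrow> 'a \<Rightarrow> real"
  assumes "\<And>x. (\<lambda>k. h k x) \<longlonglongrightarrow> g x" "\<And>k x. \<bar>h k x\<bar> \<le> B"
  shows "(\<lambda>k. measure_pmf.expectation p (h k)) \<longlonglongrightarrow> measure_pmf.expectation p g"
  by (rule integral_dominated_convergence[where w="\<lambda>_. B"]) (use assms in auto)

lemma bcontfun_realE:
  fixes g :: "complex \<Rightarrow> real"
  assumes "g \<in> bcontfun"
  obtains B where "B > 0" "\<And>x. \<bar>g x\<bar> \<le> B" "continuous_on UNIV g"
proof -
  obtain B where "\<And>x. \<bar>g x\<bar> \<le> B" "continuous_on UNIV g"
    using assms by (auto simp: bcontfun_def bounded_iff)
  then show ?thesis by (intro that[of "max B 1"]) (auto simp: le_max_iff_disj)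
qed

lemma bcontfun_realI:
  fixes g :: "complex \<Rightarrow> real"
  assumes "continuous_on UNIV g" "\<And>x. \<bar>g x\<bar> \<le> B"
  shows "g \<in> bcontfun"
  using assms by (auto simp: bcontfun_def bounded_iff)

text \<open>The quantity \<open>\<epsilon> * (1 + 2 * B)\<close> is the error in
  \<open>E_diff_le\<close>: \<epsilon> from the compact set, and \<open>2 * B\<close> on the
  remaining mass \<epsilon>. The condition \<open>\<epsilon> \<le> 2 * B\<close> is the ordering of
  the two bounds in \<open>expectation_pmf_le_split\<close>.\<close>

lemma small_scale:
  fixes B e :: real
  assumes "B > 0" "e > 0"
  obtains \<epsilon> where "\<epsilon> > 0" "\<epsilon> \<le> 2 * B" "\<epsilon> * (1 + 2 * B) < e"
proof
  let ?\<epsilon> = "min (2 * B) (e / (2 * (1 + 2 * B)))"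
  have "?\<epsilon> * (1 + 2 * B) \<le> e / (2 * (1 + 2 * B)) * (1 + 2 * B)"
    using assms(1) by (intro mult_right_mono) auto
  also have "\<dots> = e / 2" using assms(1) by (simp add: field_simps)
  finally show "?\<epsilon> * (1 + 2 * B) < e" using assms(2) by simp
qed (use assms in auto)

section \<open>Recurrent limits of the iterates are constant\<close>

locale normal_tight_weight =
  fixes f :: "complex \<Rightarrow> complex" and Q :: "complex \<Rightarrow> real"
  assumes f: "f holomorphic_on UNIV" "surj f"
    and no_exceptional: "\<forall>z. \<not> exceptional f z"
    and weight: "weight_function f Q" and cont: "weakly_continuous f Q"
    and normal: "normal_weight f Q" and tight: "tight_weight f Q"
    and nonzero: "\<forall>z. Q z \<noteq> 0"
begin

abbreviation P :: "nat \<Rightarrow> complex \<Rightarrow> complex pmf" where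
  "P \<equiv> iter_kernel f Q"

text \<open>This is \<open>A^n g\<close> for real \<open>g\<close>, where maxima and level sets make
  sense; complex functions are recovered from their real and imaginary parts.\<close>

definition E :: "nat \<Rightarrow> (complex \<Rightarrow> real) \<Rightarrow> complex \<Rightarrow> real" where
  "E n g w = measure_pmf.expectation (P n w) g"

lemma E_bound: "(\<And>x. \<bar>g x\<bar> \<le> B) \<Longrightarrow> \<bar>E n g w\<bar> \<le> B"
  using expectation_pmf_norm_le[of g B] by (simp add: E_def)

lemma E_le: "(\<And>x. \<bar>g x\<bar> \<le> B) \<Longrightarrow> (\<And>x. g x \<le> S) \<Longrightarrow> E n g w \<le> S"
  using expectation_pmf_le_split[of g B UNIV S S 0 "P n w"] by (simp add: E_def)

lemma E_equicontinuous:
  assumes "g \<in> bcontfun" "e > 0"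
  shows "\<exists>d>0. \<forall>w'. dist w' w < d \<longrightarrow> (\<forall>n. dist (E n g w') (E n g w) < e)"
proof -
  obtain B where B: "\<And>x. \<bar>g x\<bar> \<le> B" "continuous_on UNIV g" using bcontfun_realE[OF assms(1)] by metis
  define \<phi> where "\<phi> = Bcontfun (\<lambda>x. complex_of_real (g x))"
  have "(\<lambda>x. complex_of_real (g x)) \<in> bcontfun"
    using B by (auto simp: bcontfun_def bounded_iff intro!: continuous_intros)
  then have \<phi>: "apply_bcontfun \<phi> = (\<lambda>x. complex_of_real (g x))"
    by (simp add: \<phi>_def Bcontfun_inverse)
  have "apply_bcontfun ((blinfun_apply (transfer_op f Q) ^^ n) \<phi>) w = complex_of_real (E n g w)" for n w
    by (simp add: transfer_op_power_apply[OF weight cont] \<phi> E_def)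
  moreover have "dist (complex_of_real x) (complex_of_real y) = dist x y" for x y
    by (simp add: dist_norm flip: of_real_diff)
  ultimately show ?thesis
    using normal[unfolded normal_weight_def, rule_format, OF assms(2), of w \<phi>] by simp
qed

lemma E_bcontfun: "g \<in> bcontfun \<Longrightarrow> E n g \<in> bcontfun"
proof -
  assume g: "g \<in> bcontfun"
  then obtain B where "\<And>x. \<bar>g x\<bar> \<le> B" using bcontfun_realE by metis
  moreover have "continuous_on UNIV (E n g)"
    using E_equicontinuous[OF g] unfolding continuous_on_iff by blast
  ultimately show ?thesis using E_bound by (intro bcontfun_realI[where B=B]) auto
qed

lemma E_add: "g \<in> bcontfun \<Longrightarrow> E (m + n) g w = E m (E n g) w"
  unfolding E_def iter_kernel_add by (metis bcontfun_realE integral_bind_pmf_bounded_real)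

lemma E_uminus: "E n (\<lambda>x. - g x) w = - E n g w"
  by (simp add: E_def)

text \<open>Closeness on a compact set carrying most of the mass replaces uniform closeness on the
  plane. It lets a locally uniform limit be taken inside an average.\<close>

lemma E_diff_le:
  assumes "\<And>x. \<bar>g x\<bar> \<le> B" "\<And>x. \<bar>h x\<bar> \<le> B" "\<And>x. x \<in> K \<Longrightarrow> \<bar>g x - h x\<bar> \<le> \<epsilon>" "0 \<le> \<epsilon>" "\<epsilon> \<le> 2 * B"
    and "measure (measure_pmf (P n w)) K \<ge> 1 - \<epsilon>"
  shows "\<bar>E n g w - E n h w\<bar> \<le> \<epsilon> * (1 + 2 * B)"
proof -
  have i: "integrable (P n w) g" "integrable (P n w) h"
    using assms(1,2) by (auto intro: integrable_pmf_bounded[where B=B])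
  have gh: "\<bar>g x - h x\<bar> \<le> 2 * B" for x using assms(1,2)[of x] by linarith
  have "\<bar>E n g w - E n h w\<bar> = \<bar>measure_pmf.expectation (P n w) (\<lambda>x. g x - h x)\<bar>"
    using i by (simp add: E_def)
  also have "\<dots> \<le> measure_pmf.expectation (P n w) (\<lambda>x. \<bar>g x - h x\<bar>)"
    by (rule integral_abs_bound)
  also have "\<dots> \<le> (1 - \<epsilon>) * \<epsilon> + \<epsilon> * (2 * B)"
    by (rule expectation_pmf_le_split[where B="2 * B"]) (use gh assms in auto)
  also have "\<dots> \<le> \<epsilon> * (1 + 2 * B)" by (simp add: algebra_simps)
  finally show ?thesis .
qed

lemma tightE:
  assumes "\<epsilon> > 0"
  obtains K where "compact K" "\<And>w. \<forall>\<^sub>F n in sequentially. measure (P n w) K \<ge> 1 - \<epsilon>"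
proof -
  obtain K where K: "compact K" "\<And>w. \<exists>n0. \<forall>n\<ge>n0. measure (iter_weight_measure f Q n w) K \<ge> 1 - \<epsilon>"
    using tight assms unfolding tight_weight_def by blast
  have "measure (iter_weight_measure f Q n w) K = measure (P n w) K" for n w
    using K(1) by (simp add: iter_weight_measure_eq[OF f weight] measure_distr borel_compact)
  then show ?thesis using K that unfolding eventually_sequentially by simp
qed

text \<open>Tightness at level 1/2. A set of positive mass must meet the support of the law, so late
  fibres meet \<open>K\<close>.\<close>

lemma hitE:
  obtains K where "compact K" "\<And>w. \<forall>\<^sub>F n in sequentially. measure (P n w) K \<ge> 1 / 2"
    "\<And>w. \<forall>\<^sub>F n in sequentially. (f ^^ n) -` {w} \<inter> K \<noteq> {}"
proof -
  obtain K where K: "compact K" "\<And>w. \<forall>\<^sub>F n in sequentially. measure (P n w) K \<ge> 1 - 1 / 2"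
    using tightE[of "1/2"] by auto
  have "(f ^^ n) -` {w} \<inter> K \<noteq> {}" if "measure (P n w) K \<ge> 1 - 1 / 2" for n w
  proof
    assume "(f ^^ n) -` {w} \<inter> K = {}"
    then have "measure (P n w) K = 0"
      using set_iter_kernel[OF f weight nonzero, of n w] measure_Int_set_pmf[of "P n w" K]
      by (simp add: Int_commute)
    then show False using that by simp
  qed
  then have "\<forall>\<^sub>F n in sequentially. (f ^^ n) -` {w} \<inter> K \<noteq> {}" for w
    by (rule eventually_mono[OF K(2)])
  then show ?thesis using K by (intro that[of K]) auto
qed

lemma julia_nonempty: "julia_set f \<noteq> {}"
  using hitE julia_set_nonempty[OF f] compact_imp_bounded by metis

lemma two_preimages: "\<exists>k. two_preimages f k w"
  using hitE exists_two_preimages[OF f no_exceptional] compact_imp_bounded by metis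

lemma julia_subset:
  assumes "compact K" "\<And>n z. f z \<in> S (Suc n) \<Longrightarrow> z \<in> S n" "\<And>n. S n \<inter> K \<noteq> {}"
  shows "julia_set f \<subseteq> closure (S 0)"
  by (rule julia_subset_closure_targets[OF f assms(1) two_preimages assms(2,3)])

text \<open>The value at any point is nearly an average half of whose mass sits on a fixed compact set.\<close>

lemma recurrent_attains_sup:
  assumes h: "h \<in> bcontfun" and m: "filterlim m at_top sequentially"
    and rec: "\<And>w. (\<lambda>k. E (m k) h w) \<longlonglongrightarrow> h w"
    and K: "compact K" "\<And>w. \<forall>\<^sub>F n in sequentially. measure (P n w) K \<ge> 1 / 2"
  obtains w where "w \<in> K" "\<And>x. h x \<le> h w"
proof -
  obtain B where B: "\<And>x. \<bar>h x\<bar> \<le> B" "continuous_on UNIV h" using bcontfun_realE[OF h] by metis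
  have "K \<noteq> {}"
    using eventually_happens[OF K(2)] by force
  obtain w where w: "w \<in> K" "\<And>x. x \<in> K \<Longrightarrow> h x \<le> h w"
    using continuous_attains_sup[OF K(1) \<open>K \<noteq> {}\<close> continuous_on_subset[OF B(2)]] by auto
  define b where "b = (SUP x. h x)"
  have bdd: "bdd_above (range h)" using B(1) by (intro bdd_aboveI[of _ B]) (auto simp: abs_le_iff)
  have hb: "h x \<le> b" for x unfolding b_def by (rule cSUP_upper[OF UNIV_I bdd])
  have "h x \<le> h w / 2 + b / 2" for x
  proof (rule tendsto_upperbound[OF rec])
    have "\<forall>\<^sub>F k in sequentially. measure (P (m k) x) K \<ge> 1 / 2"
      by (rule eventually_compose_filterlim[OF K(2) m])
    then show "\<forall>\<^sub>F k in sequentially. E (m k) h x \<le> h w / 2 + b / 2"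
    proof (rule eventually_mono)
      fix k assume k: "measure (P (m k) x) K \<ge> 1 / 2"
      have "E (m k) h x \<le> (1 - 1/2) * h w + 1/2 * b"
        unfolding E_def by (rule expectation_pmf_le_split[OF B(1) w(2) hb hb]) (use k in auto)
      then show "E (m k) h x \<le> h w / 2 + b / 2" by simp
    qed
  qed simp
  \<comment> \<open>The bound holds at every \<open>x\<close> with the same right-hand side, so it
    passes to the supremum \<open>b\<close>; the half of the mass off \<open>K\<close> is absorbed
    into the left-hand side.\<close>
  then have "b \<le> h w / 2 + b / 2" unfolding b_def by (intro cSUP_least) auto
  then have "b \<le> h w" by simp
  then show ?thesis using hb w(1) order_trans by (intro that[of w]) blast+
qed

lemma recurrent_max_on_julia:
  assumes g: "g \<in> bcontfun" and m: "filterlim m at_top sequentially"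
    and rec: "\<And>w. (\<lambda>k. E (m k) g w) \<longlonglongrightarrow> g w"
  obtains S where "\<And>x. g x \<le> S" "\<And>z. z \<in> julia_set f \<Longrightarrow> g z = S"
proof -
  obtain K where K: "compact K" "\<And>w. \<forall>\<^sub>F n in sequentially. measure (P n w) K \<ge> 1 / 2"
    using hitE by metis
  obtain B where B: "\<And>x. \<bar>g x\<bar> \<le> B" "continuous_on UNIV g" using bcontfun_realE[OF g] by metis
  note Ebc = E_bcontfun[OF g]
  have "\<exists>w. w \<in> K \<and> (\<forall>x. E n g x \<le> E n g w)" for n
  proof -
    \<comment> \<open>Iterates of \<open>A\<close> commute, so recurrence passes from
      \<open>g\<close> to \<open>A^n g\<close> along the same times, and the maximum of
      \<open>A^n g\<close> is attained on the same \<open>K\<close>.\<close>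
    have "(\<lambda>k. E (m k) (E n g) w) \<longlonglongrightarrow> E n g w" for w
    proof -
      have "E (m k) (E n g) w = E n (E (m k) g) w" for k
        using E_add[OF g, of "m k" n w] E_add[OF g, of n "m k" w] by (simp add: add.commute)
      moreover have "(\<lambda>k. E n (E (m k) g) w) \<longlonglongrightarrow> E n g w"
        unfolding E_def[of n] by (rule expectation_pmf_dominated_convergence[OF rec E_bound[OF B(1)]])
      ultimately show ?thesis by simp
    qed
    from recurrent_attains_sup[OF Ebc m this K] show ?thesis by metis
  qed
  then obtain w where w: "\<And>n. w n \<in> K" "\<And>n x. E n g x \<le> E n g (w n)" by metis
  define S where "S = g (w 0)"
  have E0: "E 0 g = g" by (rule ext) (simp add: E_def)
  have gS: "g x \<le> S" for x using w(2)[of 0 x] by (simp add: E0 S_def)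
  have ES: "E n g x \<le> S" for n x by (rule E_le[OF B(1) gS])
  \<comment> \<open>Averaging never raises a maximum, but recurrence brings the values at
    \<open>w 0\<close> back to \<open>S\<close>. As \<open>A^(m k) g\<close> is an average of
    \<open>A^n g\<close> for large \<open>k\<close>, the maximum of \<open>A^n g\<close> cannot have
    dropped.\<close>
  have top: "E n g (w n) = S" for n
  proof (rule antisym[OF ES])
    show "S \<le> E n g (w n)"
      unfolding S_def
    proof (rule tendsto_upperbound[OF rec])
      have "\<forall>\<^sub>F k in sequentially. m k \<ge> n" using m by (simp add: filterlim_at_top)
      then show "\<forall>\<^sub>F k in sequentially. E (m k) g (w 0) \<le> E n g (w n)"
      proof (rule eventually_mono)
        fix k assume "n \<le> m k"
        then have "E (m k) g (w 0) = E (m k - n) (E n g) (w 0)"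
          using E_add[OF g, of "m k - n" n] by simp
        then show "E (m k) g (w 0) \<le> E n g (w n)"
          using E_le[OF E_bound[OF B(1)] w(2)] by simp
      qed
    qed simp
  qed
  have "julia_set f \<subseteq> closure {x. E 0 g x = S}"
  proof (rule julia_subset[OF K(1)])
    fix n z assume "f z \<in> {x. E (Suc n) g x = S}"
    then have "E 1 (E n g) (f z) = S" using E_add[OF g, of 1 n "f z"] by simp
    moreover have "z \<in> set_pmf (P 1 (f z))"
      unfolding set_iter_kernel[OF f weight nonzero] by simp
    ultimately have "E n g z = S"
      unfolding E_def[of 1] by (intro expectation_pmf_eq_upper_bound[OF ES E_bound[OF B(1)]])
    then show "z \<in> {x. E n g x = S}" by simp
  qed (use w(1) top in blast)
  also have "\<dots> = {x. g x = S}"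
    unfolding E0 using B(2) by (intro closure_closed closed_Collect_eq) auto
  finally show ?thesis using gS by (intro that[of S]) auto
qed

text \<open>Both \<open>g\<close> and \<open>-g\<close> attain their maximum on the whole Julia set;
  one point of it makes the maximum and the minimum of \<open>g\<close> agree.\<close>

lemma recurrent_constant:
  assumes g: "g \<in> bcontfun" and m: "filterlim m at_top sequentially"
    and rec: "\<And>w. (\<lambda>k. E (m k) g w) \<longlonglongrightarrow> g w"
  obtains c where "\<And>x. g x = c"
proof -
  obtain S where S: "\<And>x. g x \<le> S" "\<And>z. z \<in> julia_set f \<Longrightarrow> g z = S"
    using recurrent_max_on_julia[OF g m rec] by metis
  have "(\<lambda>x. - g x) \<in> bcontfun" "(\<lambda>k. E (m k) (\<lambda>x. - g x) w) \<longlonglongrightarrow> - g w" for w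
    using g rec[of w] by (auto simp: E_uminus bcontfun_def continuous_on_minus tendsto_minus bounded_iff)
  then obtain T where T: "\<And>x. - g x \<le> T" "\<And>z. z \<in> julia_set f \<Longrightarrow> - g z = T"
    using recurrent_max_on_julia[OF _ m, of "\<lambda>x. - g x"] by metis
  obtain z where "z \<in> julia_set f" using julia_nonempty by blast
  then have "g x = S" for x using S(1)[of x] T(1)[of x] S(2) T(2) by fastforce
  then show ?thesis by (rule that)
qed

theorem E_tendsto_constant:
  assumes g0: "g0 \<in> bcontfun"
  obtains c where "\<And>w. (\<lambda>n. E n g0 w) \<longlonglongrightarrow> c"
proof -
  obtain B where B: "B > 0" "\<And>x. \<bar>g0 x\<bar> \<le> B" "continuous_on UNIV g0" using bcontfun_realE[OF g0] by metis
  have EB: "\<bar>E n g0 x\<bar> \<le> B" for n x by (rule E_bound[OF B(2)])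
  obtain r0 g where r0: "strict_mono (r0 :: nat \<Rightarrow> nat)" "\<And>w. (\<lambda>n. E (r0 n) g0 w) \<longlonglongrightarrow> g w"
    using equicontinuous_convergent_subsequence[of "\<lambda>n. E n g0", OF E_equicontinuous[OF g0] EB] by metis
  text \<open>Passing to the indices \<open>k\<^sup>2\<close> makes the gaps tend to infinity.\<close>
  define r where "r k = r0 (k ^ 2)" for k
  have sq: "strict_mono (\<lambda>k :: nat. k ^ 2)" by (auto simp: strict_mono_def power_strict_mono)
  have r: "strict_mono r" "\<And>w. (\<lambda>n. E (r n) g0 w) \<longlonglongrightarrow> g w"
    using strict_mono_o[OF r0(1) sq] LIMSEQ_subseq_LIMSEQ[OF r0(2) sq] by (auto simp: r_def[abs_def] o_def)
  define m where "m k = r (Suc k) - r k" for k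
  \<comment> \<open>A strictly increasing sequence of naturals stretches gaps, so the gap between
    consecutive squares bounds \<open>m k\<close> from below.\<close>
  have r0_ge: "r0 a + b \<le> r0 (a + b)" for a b
    by (induction b) (use r0(1) in \<open>auto simp: strict_mono_Suc_iff Suc_le_eq intro: le_less_trans\<close>)
  have mk: "r (Suc k) = m k + r k" "m k \<ge> k" for k
  proof -
    have "(Suc k)\<^sup>2 = k\<^sup>2 + (2 * k + 1)" by (simp add: power2_eq_square)
    then have "r k + (2 * k + 1) \<le> r (Suc k)" using r0_ge[of "k\<^sup>2" "2 * k + 1"] by (simp add: r_def)
    then show "r (Suc k) = m k + r k" "m k \<ge> k" by (simp_all add: m_def)
  qed
  have m: "filterlim m at_top sequentially"
    by (rule filterlim_at_top_mono[OF filterlim_ident]) (use mk(2) in auto)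
  have eq: "\<exists>d>0. \<forall>w'. dist w' w < d \<longrightarrow> (\<forall>n. dist (E (r n) g0 w') (E (r n) g0 w) < e)" if "e > 0" for w e
    using E_equicontinuous[OF g0 that, of w] by blast
  have ul: "continuous_on UNIV g"
    "compact K \<Longrightarrow> uniform_limit K (\<lambda>n. E (r n) g0) g sequentially" for K
    by (rule equicontinuous_imp_uniform_limit[of "\<lambda>n. E (r n) g0", OF eq r(2)]; assumption)+
  have gB: "\<bar>g x\<bar> \<le> B" for x
    by (rule tendsto_upperbound[OF tendsto_rabs[OF r(2)]]) (use EB in auto)
  have g: "g \<in> bcontfun" by (rule bcontfun_realI[OF ul(1) gB])
  have rec: "(\<lambda>k. E (m k) g w) \<longlonglongrightarrow> g w" for w
  proof -
    \<comment> \<open>\<open>A^(m k)\<close> carries the \<open>k\<close>-th term of the subsequence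
      to the next one. Replacing that term by \<open>g\<close> costs little, since late laws sit
      mostly where the convergence is uniform.\<close>
    have "(\<lambda>k. E (m k) (E (r k) g0) w) \<longlonglongrightarrow> g w"
      using LIMSEQ_Suc[OF r(2)[of w]] by (simp add: mk(1) E_add[OF g0])
    moreover have "(\<lambda>k. E (m k) (E (r k) g0) w - E (m k) g w) \<longlonglongrightarrow> 0"
    proof (rule LIMSEQ_I)
      fix e :: real assume "e > 0"
      obtain \<epsilon> where \<epsilon>: "\<epsilon> > 0" "\<epsilon> \<le> 2 * B" "\<epsilon> * (1 + 2 * B) < e"
        using small_scale[OF B(1) \<open>e > 0\<close>] by metis
      obtain K where K: "compact K" "\<And>w. \<forall>\<^sub>F n in sequentially. measure (P n w) K \<ge> 1 - \<epsilon>"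
        using tightE[OF \<epsilon>(1)] by metis
      have "\<forall>\<^sub>F k in sequentially. \<forall>x\<in>K. dist (E (r k) g0 x) (g x) < \<epsilon>"
        by (rule uniform_limitD[OF ul(2)[OF K(1)] \<epsilon>(1)])
      moreover have "\<forall>\<^sub>F k in sequentially. measure (P (m k) w) K \<ge> 1 - \<epsilon>"
        by (rule eventually_compose_filterlim[OF K(2) m])
      ultimately have "\<forall>\<^sub>F k in sequentially. norm (E (m k) (E (r k) g0) w - E (m k) g w - 0) < e"
      proof eventually_elim
        case (elim k)
        have "\<bar>E (m k) (E (r k) g0) w - E (m k) g w\<bar> \<le> \<epsilon> * (1 + 2 * B)"
          by (rule E_diff_le[where K=K]) (use EB gB elim \<epsilon> in \<open>auto simp: dist_real_def less_imp_le\<close>)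
        then show ?case using \<epsilon>(3) by simp
      qed
      then show "\<exists>n0. \<forall>n\<ge>n0. norm (E (m n) (E (r n) g0) w - E (m n) g w - 0) < e"
        by (simp add: eventually_sequentially)
    qed
    ultimately show ?thesis using tendsto_diff by fastforce
  qed
  obtain c where c: "\<And>x. g x = c" using recurrent_constant[OF g m rec] by metis
  have "(\<lambda>n. E n g0 w) \<longlonglongrightarrow> c" for w
  proof (rule LIMSEQ_I)
    fix e :: real assume "e > 0"
    obtain \<epsilon> where \<epsilon>: "\<epsilon> > 0" "\<epsilon> \<le> 2 * B" "\<epsilon> * (1 + 2 * B) < e"
      using small_scale[OF B(1) \<open>e > 0\<close>] by metis
    obtain K where K: "compact K" "\<And>w. \<forall>\<^sub>F n in sequentially. measure (P n w) K \<ge> 1 - \<epsilon>"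
      using tightE[OF \<epsilon>(1)] by metis
    have "\<forall>\<^sub>F k in sequentially. \<forall>x\<in>K. dist (E (r k) g0 x) (g x) < \<epsilon>"
      by (rule uniform_limitD[OF ul(2)[OF K(1)] \<epsilon>(1)])
    \<comment> \<open>One index is enough: once \<open>A^(r k) g0\<close> is nearly constant on
      \<open>K\<close>, every average over a law concentrated on \<open>K\<close> is near
      \<open>c\<close>, so the full sequence converges.\<close>
    then obtain k where "\<forall>x\<in>K. dist (E (r k) g0 x) (g x) < \<epsilon>"
      using eventually_happens by force
    then have k: "\<bar>E (r k) g0 x - c\<bar> \<le> \<epsilon>" if "x \<in> K" for x
      using that by (force simp: c dist_real_def)
    obtain n0 where n0: "\<And>n. n \<ge> n0 \<Longrightarrow> measure (P n w) K \<ge> 1 - \<epsilon>"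
      using K(2)[of w] by (auto simp: eventually_sequentially)
    have "norm (E n g0 w - c) < e" if "n \<ge> n0 + r k" for n
    proof -
      have "E n g0 w = E (n - r k) (E (r k) g0) w"
        using that by (simp flip: E_add[OF g0])
      moreover have "E (n - r k) (\<lambda>_. c) w = c" by (simp add: E_def)
      moreover have "\<bar>E (n - r k) (E (r k) g0) w - E (n - r k) (\<lambda>_. c) w\<bar> \<le> \<epsilon> * (1 + 2 * B)"
        by (rule E_diff_le[where K=K]) (use EB gB[unfolded c] k \<epsilon> n0 that in auto)
      ultimately show ?thesis using \<epsilon>(3) by simp
    qed
    then show "\<exists>n0. \<forall>n\<ge>n0. norm (E n g0 w - c) < e" by blast
  qed
  then show ?thesis by (rule that)
qed

end

section \<open>Tight sequences of discrete measures\<close>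

text \<open>At the first place \<open>k\<close> where the digits differ they contribute at least
  \<open>1 / 8^k\<close>, and the tail at most \<open>3 / (7 * 8^k)\<close>. What remains is at
  least \<open>4/7\<close> of \<open>1 / 8^k\<close>, more than the half allowed by the closeness.
  Digit 0 may be any integer.\<close>

lemma digit_separation:
  fixes D D' :: "nat \<Rightarrow> int"
  assumes D: "\<And>k. D (Suc k) \<in> {0..3}" "\<And>k. D' (Suc k) \<in> {0..3}"
    and close: "\<bar>(\<Sum>k. D k / 8 ^ k) - (\<Sum>k. D' k / 8 ^ k)\<bar> < 1 / (2 * 8 ^ n)" and "k \<le> n"
  shows "D k = D' k"
  using \<open>k \<le> n\<close>
proof (induction k rule: less_induct)
  case (less k)
  have sm: "summable (\<lambda>k. real_of_int (A k) / 8 ^ k)" if "\<And>k. A (Suc k) \<in> {0..3}" for A :: "nat \<Rightarrow> int"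
  proof (rule summable_comparison_test')
    show "summable (\<lambda>k. 3 * (1 / 8 :: real) ^ k)" by (intro summable_mult summable_geometric) auto
    fix k :: nat assume "k \<ge> 1"
    then obtain j where "k = Suc j" by (cases k) auto
    then have "A k \<in> {0..3}" using that by simp
    then show "norm (real_of_int (A k) / 8 ^ k) \<le> 3 * (1 / 8) ^ k"
      by (simp add: power_divide divide_right_mono)
  qed
  define e where "e j = real_of_int (D j - D' j) / 8 ^ j" for j
  have se: "summable e" and eq: "suminf e = (\<Sum>k. D k / 8 ^ k) - (\<Sum>k. D' k / 8 ^ k)"
    using summable_diff[OF sm[of D, OF D(1)] sm[of D', OF D(2)]]
      suminf_diff[OF sm[of D, OF D(1)] sm[of D', OF D(2)]]
    by (auto simp: e_def[abs_def] diff_divide_distrib)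
  have tail: "\<bar>\<Sum>j. e (j + Suc k)\<bar> \<le> 3 / (7 * 8 ^ k)"
  proof -
    have sums: "(\<lambda>j. 3 / 8 ^ Suc k * (1 / 8 :: real) ^ j) sums (3 / 8 ^ Suc k * (1 / (1 - 1 / 8)))"
      by (intro sums_mult geometric_sums) auto
    have "\<bar>e (j + Suc k)\<bar> \<le> 3 / 8 ^ Suc k * (1 / 8) ^ j" for j
    proof -
      have "\<bar>D (Suc (j + k)) - D' (Suc (j + k))\<bar> \<le> 3"
        using D(1)[of "j + k"] D(2)[of "j + k"] by auto
      then have "real_of_int \<bar>D (Suc (j + k)) - D' (Suc (j + k))\<bar> \<le> 3" by linarith
      then show ?thesis
        by (simp add: e_def power_add power_divide divide_right_mono field_simps)
    qed
    then have "norm (\<Sum>j. e (j + Suc k)) \<le> (\<Sum>j. 3 / 8 ^ Suc k * (1 / 8) ^ j)"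
      by (intro norm_suminf_le sums_summable[OF sums]) auto
    also have "\<dots> = 3 / (7 * 8 ^ k)" using sums_unique[OF sums] by (simp add: field_simps)
    finally show ?thesis by simp
  qed
  have "suminf e = (\<Sum>j. e (j + Suc k)) + (\<Sum>j<Suc k. e j)"
    by (rule suminf_split_initial_segment[OF se])
  moreover have "(\<Sum>j<k. e j) = 0"
    using less by (intro sum.neutral) (auto simp: e_def)
  ultimately have sum: "suminf e = (\<Sum>j. e (j + Suc k)) + e k" by simp
  have small: "\<bar>suminf e\<bar> < 1 / (2 * 8 ^ k)"
  proof -
    have "1 / (2 * 8 ^ n) \<le> 1 / (2 * (8::real) ^ k)"
      using less.prems by (intro divide_left_mono mult_left_mono power_increasing) auto
    then show ?thesis using close eq by linarith
  qed
  show "D k = D' k"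
  proof (rule ccontr)
    assume "D k \<noteq> D' k"
    then have "1 \<le> \<bar>D k - D' k\<bar>" by linarith
    then have "1 \<le> real_of_int \<bar>D k - D' k\<bar>" by linarith
    then have "\<bar>e k\<bar> \<ge> 1 / 8 ^ k" by (simp add: e_def divide_right_mono)
    then have "1 / 8 ^ k \<le> \<bar>suminf e\<bar> + \<bar>\<Sum>j. e (j + Suc k)\<bar>" using sum by linarith
    also have "\<dots> < 1 / (2 * 8 ^ k) + 3 / (7 * 8 ^ k)" using small tail by linarith
    finally have "14 < (13::real)" by (simp add: field_simps)
    then show False by simp
  qed
qed

text \<open>This recovers the dyadic floor at one level from the floor at the previous level and one
  binary digit.\<close>

lemma floor_double: "\<lfloor>2 * y\<rfloor> = 2 * \<lfloor>y\<rfloor> + \<lfloor>2 * y\<rfloor> mod (2::int)" for y :: real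
proof -
  have "\<lfloor>2 * y\<rfloor> - 2 * \<lfloor>y\<rfloor> \<in> {0, 1}" by (simp, linarith)
  then show ?thesis by (auto; presburger)
qed

text \<open>The binary digits of both coordinates are paired to digits in \<open>{0..3}\<close>, but read in base 8: the gaps
  make the code of a point determine its leading digits stably.\<close>

definition dyadic_digit :: "complex \<Rightarrow> nat \<Rightarrow> int" where
  "dyadic_digit z k =
     (if k = 0 then int (to_nat (\<lfloor>Re z\<rfloor>, \<lfloor>Im z\<rfloor>))
      else \<lfloor>2 ^ k * Re z\<rfloor> mod 2 + 2 * (\<lfloor>2 ^ k * Im z\<rfloor> mod 2))"

definition line_code :: "complex \<Rightarrow> real" where
  "line_code z = (\<Sum>k. dyadic_digit z k / 8 ^ k)"

lemma dyadic_digit_range: "dyadic_digit z (Suc k) \<in> {0..3}"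
proof -
  have "0 \<le> x mod 2 \<and> x mod 2 \<le> 1" for x :: int by auto
  from this[of "\<lfloor>2 ^ Suc k * Re z\<rfloor>"] this[of "\<lfloor>2 ^ Suc k * Im z\<rfloor>"]
  show ?thesis unfolding dyadic_digit_def by simp
qed

text \<open>Close codes agree in digits 0 to \<open>n\<close>. Digit 0 determines the unit square,
  as \<open>to_nat\<close> is injective, and each later digit halves it in both directions, so both
  points lie in one square of side \<open>1 / 2^n\<close>.\<close>

lemma line_code_separation:
  assumes "dist (line_code z) (line_code z') < 1 / (2 * 8 ^ n)"
  shows "dist z z' \<le> 2 / 2 ^ n"
proof -
  have eq: "dyadic_digit z k = dyadic_digit z' k" if "k \<le> n" for k
    using digit_separation[of "dyadic_digit z" "dyadic_digit z'" n k, OF dyadic_digit_range dyadic_digit_range] assms that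
    by (simp add: line_code_def dist_real_def)
  have fl: "\<lfloor>2 ^ k * Re z\<rfloor> = \<lfloor>2 ^ k * Re z'\<rfloor> \<and> \<lfloor>2 ^ k * Im z\<rfloor> = \<lfloor>2 ^ k * Im z'\<rfloor>" if "k \<le> n" for k
    using that
  proof (induction k)
    case 0
    show ?case using eq[of 0] by (simp add: dyadic_digit_def)
  next
    case (Suc k)
    have m: "0 \<le> x mod 2 \<and> x mod 2 \<le> 1" for x :: int by auto
    have "\<lfloor>2 ^ Suc k * Re z\<rfloor> mod 2 = \<lfloor>2 ^ Suc k * Re z'\<rfloor> mod 2"
      "\<lfloor>2 ^ Suc k * Im z\<rfloor> mod 2 = \<lfloor>2 ^ Suc k * Im z'\<rfloor> mod 2"
      using eq[OF Suc.prems] m[of "\<lfloor>2 ^ Suc k * Re z\<rfloor>"] m[of "\<lfloor>2 ^ Suc k * Re z'\<rfloor>"]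
        m[of "\<lfloor>2 ^ Suc k * Im z\<rfloor>"] m[of "\<lfloor>2 ^ Suc k * Im z'\<rfloor>"]
      unfolding dyadic_digit_def by (simp_all, presburger+)
    then show ?case
      using floor_double[of "2 ^ k * Re z"] floor_double[of "2 ^ k * Re z'"]
        floor_double[of "2 ^ k * Im z"] floor_double[of "2 ^ k * Im z'"] Suc
      by (simp add: mult.assoc)
  qed
  have d: "\<bar>x - y\<bar> \<le> 1 / 2 ^ n" if "\<lfloor>2 ^ n * x\<rfloor> = \<lfloor>2 ^ n * y\<rfloor>" for x y :: real
  proof -
    have "\<bar>2 ^ n * x - 2 ^ n * y\<bar> \<le> 1" using that by linarith
    then have "2 ^ n * \<bar>x - y\<bar> \<le> 1" by (simp add: abs_mult flip: right_diff_distrib)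
    then show ?thesis by (simp add: field_simps)
  qed
  have "dist z z' \<le> \<bar>Re (z - z')\<bar> + \<bar>Im (z - z')\<bar>"
    unfolding dist_norm by (rule cmod_le)
  also have "\<dots> \<le> 1 / 2 ^ n + 1 / 2 ^ n"
    using d fl[of n] by (intro add_mono) auto
  finally show ?thesis by simp
qed

text \<open>Digit 0 is an enumeration index without relation to size, but a bounded set meets only
  finitely many unit squares. The remaining digits add at most \<open>3/7\<close>. The lemma carries
  tightness over to the coded laws.\<close>

lemma line_code_bounded:
  assumes "bounded K"
  shows "bounded (line_code ` K)"
proof -
  obtain B where B: "\<And>z. z \<in> K \<Longrightarrow> norm z \<le> B" using assms by (auto simp: bounded_iff)
  define I where "I = {\<lfloor>- B\<rfloor>..\<lfloor>B\<rfloor>} \<times> {\<lfloor>- B\<rfloor>..\<lfloor>B\<rfloor>}"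
  have "finite (to_nat ` I)" by (simp add: I_def)
  then obtain N where N: "\<And>i. i \<in> I \<Longrightarrow> to_nat i \<le> N"
    using Max_ge by (metis imageI)
  have "norm (line_code z) \<le> real N + 1" if "z \<in> K" for z
  proof -
    have "\<lfloor>Re z\<rfloor> \<in> {\<lfloor>- B\<rfloor>..\<lfloor>B\<rfloor>} \<and> \<lfloor>Im z\<rfloor> \<in> {\<lfloor>- B\<rfloor>..\<lfloor>B\<rfloor>}"
      using B[OF that] abs_Re_le_cmod[of z] abs_Im_le_cmod[of z]
      by (auto intro!: floor_mono)
    then have d0: "real_of_int (dyadic_digit z 0) \<le> real N"
      using N[of "(\<lfloor>Re z\<rfloor>, \<lfloor>Im z\<rfloor>)"] by (simp add: dyadic_digit_def I_def)
    have sums: "(\<lambda>k. real N * (if k = 0 then 1 else 0) + 3 / 8 * (if k = 0 then 0 else (1 / 8 :: real) ^ (k - 1))) sums (real N * 1 + 3 / 8 * (1 / (1 - 1 / 8)))"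
    proof (intro sums_add sums_mult)
      show "(\<lambda>k :: nat. if k = 0 then 1 else 0 :: real) sums 1"
        using sums_single[of 0 "\<lambda>_. 1 :: real"] by simp
      have "(\<lambda>k. if Suc k = 0 then 0 else (1 / 8 :: real) ^ (Suc k - 1)) sums (1 / (1 - 1 / 8))"
        using geometric_sums[of "1 / 8 :: real"] by simp
      then show "(\<lambda>k :: nat. if k = 0 then 0 else (1 / 8 :: real) ^ (k - 1)) sums (1 / (1 - 1 / 8))"
        by (subst (asm) sums_Suc_iff) simp
    qed
    have le: "norm (real_of_int (dyadic_digit z k) / 8 ^ k)
        \<le> real N * (if k = 0 then 1 else 0) + 3 / 8 * (if k = 0 then 0 else (1 / 8) ^ (k - 1))" for k
    proof (cases k)
      case 0
      then show ?thesis using d0 by (simp add: dyadic_digit_def)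
    next
      case (Suc j)
      then show ?thesis using dyadic_digit_range[of z j]
        by (auto simp: field_simps power_divide)
    qed
    have "norm (line_code z) \<le> real N * 1 + 3 / 8 * (1 / (1 - 1 / 8))"
      unfolding line_code_def sums_unique[OF sums] by (rule norm_suminf_le[OF le sums_summable[OF sums]])
    then show ?thesis by simp
  qed
  then show ?thesis by (auto simp: bounded_iff)
qed

text \<open>By \<open>line_code_separation\<close> the inverse of the code is uniformly continuous
  on its range, with no continuity of the code itself. It therefore extends to the closure and, by
  Tietze, to the whole line.\<close>

lemma line_decode:
  obtains c :: "real \<Rightarrow> complex" where "continuous_on UNIV c" "\<And>z. c (line_code z) = z"
proof -
  have small: "\<exists>n. 2 / 2 ^ n < e" if e: "e > 0" for e :: real
  proof -
    obtain n where "(1 / 2 :: real) ^ n < e / 2"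
      using real_arch_pow_inv[of "e / 2" "1 / 2"] e by auto
    then show ?thesis by (intro exI[of _ n]) (simp add: power_divide field_simps)
  qed
  have inj: "inj line_code"
  proof (rule injI, rule ccontr)
    fix z z' assume eq: "line_code z = line_code z'" and "z \<noteq> z'"
    then obtain n where "2 / 2 ^ n < dist z z'" using small[of "dist z z'"] by (metis zero_less_dist_iff)
    moreover have "dist z z' \<le> 2 / 2 ^ n"
      by (rule line_code_separation) (simp add: eq)
    ultimately show False by simp
  qed
  have "uniformly_continuous_on (range line_code) (inv line_code)"
    unfolding uniformly_continuous_on_def
  proof (intro allI impI)
    fix e :: real assume "e > 0"
    then obtain n where n: "2 / 2 ^ n < e" using small by blast
    show "\<exists>d>0. \<forall>x\<in>range line_code. \<forall>x'\<in>range line_code. dist x' x < d \<longrightarrow>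
        dist (inv line_code x') (inv line_code x) < e"
    proof (intro exI[of _ "1 / (2 * 8 ^ n)"] conjI ballI impI)
      fix x x' assume "x \<in> range line_code" "x' \<in> range line_code" "dist x' x < 1 / (2 * 8 ^ n)"
      then show "dist (inv line_code x') (inv line_code x) < e"
        using line_code_separation n by (fastforce simp: inv_f_f[OF inj])
    qed simp
  qed
  then obtain g where g: "uniformly_continuous_on (closure (range line_code)) g"
      "\<And>x. x \<in> range line_code \<Longrightarrow> inv line_code x = g x"
    using uniformly_continuous_on_extension_on_closure by metis
  obtain c where c: "continuous_on UNIV c" "\<And>x. x \<in> closure (range line_code) \<Longrightarrow> c x = g x"
    using Tietze_unbounded[of "closure (range line_code)" g UNIV] uniformly_continuous_imp_continuous[OF g(1)]
    by auto
  show ?thesis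
  proof (rule that[OF c(1)])
    fix z
    have "c (line_code z) = g (line_code z)" by (rule c(2)) (use closure_subset[of "range line_code"] in blast)
    also have "\<dots> = z" using g(2)[of "line_code z"] by (simp add: inv_f_f[OF inj])
    finally show "c (line_code z) = z" .
  qed
qed

text \<open>A case of Prokhorov's theorem. The injection \<open>line_code\<close> into the line
  has a continuous left inverse, so Helly's selection theorem for the images suffices.\<close>

theorem tight_pmf_sequence_limit:
  fixes q :: "nat \<Rightarrow> complex pmf"
  assumes tight: "\<And>\<epsilon>. \<epsilon> > 0 \<Longrightarrow> \<exists>K. compact K \<and> (\<forall>\<^sub>F n in sequentially. measure (q n) K \<ge> 1 - \<epsilon>)"
  obtains r \<mu> where "strict_mono (r :: nat \<Rightarrow> nat)" "borel_prob \<mu>"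
    "\<And>\<phi> :: complex \<Rightarrow> real. \<phi> \<in> bcontfun \<Longrightarrow>
       (\<lambda>k. measure_pmf.expectation (q (r k)) \<phi>) \<longlonglongrightarrow> (LINT z|\<mu>. \<phi> z)"
proof -
  define m where "m n = distr (measure_pmf (q n)) borel line_code" for n
  have rd: "real_distribution (m n)" for n
    unfolding m_def real_distribution_def real_distribution_axioms_def
    by (auto intro!: measure_pmf.prob_space_distr)
  have mm: "measure (m n) A = measure (q n) (line_code -` A)" if "A \<in> sets borel" for n A
    using that by (simp add: m_def measure_distr)
  have "Helly_Selection.tight m"
    unfolding Helly_Selection.tight_def
  proof (intro conjI allI impI rd)
    fix \<epsilon> :: real assume "\<epsilon> > 0"
    then obtain K where K: "compact K" "\<forall>\<^sub>F n in sequentially. measure (q n) K \<ge> 1 - \<epsilon> / 2"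
      using tight[of "\<epsilon> / 2"] by auto
    obtain n0 where n0: "\<And>n. n \<ge> n0 \<Longrightarrow> measure (q n) K \<ge> 1 - \<epsilon> / 2"
      using K(2) by (auto simp: eventually_sequentially)
    \<comment> \<open>The bound by the mass of \<open>K\<close> concerns late \<open>n\<close> only.
      These intervals exhaust the line, which takes care of the finitely many earlier laws.\<close>
    define A where "A k = {- real k <.. real k}" for k
    have "(\<lambda>k. measure (m n) (A k)) \<longlonglongrightarrow> measure (m n) (\<Union>k. A k)" for n
    proof -
      interpret real_distribution "m n" by (rule rd)
      show ?thesis
        by (rule finite_Lim_measure_incseq) (auto simp: A_def incseq_def)
    qed
    moreover have UA: "(\<Union>k. A k) = UNIV"
    proof (intro set_eqI iffI UNIV_I)
      fix x :: real
      obtain k :: nat where "\<bar>x\<bar> < real k" using reals_Archimedean2 by blast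
      then have "x \<in> A k" by (auto simp: A_def)
      then show "x \<in> (\<Union>k. A k)" by blast
    qed
    moreover have "measure (m n) UNIV = 1" for n by (simp add: mm)
    ultimately have "(\<lambda>k. measure (m n) (A k)) \<longlonglongrightarrow> 1" for n by simp
    then have "\<forall>\<^sub>F k in sequentially. measure (m n) (A k) > 1 - \<epsilon>" for n
      using \<open>\<epsilon> > 0\<close> by (intro order_tendstoD(1)) auto
    then have ev: "\<forall>\<^sub>F k in sequentially. \<forall>n\<in>{..<n0}. measure (m n) (A k) > 1 - \<epsilon>"
      by (intro eventually_ball_finite) auto
    obtain B where B: "\<And>z. z \<in> K \<Longrightarrow> \<bar>line_code z\<bar> \<le> B"
      using line_code_bounded[OF compact_imp_bounded[OF K(1)]] by (auto simp: bounded_iff)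
    obtain k0 :: nat where k0: "B < real k0" using reals_Archimedean2 by blast
    obtain k where k: "k \<ge> Suc k0" "\<forall>n\<in>{..<n0}. measure (m n) (A k) > 1 - \<epsilon>"
      using eventually_happens[OF eventually_conj[OF eventually_ge_at_top[of "Suc k0"] ev]] by auto
    have "measure (m n) (A k) > 1 - \<epsilon>" for n
    proof (cases "n < n0")
      case False
      have "K \<subseteq> line_code -` A k"
      proof
        fix z assume "z \<in> K"
        then have "\<bar>line_code z\<bar> < real k" using B[of z] k0 k(1) by linarith
        then show "z \<in> line_code -` A k" by (auto simp: A_def)
      qed
      then have "measure (q n) K \<le> measure (m n) (A k)"
        by (subst mm) (auto simp: A_def intro: measure_pmf.finite_measure_mono)
      then show ?thesis using n0[of n] False \<open>\<epsilon> > 0\<close> by linarith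
    qed (use k in auto)
    moreover have "- real k < real k" using k(1) by simp
    ultimately show "\<exists>a b. a < b \<and> (\<forall>n. 1 - \<epsilon> < measure (m n) {a<..b})"
      unfolding A_def by blast
  qed
  from tight_imp_convergent_subsubsequence[OF this strict_mono_id]
  obtain r M where r: "strict_mono (r :: nat \<Rightarrow> nat)" "real_distribution M" "weak_conv_m (m \<circ> r) M"
    by auto
  interpret M: real_distribution M by (rule r(2))
  obtain c where c: "continuous_on UNIV c" "\<And>z. c (line_code z) = z" using line_decode by metis
  have cm: "c \<in> borel_measurable borel" using c(1) by (rule borel_measurable_continuous_onI)
  \<comment> \<open>\<open>c\<close> undoes the code on the given laws, so integrals of
    \<open>\<phi>\<close> become integrals of the continuous function \<open>\<phi> (c x)\<close> on
    the line, where weak convergence applies.\<close>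
  define \<mu> where "\<mu> = distr M borel c"
  have \<mu>: "borel_prob \<mu>"
    unfolding borel_prob_def \<mu>_def using cm by (auto intro!: M.prob_space_distr)
  show ?thesis
  proof (rule that[OF r(1) \<mu>])
    fix \<phi> :: "complex \<Rightarrow> real" assume "\<phi> \<in> bcontfun"
    then obtain B where B: "\<And>x. \<bar>\<phi> x\<bar> \<le> B" "continuous_on UNIV \<phi>"
      by (auto simp: bcontfun_def bounded_iff)
    have pm: "\<phi> \<in> borel_measurable borel" using B(2) by (rule borel_measurable_continuous_onI)
    have cc: "continuous_on UNIV (\<lambda>x. \<phi> (c x))"
      using continuous_on_compose2[OF B(2) c(1)] by simp
    have "(\<lambda>k. LINT x|(m \<circ> r) k. \<phi> (c x)) \<longlonglongrightarrow> (LINT x|M. \<phi> (c x))"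
      by (rule weak_conv_imp_integral_bdd_continuous_conv[OF _ _ r(3)])
         (use rd r(2) cc B(1) in \<open>auto simp: continuous_on_eq_continuous_at\<close>)
    moreover have "(LINT x|(m \<circ> r) k. \<phi> (c x)) = measure_pmf.expectation (q (r k)) \<phi>" for k
      unfolding m_def o_def
      by (subst integral_distr) (auto simp: c(2) intro!: borel_measurable_continuous_onI cc)
    moreover have "(LINT x|M. \<phi> (c x)) = (LINT z|\<mu>. \<phi> z)"
      unfolding \<mu>_def by (subst integral_distr) (use cm pm in auto)
    ultimately show "(\<lambda>k. measure_pmf.expectation (q (r k)) \<phi>) \<longlonglongrightarrow> (LINT z|\<mu>. \<phi> z)" by simp
  qed
qed

section \<open>The equilibrium measure\<close>

lemma borel_probD:
  assumes "borel_prob \<mu>"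
  shows "prob_space \<mu>" "sets \<mu> = sets borel" "space \<mu> = UNIV"
  using assms sets_eq_imp_space_eq[of \<mu> borel] by (auto simp: borel_prob_def)

lemma integrable_borel_prob:
  fixes \<phi> :: "complex \<Rightarrow> real"
  assumes "borel_prob \<mu>" "\<phi> \<in> borel_measurable borel" "\<And>x. \<bar>\<phi> x\<bar> \<le> B"
  shows "integrable \<mu> \<phi>"
proof -
  interpret prob_space \<mu> using borel_probD(1)[OF assms(1)] .
  show ?thesis
    using assms(2,3) borel_probD(2)[OF assms(1)]
    by (intro integrable_const_bound[where B=B]) (auto cong: measurable_cong_sets)
qed

lemma bcontfun_measurable: "\<phi> \<in> bcontfun \<Longrightarrow> \<phi> \<in> borel_measurable borel"
  by (auto simp: bcontfun_def intro: borel_measurable_continuous_onI)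

lemma integrable_bcontfun_real:
  fixes \<phi> :: "complex \<Rightarrow> real"
  assumes "borel_prob \<mu>" "\<phi> \<in> bcontfun"
  shows "integrable \<mu> \<phi>"
  using bcontfun_realE[OF assms(2)] integrable_borel_prob[OF assms(1) bcontfun_measurable[OF assms(2)]]
  by metis

lemma borel_prob_dominated_convergence:
  fixes h :: "nat \<Rightarrow> complex \<Rightarrow> real"
  assumes \<mu>: "borel_prob \<mu>" and h: "\<And>k. h k \<in> borel_measurable borel" and g: "g \<in> borel_measurable borel"
    and "\<And>x. (\<lambda>k. h k x) \<longlonglongrightarrow> g x" "\<And>k x. \<bar>h k x\<bar> \<le> B"
  shows "(\<lambda>k. LINT x|\<mu>. h k x) \<longlonglongrightarrow> (LINT x|\<mu>. g x)"
proof (rule integral_dominated_convergence[where w="\<lambda>_. B"])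
  interpret prob_space \<mu> using borel_probD(1)[OF \<mu>] .
  show "g \<in> borel_measurable \<mu>" "\<And>k. h k \<in> borel_measurable \<mu>" 
    using h g borel_probD(2)[OF \<mu>] by (auto cong: measurable_cong_sets)
  show "integrable \<mu> (\<lambda>_. B)" by simp
qed (use assms(4,5) in auto)

lemma closed_indicator_approx:
  fixes F :: "complex set"
  assumes "closed F"
  obtains \<phi> :: "nat \<Rightarrow> complex \<Rightarrow> real" where "\<And>n. \<phi> n \<in> bcontfun" "\<And>n x. \<bar>\<phi> n x\<bar> \<le> 1"
    "\<And>x. (\<lambda>n. \<phi> n x) \<longlonglongrightarrow> indicator F x"
proof (cases "F = {}")
  \<comment> \<open>The empty set is separate because \<open>infdist\<close> to it is 0, so the
    cutoffs below would be constantly 1.\<close>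
  case True
  then show ?thesis by (intro that[of "\<lambda>_ _. 0"]) (auto intro: bcontfun_realI[where B=0])
next
  case False
  define \<phi> where "\<phi> n x = max 0 (1 - real n * infdist x F)" for n x
  show ?thesis
  proof (rule that[of \<phi>])
    show b: "\<bar>\<phi> n x\<bar> \<le> 1" for n x using infdist_nonneg[of x F] by (auto simp: \<phi>_def abs_if max_def)
    show "\<phi> n \<in> bcontfun" for n
      by (rule bcontfun_realI[OF _ b]) (auto simp: \<phi>_def[abs_def] intro!: continuous_intros)
    show "(\<lambda>n. \<phi> n x) \<longlonglongrightarrow> indicator F x" for x
    proof (cases "x \<in> F")
      case True
      then show ?thesis by (simp add: \<phi>_def)
    next
      case False
      then have pos: "infdist x F > 0"
        using assms \<open>F \<noteq> {}\<close> by (simp add: infdist_pos_not_in_closed)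
      obtain n0 :: nat where n0: "1 / infdist x F < real n0" using reals_Archimedean2 by blast
      have "\<phi> n x = 0" if "n \<ge> n0" for n
      proof -
        have "1 / infdist x F < real n" using n0 that by linarith
        then show ?thesis using pos by (simp add: \<phi>_def field_simps)
      qed
      then have "\<forall>\<^sub>F n in sequentially. \<phi> n x = indicator F x"
        using False unfolding eventually_sequentially by auto
      then show ?thesis by (rule tendsto_eventually)
    qed
  qed
qed

text \<open>Closed sets form a generator stable under intersection, and their indicators are bounded
  pointwise limits of continuous functions.\<close>

lemma borel_prob_eqI:
  assumes \<mu>: "borel_prob \<mu>" and \<nu>: "borel_prob \<nu>"
    and eq: "\<And>\<phi> :: complex \<Rightarrow> real. \<phi> \<in> bcontfun \<Longrightarrow> (LINT x|\<mu>. \<phi> x) = (LINT x|\<nu>. \<phi> x)"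
  shows "\<mu> = \<nu>"
proof (rule measure_eqI_generator_eq[where A = "\<lambda>_. UNIV" and \<Omega> = UNIV and E = "Collect closed"])
  interpret M: prob_space \<mu> using borel_probD(1)[OF \<mu>] .
  interpret N: prob_space \<nu> using borel_probD(1)[OF \<nu>] .
  show "Int_stable (Collect closed)" by (auto simp: Int_stable_def)
  show "sets \<mu> = sigma_sets UNIV (Collect closed)" "sets \<nu> = sigma_sets UNIV (Collect closed)"
    using borel_probD(2)[OF \<mu>] borel_probD(2)[OF \<nu>] by (auto simp: borel_eq_closed)
  show "emeasure \<mu> X = emeasure \<nu> X" if "X \<in> Collect closed" for X
  proof -
    have X: "X \<in> sets borel" "closed X" using that by auto
    obtain \<phi> :: "nat \<Rightarrow> complex \<Rightarrow> real" where \<phi>: "\<And>n. \<phi> n \<in> bcontfun" "\<And>n x. \<bar>\<phi> n x\<bar> \<le> 1"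
      "\<And>x. (\<lambda>n. \<phi> n x) \<longlonglongrightarrow> indicator X x"
      using closed_indicator_approx[OF X(2)] by metis
    have ind: "indicator X \<in> borel_measurable (borel :: complex measure)" using X(1) by simp
    note dc = borel_prob_dominated_convergence[OF _ bcontfun_measurable[OF \<phi>(1)] ind \<phi>(3,2)]
    have "(LINT x|\<mu>. indicator X x :: real) = (LINT x|\<nu>. indicator X x)"
      using LIMSEQ_unique[OF dc[OF \<mu>] dc[OF \<nu>, folded eq[OF \<phi>(1)]]] .
    then show ?thesis
      using X(1) by (simp add: borel_probD(3)[OF \<mu>] borel_probD(3)[OF \<nu>] M.emeasure_eq_measure N.emeasure_eq_measure)
  qed
  show "emeasure \<mu> UNIV \<noteq> \<infinity>" by simp
qed auto

text \<open>By regularity \<open>B\<close> lies between a compact \<open>K\<close> and an open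
  \<open>U\<close> whose measures differ by less than \<epsilon>. A Urysohn function for the two
  differs from the indicator only on \<open>U - K\<close>, by at most 1.\<close>

lemma borel_prob_L1_approx:
  assumes \<mu>: "borel_prob \<mu>" and B: "B \<in> sets borel" and "\<epsilon> > 0"
  obtains \<phi> :: "complex \<Rightarrow> real" where "\<phi> \<in> bcontfun" "\<And>x. \<phi> x \<in> {0..1}"
    "(LINT x|\<mu>. \<bar>indicator B x - \<phi> x\<bar>) < \<epsilon>"
proof -
  interpret prob_space \<mu> using borel_probD(1)[OF \<mu>] .
  note s = borel_probD(2)[OF \<mu>]
  have fin: "emeasure \<mu> (space \<mu>) \<noteq> \<infinity>" by simp
  have "\<exists>U. B \<subseteq> U \<and> open U \<and> measure \<mu> U < measure \<mu> B + \<epsilon> / 2"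
  proof -
    have "(INF U \<in> {U. B \<subseteq> U \<and> open U}. emeasure \<mu> U) < ennreal (measure \<mu> B + \<epsilon> / 2)"
      unfolding outer_regular[OF s fin B, symmetric] using \<open>\<epsilon> > 0\<close>
      by (simp add: emeasure_eq_measure ennreal_less_iff)
    then show ?thesis by (auto simp: INF_less_iff emeasure_eq_measure ennreal_less_iff)
  qed
  then obtain U where U: "B \<subseteq> U" "open U" "measure \<mu> U < measure \<mu> B + \<epsilon> / 2" by blast
  have "\<exists>K. K \<subseteq> B \<and> compact K \<and> measure \<mu> B < measure \<mu> K + \<epsilon> / 2"
  \<comment> \<open>The case split keeps \<open>measure \<mu> B - \<epsilon> / 2\<close>
    nonnegative, since \<open>ennreal\<close> sends negative numbers to 0.\<close>
  proof (cases "measure \<mu> B < \<epsilon> / 2")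
    case True
    then show ?thesis by (intro exI[of _ "{}"]) auto
  next
    case False
    have "ennreal (measure \<mu> B - \<epsilon> / 2) < (SUP K \<in> {K. K \<subseteq> B \<and> compact K}. emeasure \<mu> K)"
      unfolding inner_regular[OF s fin B, symmetric] using \<open>\<epsilon> > 0\<close> False
      by (simp add: emeasure_eq_measure ennreal_less_iff)
    then obtain K where K: "K \<subseteq> B" "compact K" "ennreal (measure \<mu> B - \<epsilon> / 2) < ennreal (measure \<mu> K)"
      by (auto simp: less_SUP_iff emeasure_eq_measure)
    then have "measure \<mu> B - \<epsilon> / 2 < measure \<mu> K" using False by (simp add: ennreal_less_iff)
    then show ?thesis using K(1,2) by (intro exI[of _ K]) auto
  qed
  then obtain K where K: "K \<subseteq> B" "compact K" "measure \<mu> B < measure \<mu> K + \<epsilon> / 2" by blast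
  have "- U \<inter> K = {}" using U(1) K(1) by blast
  then obtain \<phi> :: "complex \<Rightarrow> real" where \<phi>: "continuous_on UNIV \<phi>" "\<And>x. \<phi> x \<in> closed_segment 0 1"
      "\<And>x. x \<in> - U \<Longrightarrow> \<phi> x = 0" "\<And>x. x \<in> K \<Longrightarrow> \<phi> x = 1"
    using Urysohn[of "- U" K "0::real" 1] U(2) K(2) by (metis closed_Compl compact_imp_closed)
  have \<phi>01: "\<phi> x \<in> {0..1}" for x using \<phi>(2)[of x] by (simp add: closed_segment_eq_real_ivl)
  have bc: "\<phi> \<in> bcontfun" by (rule bcontfun_realI[OF \<phi>(1), of 1]) (use \<phi>01 in force)
  have UK: "U \<in> sets \<mu>" "K \<in> sets \<mu>" using U K s by (auto simp: borel_compact)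
  have le: "\<bar>indicator B x - \<phi> x\<bar> \<le> indicator (U - K) x" for x
  proof (cases "x \<in> U - K")
    case True
    then show ?thesis using \<phi>01[of x] by (auto simp: indicator_def)
  next
    case False
    then have "indicator B x = \<phi> x"
      using \<phi>(3,4)[of x] U(1) K(1) by (auto simp: indicator_def)
    then show ?thesis by simp
  qed
  have "(LINT x|\<mu>. \<bar>indicator B x - \<phi> x\<bar>) \<le> (LINT x|\<mu>. indicator (U - K) x)"
  proof (rule integral_mono)
    show "integrable \<mu> (\<lambda>x. \<bar>indicator B x - \<phi> x\<bar>)"
      by (rule integrable_borel_prob[OF \<mu>, where B=1])
         (use B bcontfun_measurable[OF bc] order_trans[OF le] in \<open>auto simp: indicator_le_1\<close>)
    show "integrable \<mu> (indicator (U - K) :: complex \<Rightarrow> real)" by (rule integrable_borel_prob[OF \<mu>, where B=1]) (use UK s in \<open>auto simp: indicator_le_1 intro!: borel_measurable_indicator sets.Diff\<close>)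
  qed (rule le)
  also have "\<dots> = measure \<mu> (U - K)" using UK by simp
  also have "\<dots> = measure \<mu> U - measure \<mu> K"
    using UK U(1) K(1) by (intro finite_measure_Diff) auto
  also have "\<dots> < \<epsilon>" using U(3) K(3) by simp
  finally show ?thesis using that bc \<phi>01 by blast
qed

lemma transpose_op_power:
  "blinfun_apply ((transpose_op T ^^ n) L) \<phi> = blinfun_apply L ((blinfun_apply T ^^ n) \<phi>)"
  by (induction n arbitrary: L \<phi>) (simp_all add: transpose_op_def funpow_swap1)

lemma measure_functional_in_dual:
  assumes "borel_prob \<mu>"
  shows "measure_functional \<mu> \<in> Cb_dual"
  unfolding Cb_dual_def
proof (intro CollectI allI impI)
  fix c and \<phi> \<psi> :: "complex \<Rightarrow>\<^sub>C complex"
  assume "\<forall>z. apply_bcontfun \<psi> z = c * apply_bcontfun \<phi> z"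
  then have "apply_bcontfun \<psi> = (\<lambda>z. c * apply_bcontfun \<phi> z)" by auto
  then show "blinfun_apply (measure_functional \<mu>) \<psi> = c * blinfun_apply (measure_functional \<mu>) \<phi>"
    by (simp add: measure_functional_apply[OF assms])
qed

lemma bcontfun_Re_Im:
  fixes \<phi> :: "complex \<Rightarrow>\<^sub>C complex"
  shows "(\<lambda>z. Re (apply_bcontfun \<phi> z)) \<in> bcontfun" "(\<lambda>z. Im (apply_bcontfun \<phi> z)) \<in> bcontfun"
proof -
  have "\<bar>Re (apply_bcontfun \<phi> z)\<bar> \<le> norm \<phi>" "\<bar>Im (apply_bcontfun \<phi> z)\<bar> \<le> norm \<phi>" for z
    using norm_bounded[of \<phi> z] abs_Re_le_cmod abs_Im_le_cmod order_trans by blast+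
  then show "(\<lambda>z. Re (apply_bcontfun \<phi> z)) \<in> bcontfun" "(\<lambda>z. Im (apply_bcontfun \<phi> z)) \<in> bcontfun"
    by (auto intro!: bcontfun_realI continuous_intros)
qed

lemma Re_Im_LINT_bcontfun:
  fixes \<phi> :: "complex \<Rightarrow>\<^sub>C complex"
  assumes "borel_prob \<mu>"
  shows "Re (LINT z|\<mu>. apply_bcontfun \<phi> z) = (LINT z|\<mu>. Re (apply_bcontfun \<phi> z))"
    "Im (LINT z|\<mu>. apply_bcontfun \<phi> z) = (LINT z|\<mu>. Im (apply_bcontfun \<phi> z))"
  using integrable_bcontfun[OF assms, of \<phi>] by simp_all

context normal_tight_weight begin

lemma Re_Im_expectation:
  fixes \<phi> :: "complex \<Rightarrow>\<^sub>C complex"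
  shows "Re (measure_pmf.expectation (P n w) (apply_bcontfun \<phi>)) = E n (\<lambda>z. Re (apply_bcontfun \<phi> z)) w"
    "Im (measure_pmf.expectation (P n w) (apply_bcontfun \<phi>)) = E n (\<lambda>z. Im (apply_bcontfun \<phi> z)) w"
  using integrable_pmf_bounded[of "apply_bcontfun \<phi>" "norm \<phi>" "P n w"] by (simp_all add: E_def norm_bounded)

text \<open>Tightness yields a limit measure only along a subsequence of the laws at 0. The constant
  limit of \<open>A^n \<phi>\<close>, already known for the full sequence and every
  \<open>w\<close>, must then be its integral.\<close>

theorem equilibrium_exists:
  obtains \<mu> where "borel_prob \<mu>" "\<And>\<phi> w. \<phi> \<in> bcontfun \<Longrightarrow> (\<lambda>n. E n \<phi> w) \<longlonglongrightarrow> (LINT z|\<mu>. \<phi> z)"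
proof -
  have "\<exists>K. compact K \<and> (\<forall>\<^sub>F n in sequentially. measure (P n 0) K \<ge> 1 - \<epsilon>)" if "\<epsilon> > 0" for \<epsilon>
    using tightE[OF that] by metis
  then obtain r \<mu> where r: "strict_mono (r :: nat \<Rightarrow> nat)" "borel_prob \<mu>"
    "\<And>\<phi> :: complex \<Rightarrow> real. \<phi> \<in> bcontfun \<Longrightarrow>
       (\<lambda>k. measure_pmf.expectation (P (r k) 0) \<phi>) \<longlonglongrightarrow> (LINT z|\<mu>. \<phi> z)"
    using tight_pmf_sequence_limit[of "\<lambda>n. P n 0"] by metis
  show ?thesis
  proof (rule that[OF r(2)])
    fix \<phi> :: "complex \<Rightarrow> real" and w assume \<phi>: "\<phi> \<in> bcontfun"
    obtain c where c: "\<And>w. (\<lambda>n. E n \<phi> w) \<longlonglongrightarrow> c" using E_tendsto_constant[OF \<phi>] by metis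
    have "(\<lambda>k. E (r k) \<phi> 0) \<longlonglongrightarrow> c"
      using LIMSEQ_subseq_LIMSEQ[OF c[of 0] r(1)] by (simp add: o_def)
    then have "c = (LINT z|\<mu>. \<phi> z)" using LIMSEQ_unique r(3)[OF \<phi>] unfolding E_def by blast
    then show "(\<lambda>n. E n \<phi> w) \<longlonglongrightarrow> (LINT z|\<mu>. \<phi> z)" using c by simp
  qed
qed

end

section \<open>Invariance and mixing\<close>

locale equilibrium = normal_tight_weight +
  fixes \<mu> :: "complex measure"
  assumes \<mu>: "borel_prob \<mu>"
    and lim: "\<And>\<phi> w. \<phi> \<in> bcontfun \<Longrightarrow> (\<lambda>n. E n \<phi> w) \<longlonglongrightarrow> (LINT z|\<mu>. \<phi> z)"
begin

text \<open>The limit of \<open>A^(m+n) \<phi>\<close> at 0 as \<open>m\<close> grows is read in two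
  ways: for the function \<open>A^n \<phi>\<close>, and as a shifted sequence for
  \<open>\<phi>\<close>.\<close>

lemma integral_E:
  assumes "\<phi> \<in> bcontfun"
  shows "(LINT z|\<mu>. E n \<phi> z) = (LINT z|\<mu>. \<phi> z)"
proof (rule LIMSEQ_unique)
  show "(\<lambda>m. E m (E n \<phi>) 0) \<longlonglongrightarrow> (LINT z|\<mu>. E n \<phi> z)" by (rule lim[OF E_bcontfun[OF assms]])
  show "(\<lambda>m. E m (E n \<phi>) 0) \<longlonglongrightarrow> (LINT z|\<mu>. \<phi> z)"
    using LIMSEQ_ignore_initial_segment[OF lim[OF assms, of 0], of n] by (simp add: E_add[OF assms])
qed

lemma f_iterate_continuous: "continuous_on A (f ^^ n)"
  using surj_holomorphic_iterate(1)[OF f] holomorphic_on_imp_continuous_on continuous_on_subset by blast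

text \<open>On the fibre of \<open>f^n\<close> over \<open>w\<close> the first factor is constantly
  \<open>\<phi> w\<close>. Combined with \<open>integral_E\<close>, it makes \<open>A^n\<close>
  adjoint to composition with \<open>f^n\<close>.\<close>

lemma E_factor:
  "E n (\<lambda>z. \<phi> ((f ^^ n) z) * \<psi> z) w = \<phi> w * E n \<psi> w"
proof -
  have "E n (\<lambda>z. \<phi> ((f ^^ n) z) * \<psi> z) w = measure_pmf.expectation (P n w) (\<lambda>z. \<phi> w * \<psi> z)"
    unfolding E_def by (rule integral_cong_AE)
      (auto simp: AE_measure_pmf_iff set_iter_kernel[OF f weight nonzero])
  then show ?thesis by (simp add: E_def)
qed

lemma bcontfun_comp_times:
  fixes \<phi> \<psi> :: "complex \<Rightarrow> real"
  assumes "\<phi> \<in> bcontfun" "\<psi> \<in> bcontfun"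
  shows "(\<lambda>z. \<phi> ((f ^^ n) z) * \<psi> z) \<in> bcontfun"
proof -
  obtain B where B: "\<And>x. \<bar>\<phi> x\<bar> \<le> B" "continuous_on UNIV \<phi>" using bcontfun_realE[OF assms(1)] by metis
  obtain C where C: "\<And>x. \<bar>\<psi> x\<bar> \<le> C" "continuous_on UNIV \<psi>" using bcontfun_realE[OF assms(2)] by metis
  show ?thesis
  proof (rule bcontfun_realI)
    show "continuous_on UNIV (\<lambda>z. \<phi> ((f ^^ n) z) * \<psi> z)"
      by (intro continuous_on_mult continuous_on_compose2[OF B(2) f_iterate_continuous] C) auto
    show "\<bar>\<phi> ((f ^^ n) z) * \<psi> z\<bar> \<le> B * C" for z
      unfolding abs_mult using B(1) C(1) by (intro mult_mono order_trans[OF abs_ge_zero B(1)]) auto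
  qed
qed

lemma correlation:
  assumes "\<phi> \<in> bcontfun" "\<psi> \<in> bcontfun"
  shows "(LINT z|\<mu>. \<phi> ((f ^^ n) z) * \<psi> z) = (LINT z|\<mu>. \<phi> z * E n \<psi> z)"
  using integral_E[OF bcontfun_comp_times[OF assms, of n], of n] by (simp add: E_factor)

lemma f_iterate_measurable: "f ^^ n \<in> borel_measurable borel"
  by (rule borel_measurable_continuous_onI[OF f_iterate_continuous])

lemma distr_iterate: "distr \<mu> borel (f ^^ n) = \<mu>"
proof (rule borel_prob_eqI[OF _ \<mu>])
  have meas: "f ^^ n \<in> measurable \<mu> borel"
    using f_iterate_measurable borel_probD(2)[OF \<mu>] by (auto cong: measurable_cong_sets)
  then show "borel_prob (distr \<mu> borel (f ^^ n))"
    unfolding borel_prob_def using prob_space.prob_space_distr[OF borel_probD(1)[OF \<mu>]] by auto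
  fix \<phi> :: "complex \<Rightarrow> real" assume \<phi>: "\<phi> \<in> bcontfun"
  have one: "(\<lambda>_ :: complex. 1 :: real) \<in> bcontfun" by (rule bcontfun_realI[where B=1]) auto
  have "(LINT x|distr \<mu> borel (f ^^ n). \<phi> x) = (LINT x|\<mu>. \<phi> ((f ^^ n) x))"
    by (rule integral_distr[OF meas bcontfun_measurable[OF \<phi>]])
  also have "\<dots> = (LINT x|\<mu>. \<phi> x)"
    using correlation[OF \<phi> one, of n] by (simp add: E_def)
  finally show "(LINT x|distr \<mu> borel (f ^^ n). \<phi> x) = (LINT x|\<mu>. \<phi> x)" .
qed

lemma invariant: "invariant_measure f \<mu>"
  using distr_iterate[of 1] by (simp add: invariant_measure_def)

lemma correlation_tendsto:
  fixes \<phi> \<psi> :: "complex \<Rightarrow> real"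
  assumes \<phi>: "\<phi> \<in> bcontfun" and \<psi>: "\<psi> \<in> bcontfun"
  shows "(\<lambda>n. LINT z|\<mu>. \<phi> ((f ^^ n) z) * \<psi> z) \<longlonglongrightarrow> (LINT z|\<mu>. \<phi> z) * (LINT z|\<mu>. \<psi> z)"
proof -
  obtain B where B: "\<And>x. \<bar>\<phi> x\<bar> \<le> B" using bcontfun_realE[OF \<phi>] by metis
  obtain C where C: "\<And>x. \<bar>\<psi> x\<bar> \<le> C" using bcontfun_realE[OF \<psi>] by metis
  have "(\<lambda>n. LINT z|\<mu>. \<phi> z * E n \<psi> z) \<longlonglongrightarrow> (LINT z|\<mu>. \<phi> z * (LINT z|\<mu>. \<psi> z))"
  proof (rule borel_prob_dominated_convergence[OF \<mu>, where B = "B * C"])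
    show "\<bar>\<phi> z * E n \<psi> z\<bar> \<le> B * C" for n z
      unfolding abs_mult using B E_bound[OF C] by (intro mult_mono order_trans[OF abs_ge_zero B]) auto
    show "(\<lambda>n. \<phi> z * E n \<psi> z) \<longlonglongrightarrow> \<phi> z * (LINT z|\<mu>. \<psi> z)" for z
      by (intro tendsto_intros lim[OF \<psi>])
  qed (use bcontfun_measurable[OF \<phi>] bcontfun_measurable[OF E_bcontfun[OF \<psi>]] in auto)
  then show ?thesis by (simp add: correlation[OF \<phi> \<psi>])
qed

lemma mixing: "mixing f \<mu>"
  unfolding mixing_def
proof (intro ballI)
  interpret prob_space \<mu> using borel_probD(1)[OF \<mu>] .
  fix B C :: "complex set" assume BC: "B \<in> sets borel" "C \<in> sets borel"
  have meas: "f ^^ n \<in> measurable \<mu> borel" for n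
    using f_iterate_measurable borel_probD(2)[OF \<mu>] by (auto cong: measurable_cong_sets)
  show "(\<lambda>n. measure \<mu> ((f ^^ n) -` B \<inter> C)) \<longlonglongrightarrow> measure \<mu> B * measure \<mu> C"
  proof (rule LIMSEQ_I)
    fix e :: real assume "e > 0"
    \<comment> \<open>Passing from indicators to continuous functions costs
      \<open>2 * \<epsilon>\<close> in the correlation and \<open>2 * \<epsilon>\<close> in the
      product of measures; the convergence of correlations costs one more \<epsilon>.\<close>
    define \<epsilon> where "\<epsilon> = e / 5"
    have "\<epsilon> > 0" using \<open>e > 0\<close> by (simp add: \<epsilon>_def)
    obtain \<phi> :: "complex \<Rightarrow> real" where \<phi>: "\<phi> \<in> bcontfun" "\<And>x. \<phi> x \<in> {0..1}"
      "(LINT x|\<mu>. \<bar>indicator B x - \<phi> x\<bar>) < \<epsilon>"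
      using borel_prob_L1_approx[OF \<mu> BC(1) \<open>\<epsilon> > 0\<close>] by metis
    obtain \<psi> :: "complex \<Rightarrow> real" where \<psi>: "\<psi> \<in> bcontfun" "\<And>x. \<psi> x \<in> {0..1}"
      "(LINT x|\<mu>. \<bar>indicator C x - \<psi> x\<bar>) < \<epsilon>"
      using borel_prob_L1_approx[OF \<mu> BC(2) \<open>\<epsilon> > 0\<close>] by metis
    note [measurable] = BC f_iterate_measurable bcontfun_measurable[OF \<phi>(1)] bcontfun_measurable[OF \<psi>(1)]
    have prod_le: "\<bar>a * b - c * d\<bar> \<le> \<bar>a - c\<bar> + \<bar>b - d\<bar>"
      if "a \<in> {0..1}" "d \<in> {0..1}" for a b c d :: real
    proof -
      have "a * b - c * d = a * (b - d) + (a - c) * d" by (simp add: algebra_simps)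
      also have "\<bar>\<dots>\<bar> \<le> \<bar>a\<bar> * \<bar>b - d\<bar> + \<bar>a - c\<bar> * \<bar>d\<bar>"
        by (metis abs_mult abs_triangle_ineq)
      also have "\<dots> \<le> 1 * \<bar>b - d\<bar> + \<bar>a - c\<bar> * 1"
        using that by (intro add_mono mult_mono) auto
      finally show ?thesis by simp
    qed
    have ind01: "indicator A x \<in> {0..1 :: real}" for A and x :: complex by (auto simp: indicator_def)
    have bnd: "\<bar>indicator A x - u\<bar> \<le> 1" if "u \<in> {0..1 :: real}" for A u and x :: complex
      using that by (auto simp: indicator_def)
    have d1: "\<bar>measure \<mu> ((f ^^ n) -` B \<inter> C) - (LINT z|\<mu>. \<phi> ((f ^^ n) z) * \<psi> z)\<bar> < 2 * \<epsilon>" for n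
    proof -
      have "(f ^^ n) -` B \<inter> C \<in> sets borel"
        using measurable_sets[OF f_iterate_measurable BC(1), of n] BC(2) by auto
      then have "measure \<mu> ((f ^^ n) -` B \<inter> C) = (LINT z|\<mu>. indicator ((f ^^ n) -` B \<inter> C) z)"
        by (simp add: borel_probD(3)[OF \<mu>])
      also have "\<dots> = (LINT z|\<mu>. indicator B ((f ^^ n) z) * indicator C z)"
        by (intro Bochner_Integration.integral_cong) (auto split: split_indicator)
      finally have "\<bar>measure \<mu> ((f ^^ n) -` B \<inter> C) - (LINT z|\<mu>. \<phi> ((f ^^ n) z) * \<psi> z)\<bar> =
          \<bar>LINT z|\<mu>. indicator B ((f ^^ n) z) * indicator C z - \<phi> ((f ^^ n) z) * \<psi> z\<bar>"
      proof (subst Bochner_Integration.integral_diff)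
        show "integrable \<mu> (\<lambda>z. indicator B ((f ^^ n) z) * indicator C z :: real)"
          by (rule integrable_borel_prob[OF \<mu>, where B=1]) (auto simp: indicator_def)
        show "integrable \<mu> (\<lambda>z. \<phi> ((f ^^ n) z) * \<psi> z)"
          by (rule integrable_bcontfun_real[OF \<mu> bcontfun_comp_times[OF \<phi>(1) \<psi>(1)]])
      qed simp
      also have "\<dots> \<le> (LINT z|\<mu>. \<bar>indicator B ((f ^^ n) z) * indicator C z - \<phi> ((f ^^ n) z) * \<psi> z\<bar>)"
        by (rule integral_abs_bound)
      also have "\<dots> \<le> (LINT z|\<mu>. \<bar>indicator B ((f ^^ n) z) - \<phi> ((f ^^ n) z)\<bar> + \<bar>indicator C z - \<psi> z\<bar>)"
      proof (rule integral_mono)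
        have le: "\<bar>indicator B ((f ^^ n) z) * indicator C z - \<phi> ((f ^^ n) z) * \<psi> z\<bar> \<le>
            \<bar>indicator B ((f ^^ n) z) - \<phi> ((f ^^ n) z)\<bar> + \<bar>indicator C z - \<psi> z\<bar>" for z
          by (rule prod_le[OF ind01 \<psi>(2)])
        then show "\<bar>indicator B ((f ^^ n) z) * indicator C z - \<phi> ((f ^^ n) z) * \<psi> z\<bar> \<le>
            \<bar>indicator B ((f ^^ n) z) - \<phi> ((f ^^ n) z)\<bar> + \<bar>indicator C z - \<psi> z\<bar>" for z .
        have le2: "\<bar>indicator B ((f ^^ n) z) - \<phi> ((f ^^ n) z)\<bar> + \<bar>indicator C z - \<psi> z\<bar> \<le> 2" for z
          using bnd[OF \<phi>(2), of B "(f ^^ n) z" "(f ^^ n) z"] bnd[OF \<psi>(2), of C z z] by linarith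
        show "integrable \<mu> (\<lambda>z. \<bar>indicator B ((f ^^ n) z) - \<phi> ((f ^^ n) z)\<bar> + \<bar>indicator C z - \<psi> z\<bar>)"
          by (rule integrable_borel_prob[OF \<mu>, where B=2]) (use le2 in auto)
        show "integrable \<mu> (\<lambda>z. \<bar>indicator B ((f ^^ n) z) * indicator C z - \<phi> ((f ^^ n) z) * \<psi> z\<bar>)"
          by (rule integrable_borel_prob[OF \<mu>, where B=2]) (use order_trans[OF le le2] in auto)
      qed
      also have "\<dots> = (LINT z|\<mu>. \<bar>indicator B ((f ^^ n) z) - \<phi> ((f ^^ n) z)\<bar>) + (LINT z|\<mu>. \<bar>indicator C z - \<psi> z\<bar>)"
        by (intro Bochner_Integration.integral_add integrable_borel_prob[OF \<mu>, where B=1])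
           (use bnd[OF \<phi>(2)] bnd[OF \<psi>(2)] in auto)
      \<comment> \<open>Invariance removes \<open>f^n\<close>, so the approximation error does not
        depend on \<open>n\<close>.\<close>
      also have "(LINT z|\<mu>. \<bar>indicator B ((f ^^ n) z) - \<phi> ((f ^^ n) z)\<bar>) =
          (LINT z|distr \<mu> borel (f ^^ n). \<bar>indicator B z - \<phi> z\<bar>)"
        by (rule integral_distr[OF meas, symmetric]) simp
      finally show ?thesis using \<phi>(3) \<psi>(3) by (simp add: distr_iterate)
    qed
    have d2: "\<bar>measure \<mu> B * measure \<mu> C - (LINT z|\<mu>. \<phi> z) * (LINT z|\<mu>. \<psi> z)\<bar> < 2 * \<epsilon>"
    proof -
      have diff: "\<bar>measure \<mu> A - (LINT z|\<mu>. \<eta> z)\<bar> \<le> (LINT x|\<mu>. \<bar>indicator A x - \<eta> x\<bar>)"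
        if "A \<in> sets borel" "\<eta> \<in> bcontfun" for A \<eta>
      proof -
        have "measure \<mu> A - (LINT z|\<mu>. \<eta> z) = (LINT x|\<mu>. indicator A x - \<eta> x)"
        proof -
          have "integrable \<mu> (indicator A :: complex \<Rightarrow> real)"
            by (rule integrable_borel_prob[OF \<mu>, where B=1]) (use that(1) in \<open>auto simp: indicator_def\<close>)
          then show ?thesis
            using that integrable_bcontfun_real[OF \<mu> that(2)]
            by (simp add: borel_probD(3)[OF \<mu>])
        qed
        then show ?thesis using integral_abs_bound[of \<mu> "\<lambda>x. indicator A x - \<eta> x"] by simp
      qed
      have "(LINT z|\<mu>. \<psi> z) \<in> {0..1}"
      proof -
        have "(LINT z|\<mu>. \<psi> z) \<le> (LINT z|\<mu>. 1)"
          using \<psi>(2) by (intro integral_mono integrable_bcontfun_real[OF \<mu> \<psi>(1)]) auto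
        moreover have "(LINT z|\<mu>. \<psi> z) \<ge> 0" using \<psi>(2) by (intro Bochner_Integration.integral_nonneg) auto
        ultimately show ?thesis by (simp add: prob_space)
      qed
      then have "\<bar>measure \<mu> B * measure \<mu> C - (LINT z|\<mu>. \<phi> z) * (LINT z|\<mu>. \<psi> z)\<bar> \<le>
          \<bar>measure \<mu> B - (LINT z|\<mu>. \<phi> z)\<bar> + \<bar>measure \<mu> C - (LINT z|\<mu>. \<psi> z)\<bar>"
        by (intro prod_le) auto
      then show ?thesis
        using diff[OF BC(1) \<phi>(1)] diff[OF BC(2) \<psi>(1)] \<phi>(3) \<psi>(3) by linarith
    qed
    obtain n0 where n0: "\<And>n. n \<ge> n0 \<Longrightarrow>
        \<bar>(LINT z|\<mu>. \<phi> ((f ^^ n) z) * \<psi> z) - (LINT z|\<mu>. \<phi> z) * (LINT z|\<mu>. \<psi> z)\<bar> < \<epsilon>"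
      using LIMSEQ_D[OF correlation_tendsto[OF \<phi>(1) \<psi>(1)] \<open>\<epsilon> > 0\<close>] by auto
    have "norm (measure \<mu> ((f ^^ n) -` B \<inter> C) - measure \<mu> B * measure \<mu> C) < e" if "n \<ge> n0" for n
      using n0[OF that] d1[of n] d2 unfolding real_norm_def \<epsilon>_def by linarith
    then show "\<exists>n0. \<forall>n\<ge>n0. norm (measure \<mu> ((f ^^ n) -` B \<inter> C) - measure \<mu> B * measure \<mu> C) < e"
      by blast
  qed
qed

end

section \<open>Support and convergence of measures\<close>

context equilibrium begin

lemma integral_pos_of_support:
  fixes g :: "complex \<Rightarrow> real"
  assumes g: "g \<in> bcontfun" "\<And>x. g x \<ge> 0" and z: "z \<in> measure_support \<mu>" "g z > 0"
  shows "(LINT x|\<mu>. g x) > 0"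
proof (rule ccontr)
  assume "\<not> ?thesis"
  moreover have "(LINT x|\<mu>. g x) \<ge> 0" using g(2) by (intro Bochner_Integration.integral_nonneg) auto
  ultimately have "(LINT x|\<mu>. g x) = 0" by simp
  then have "AE x in \<mu>. g x = 0"
    using g by (subst (asm) integral_nonneg_eq_0_iff_AE[OF integrable_bcontfun_real[OF \<mu> g(1)]]) auto
  moreover have op: "open {x. g x > 0}"
    using g(1) by (intro open_Collect_less) (auto simp: bcontfun_def)
  ultimately have "emeasure \<mu> {x. g x > 0} = 0"
    using borel_probD(2,3)[OF \<mu>]
    by (subst (asm) AE_iff_measurable[of "{x. g x \<noteq> 0}"])
       (use g(2) bcontfun_measurable[OF g(1)] in \<open>auto simp: less_le intro!: emeasure_eq_0[of "{x. g x \<noteq> 0}" \<mu>]\<close>)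
  then show False using z op unfolding measure_support_def by force
qed

text \<open>A tent function \<open>g\<close> at \<open>y\<close> has \<open>A g > 0\<close> at
  \<open>f y\<close>, because the preimage \<open>y\<close> has positive weight. Hence
  \<open>A g\<close> has positive integral, and by invariance so does \<open>g\<close>, whose
  support can be taken as small as desired.\<close>

lemma support_backward_invariant:
  assumes "f y \<in> measure_support \<mu>"
  shows "y \<in> measure_support \<mu>"
  unfolding measure_support_def
proof (intro CollectI allI impI, elim conjE)
  fix U assume "open U" "y \<in> U"
  then obtain e where e: "e > 0" "ball y e \<subseteq> U" using open_contains_ball by blast
  define g where "g x = max 0 (e - dist x y)" for x
  have g0: "g x \<ge> 0" "\<bar>g x\<bar> \<le> e" for x using e(1) by (auto simp: g_def)
  have g: "g \<in> bcontfun"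
    by (rule bcontfun_realI[OF _ g0(2)]) (auto simp: g_def[abs_def] intro!: continuous_intros)
  have E0: "E 1 g x \<ge> 0" for x unfolding E_def using g0 by (intro Bochner_Integration.integral_nonneg) auto
  have "E 1 g (f y) > 0"
  proof (rule ccontr)
    assume "\<not> ?thesis"
    then have "E 1 (\<lambda>x. - g x) (f y) = 0" using E0[of "f y"] by (simp add: E_uminus)
    moreover have "y \<in> set_pmf (P 1 (f y))"
      unfolding set_iter_kernel[OF f weight nonzero] by simp
    ultimately have "- g y = 0"
      unfolding E_def by (intro expectation_pmf_eq_upper_bound[where B=e and S=0 and h="\<lambda>x. - g x"]) (use g0 in auto)
    then show False using e(1) by (simp add: g_def)
  qed
  then have "(LINT x|\<mu>. E 1 g x) > 0"
    by (intro integral_pos_of_support[OF E_bcontfun[OF g] E0 assms])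
  then have pos: "(LINT x|\<mu>. g x) > 0" using integral_E[OF g] by simp
  show "emeasure \<mu> U > 0"
  proof (rule ccontr)
    assume "\<not> ?thesis"
    then have "emeasure \<mu> U = 0" by simp
    moreover have "U \<in> sets \<mu>" using \<open>open U\<close> borel_probD(2)[OF \<mu>] by simp
    ultimately have "AE x in \<mu>. x \<notin> U" by (auto intro!: AE_I'[of U] null_setsI)
    then have "AE x in \<mu>. g x = 0"
      by (rule AE_mp) (use e(2) in \<open>auto intro!: AE_I2 simp: g_def subset_eq dist_commute not_less\<close>)
    then have "(LINT x|\<mu>. g x) = 0" by (simp add: integral_eq_zero_AE)
    then show False using pos by simp
  qed
qed

lemma support_nonempty: "measure_support \<mu> \<noteq> {}"
proof
  assume "measure_support \<mu> = {}"
  then have "\<forall>z. \<exists>U. open U \<and> z \<in> U \<and> emeasure \<mu> U = 0"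
    unfolding measure_support_def by (auto simp: not_gr_zero)
  then obtain U where U: "\<And>z. open (U z)" "\<And>z. z \<in> U z" "\<And>z. emeasure \<mu> (U z) = 0" by metis
  obtain F where F: "F \<subseteq> range U" "countable F" "\<Union>F = \<Union>(range U)"
    by (rule Lindelof[of "range U"]) (use U(1) in auto)
  have "(\<Union>X\<in>F. X) \<in> null_sets \<mu>"
    using F(1) U borel_probD(2)[OF \<mu>] by (intro null_sets_UN'[OF F(2)]) (auto intro!: null_setsI)
  moreover have "(\<Union>X\<in>F. X) = UNIV" using F(3) U(2) by auto
  ultimately have "emeasure \<mu> UNIV = 0" by auto
  then show False
    using prob_space.emeasure_space_1[OF borel_probD(1)[OF \<mu>]] borel_probD(3)[OF \<mu>] by simp
qed

lemma closed_support: "closed (measure_support \<mu>)"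
proof -
  have "open (- measure_support \<mu>)"
    by (subst open_subopen) (force simp: measure_support_def)
  then show ?thesis by (simp add: closed_def)
qed

text \<open>The targets are constantly the support, and the compact set is a single point of it, so
  backward invariance is all that has to be checked.\<close>

lemma julia_subset_support: "julia_set f \<subseteq> measure_support \<mu>"
proof -
  obtain z where z: "z \<in> measure_support \<mu>" using support_nonempty by blast
  have "julia_set f \<subseteq> closure (measure_support \<mu>)"
    by (rule julia_subset[of "{z}" "\<lambda>_. measure_support \<mu>"])
       (use support_backward_invariant z in auto)
  then show ?thesis using closed_support by (simp add: closure_closed)
qed

text \<open>Mixing gives the limit \<open>measure \<mu> B * measure \<mu> V > 0\<close>. It holds
  for all late \<open>n\<close>, so it is still available along the subsequence chosen by
  normality.\<close>

lemma support_transitive: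
  assumes "z \<in> measure_support \<mu>" "open V" "z \<in> V" "y \<in> measure_support \<mu>" "open B" "y \<in> B"
  shows "\<forall>\<^sub>F n in sequentially. \<exists>x\<in>V. (f ^^ n) x \<in> B"
proof -
  interpret prob_space \<mu> using borel_probD(1)[OF \<mu>] .
  have "measure \<mu> V > 0" "measure \<mu> B > 0"
    using assms unfolding measure_support_def by (auto simp: emeasure_eq_measure)
  then have pos: "measure \<mu> B * measure \<mu> V > 0" by simp
  have "(\<lambda>n. measure \<mu> ((f ^^ n) -` B \<inter> V)) \<longlonglongrightarrow> measure \<mu> B * measure \<mu> V"
    using mixing assms(2,5) unfolding mixing_def by auto
  from order_tendstoD(1)[OF this pos] show ?thesis
  proof (rule eventually_mono)
    fix n assume "0 < measure \<mu> ((f ^^ n) -` B \<inter> V)"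
    then have "(f ^^ n) -` B \<inter> V \<noteq> {}" by auto
    then show "\<exists>x\<in>V. (f ^^ n) x \<in> B" by blast
  qed
qed

lemma support_subset_julia: "measure_support \<mu> \<subseteq> julia_set f"
proof
  fix z assume z: "z \<in> measure_support \<mu>"
  show "z \<in> julia_set f"
  proof (rule ccontr)
    assume "z \<notin> julia_set f"
    then obtain U where U: "open U" "z \<in> U" "normal_family U (range (\<lambda>n. f ^^ n))"
      by (auto simp: julia_set_def fatou_set_def)
    have "range (\<lambda>n. f ^^ n) \<subseteq> range (\<lambda>n. f ^^ n)" ..
    then obtain r where r: "strict_mono (r :: nat \<Rightarrow> nat)"
      "(\<exists>g. g holomorphic_on U \<and> locally_uniform_limit U ((\<lambda>n. f ^^ n) \<circ> r) g) \<or>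
         locally_uniform_limit_infinity U ((\<lambda>n. f ^^ n) \<circ> r)"
      using U(3) unfolding normal_family_def by blast
    have trans: "\<forall>\<^sub>F n in sequentially. \<exists>x\<in>V. (f ^^ r n) x \<in> B"
      if "open V" "z \<in> V" "y \<in> measure_support \<mu>" "open B" "y \<in> B" for V y B
      using eventually_subseq[OF r(1) support_transitive[OF z that]] .
    from r(2) show False
    proof
      assume "locally_uniform_limit_infinity U ((\<lambda>n. f ^^ n) \<circ> r)"
      then obtain V where V: "open V" "z \<in> V"
        "\<And>M. \<forall>\<^sub>F n in sequentially. \<forall>x\<in>V \<inter> U. norm ((f ^^ r n) x) \<ge> M"
        using U(2) unfolding locally_uniform_limit_infinity_def o_def by blast
      have "\<forall>\<^sub>F n in sequentially. \<exists>x\<in>V \<inter> U. (f ^^ r n) x \<in> ball z 1"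
        by (rule trans) (use V U z in auto)
      with V(3)[of "norm z + 1"] have "\<forall>\<^sub>F n in sequentially. False"
      proof eventually_elim
        case (elim n)
        then obtain x where "norm ((f ^^ r n) x) \<ge> norm z + 1" "dist z ((f ^^ r n) x) < 1" by auto
        then show False using norm_triangle_sub[of "(f ^^ r n) x" z] by (simp add: dist_norm norm_minus_commute)
      qed
      then show False by simp
    next
      assume "\<exists>g. g holomorphic_on U \<and> locally_uniform_limit U ((\<lambda>n. f ^^ n) \<circ> r) g"
      then obtain g where g: "g holomorphic_on U" "locally_uniform_limit U ((\<lambda>n. f ^^ n) \<circ> r) g" by blast
      obtain V where V: "open V" "z \<in> V" "uniform_limit (V \<inter> U) ((\<lambda>n. f ^^ n) \<circ> r) g sequentially"
        using g(2) U(2) unfolding locally_uniform_limit_def by blast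
      \<comment> \<open>A holomorphic limit \<open>g\<close> concentrates the images of small
        neighbourhoods of \<open>z\<close> near \<open>g z\<close>, whereas by mixing they come
        close to every point of the support. One third of the distance goes to each of the three
        errors.\<close>
      have only: "y = g z" if y: "y \<in> measure_support \<mu>" for y
      proof (rule ccontr)
        assume "y \<noteq> g z"
        define e where "e = dist y (g z) / 3"
        have "e > 0" using \<open>y \<noteq> g z\<close> by (simp add: e_def)
        have "continuous_on U g" by (rule holomorphic_on_imp_continuous_on[OF g(1)])
        then have "open (U \<inter> g -` ball (g z) e)" using U(1) by (intro continuous_open_preimage) auto
        then have "\<forall>\<^sub>F n in sequentially. \<exists>x\<in>V \<inter> (U \<inter> g -` ball (g z) e). (f ^^ r n) x \<in> ball y e"
          by (intro trans) (use V U y \<open>e > 0\<close> in auto)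
        moreover have "\<forall>\<^sub>F n in sequentially. \<forall>x\<in>V \<inter> U. dist (((\<lambda>n. f ^^ n) \<circ> r) n x) (g x) < e"
          by (rule uniform_limitD[OF V(3) \<open>e > 0\<close>])
        ultimately have "\<forall>\<^sub>F n in sequentially. False"
        proof eventually_elim
          case (elim n)
          then obtain x where x: "dist (g z) (g x) < e" "dist y ((f ^^ r n) x) < e" "dist ((f ^^ r n) x) (g x) < e"
            by auto
          have "dist y (g z) \<le> dist y ((f ^^ r n) x) + dist ((f ^^ r n) x) (g x) + dist (g z) (g x)"
            by (metis add.assoc add_left_mono dist_commute dist_triangle dist_triangle_le order_refl)
          then show False using x by (simp add: e_def)
        qed
        then show False by simp
      qed
      have single: "y = z" if "y \<in> measure_support \<mu>" for y using only[OF that] only[OF z] by simp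
      \<comment> \<open>A one-point support that is backward invariant contains the whole backward
        orbit of its point, which is then exceptional.\<close>
      have "x = z" if "(f ^^ n) x = z" for n x
      proof (rule single)
        have "(f ^^ n) x \<in> measure_support \<mu> \<Longrightarrow> x \<in> measure_support \<mu>"
          by (induction n) (auto dest: support_backward_invariant)
        then show "x \<in> measure_support \<mu>" unfolding that using z .
      qed
      then have "(\<Union>n. (f ^^ n) -` {z}) \<subseteq> {z}" by blast
      then show False using no_exceptional finite_subset unfolding exceptional_def by blast
    qed
  qed
qed

lemma support_eq_julia: "measure_support \<mu> = julia_set f"
  using support_subset_julia julia_subset_support by blast

section \<open>Weak convergence and the transpose operator\<close>

lemma Re_Im_tendsto:
  fixes \<phi> :: "complex \<Rightarrow>\<^sub>C complex"
  assumes "borel_prob \<nu>" "\<And>n. borel_prob (N n)"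
    and "\<And>\<psi> :: complex \<Rightarrow> real. \<psi> \<in> bcontfun \<Longrightarrow> (\<lambda>n. LINT z|N n. \<psi> z) \<longlonglongrightarrow> (LINT z|\<nu>. \<psi> z)"
  shows "(\<lambda>n. LINT z|N n. apply_bcontfun \<phi> z) \<longlonglongrightarrow> (LINT z|\<nu>. apply_bcontfun \<phi> z)"
  unfolding tendsto_complex_iff Re_Im_LINT_bcontfun[OF assms(1)] Re_Im_LINT_bcontfun[OF assms(2)]
  using assms(3)[OF bcontfun_Re_Im(1)] assms(3)[OF bcontfun_Re_Im(2)] by blast

lemma expectation_tendsto:
  fixes \<phi> :: "complex \<Rightarrow>\<^sub>C complex"
  shows "(\<lambda>n. measure_pmf.expectation (P n w) (apply_bcontfun \<phi>)) \<longlonglongrightarrow> (LINT z|\<mu>. apply_bcontfun \<phi> z)"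
  unfolding tendsto_complex_iff Re_Im_LINT_bcontfun[OF \<mu>] Re_Im_expectation
  using lim[OF bcontfun_Re_Im(1)] lim[OF bcontfun_Re_Im(2)] by blast

lemma iter_weight_measure_borel_prob: "borel_prob (iter_weight_measure f Q n w)"
  unfolding iter_weight_measure_eq[OF f weight] borel_prob_def
  by (auto intro!: measure_pmf.prob_space_distr)

lemma integral_iter_weight_measure:
  fixes g :: "complex \<Rightarrow> 'b::{banach, second_countable_topology}"
  assumes "g \<in> borel_measurable borel"
  shows "(LINT z|iter_weight_measure f Q n w. g z) = measure_pmf.expectation (P n w) g"
  unfolding iter_weight_measure_eq[OF f weight] using assms by (subst integral_distr) auto

lemma iter_weight_measure_weak: "converges_weakly (\<lambda>n. iter_weight_measure f Q n w) \<mu>"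
proof -
  have "apply_bcontfun \<phi> \<in> borel_measurable borel" for \<phi> :: "complex \<Rightarrow>\<^sub>C complex"
    by (intro borel_measurable_continuous_onI) simp
  then show ?thesis
    unfolding converges_weakly_def
    by (simp add: \<mu> iter_weight_measure_borel_prob integral_iter_weight_measure expectation_tendsto)
qed

text \<open>Pointwise convergence is known; the equicontinuity contained in normality upgrades it on
  compact sets.\<close>

lemma transfer_locally_uniform:
  "locally_uniform_limit UNIV (\<lambda>n. apply_bcontfun ((blinfun_apply (transfer_op f Q) ^^ n) \<phi>))
     (\<lambda>_. LINT z|\<mu>. apply_bcontfun \<phi> z)"
proof (rule locally_uniform_limitI[OF open_UNIV])
  fix K :: "complex set" assume K: "compact K"
  show "uniform_limit K (\<lambda>n. apply_bcontfun ((blinfun_apply (transfer_op f Q) ^^ n) \<phi>))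
     (\<lambda>_. LINT z|\<mu>. apply_bcontfun \<phi> z) sequentially"
  proof (rule equicontinuous_imp_uniform_limit(2)[OF _ _ K])
    show "\<exists>d>0. \<forall>w'. dist w' w < d \<longrightarrow> (\<forall>n. dist (apply_bcontfun ((blinfun_apply (transfer_op f Q) ^^ n) \<phi>) w')
        (apply_bcontfun ((blinfun_apply (transfer_op f Q) ^^ n) \<phi>) w) < e)" if "e > 0" for w e
      using normal[unfolded normal_weight_def, rule_format, OF that] .
    show "(\<lambda>n. apply_bcontfun ((blinfun_apply (transfer_op f Q) ^^ n) \<phi>) w) \<longlonglongrightarrow> (LINT z|\<mu>. apply_bcontfun \<phi> z)" for w
      unfolding transfer_op_power_apply[OF weight cont] by (rule expectation_tendsto)
  qed
qed

lemma Re_Im_LINT_transfer: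
  fixes \<phi> :: "complex \<Rightarrow>\<^sub>C complex"
  assumes "borel_prob \<nu>"
  shows "Re (LINT z|\<nu>. apply_bcontfun ((blinfun_apply (transfer_op f Q) ^^ n) \<phi>) z) =
      (LINT z|\<nu>. E n (\<lambda>z. Re (apply_bcontfun \<phi> z)) z)"
    "Im (LINT z|\<nu>. apply_bcontfun ((blinfun_apply (transfer_op f Q) ^^ n) \<phi>) z) =
      (LINT z|\<nu>. E n (\<lambda>z. Im (apply_bcontfun \<phi> z)) z)"
  using Re_Im_LINT_bcontfun[OF assms, of "(blinfun_apply (transfer_op f Q) ^^ n) \<phi>"]
  by (simp_all only: transfer_op_power_apply[OF weight cont] Re_Im_expectation)

lemma transpose_fixed:
  "transpose_op (transfer_op f Q) (measure_functional \<mu>) = measure_functional \<mu>"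
proof (rule blinfun_eqI)
  fix \<phi> :: "complex \<Rightarrow>\<^sub>C complex"
  have "(LINT z|\<mu>. apply_bcontfun ((blinfun_apply (transfer_op f Q) ^^ 1) \<phi>) z) = (LINT z|\<mu>. apply_bcontfun \<phi> z)"
    by (intro complex_eqI; simp only: Re_Im_LINT_transfer[OF \<mu>] integral_E bcontfun_Re_Im;
        simp only: Re_Im_LINT_bcontfun[OF \<mu>])
  then show "blinfun_apply (transpose_op (transfer_op f Q) (measure_functional \<mu>)) \<phi> =
      blinfun_apply (measure_functional \<mu>) \<phi>"
    by (simp add: transpose_op_def measure_functional_apply[OF \<mu>])
qed

text \<open>It suffices to test closed sets. Their mass is a pointwise limit in \<open>w\<close> of
  the continuous functions \<open>A^n\<close> of cutoffs. This allows the laws to be mixed over an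
  initial measure.\<close>

lemma kernel_measurable: "iter_weight_measure f Q n \<in> borel \<rightarrow>\<^sub>M prob_algebra borel"
proof (rule measurable_prob_algebra_generated[where \<Omega> = UNIV and G = "Collect closed"])
  show "sets borel = sigma_sets UNIV (Collect (closed :: complex set \<Rightarrow> bool))"
    by (simp add: borel_eq_closed)
  show "Int_stable (Collect closed)" by (auto simp: Int_stable_def)
  fix F :: "complex set" assume "F \<in> Collect closed"
  then have F: "closed F" by simp
  obtain \<phi> :: "nat \<Rightarrow> complex \<Rightarrow> real" where \<phi>: "\<And>n. \<phi> n \<in> bcontfun" "\<And>n x. \<bar>\<phi> n x\<bar> \<le> 1"
    "\<And>x. (\<lambda>n. \<phi> n x) \<longlonglongrightarrow> indicator F x"
    using closed_indicator_approx[OF F] by metis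
  have "(\<lambda>w. E n (indicator F) w) \<in> borel_measurable borel"
  proof (rule borel_measurable_LIMSEQ_real)
    show "(\<lambda>k. E n (\<phi> k) w) \<longlonglongrightarrow> E n (indicator F) w" for w
      unfolding E_def by (rule expectation_pmf_dominated_convergence[OF \<phi>(3,2)])
    show "E n (\<phi> k) \<in> borel_measurable borel" for k
      by (rule bcontfun_measurable[OF E_bcontfun[OF \<phi>(1)]])
  qed
  moreover have "emeasure (iter_weight_measure f Q n w) F = ennreal (E n (indicator F) w)" for w
    using F by (simp add: iter_weight_measure_eq[OF f weight] emeasure_distr measure_pmf.emeasure_eq_measure E_def)
  ultimately show "(\<lambda>w. emeasure (iter_weight_measure f Q n w) F) \<in> borel_measurable borel" by simp
qed (use iter_weight_measure_borel_prob in \<open>auto simp: borel_prob_def\<close>)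

lemma arbitrary_initial_measure:
  assumes \<nu>: "borel_prob \<nu>"
  shows "\<exists>N. (\<forall>n. measure_functional (N n) =
      (transpose_op (transfer_op f Q) ^^ n) (measure_functional \<nu>)) \<and> converges_weakly N \<mu>"
proof -
  interpret \<nu>: prob_space \<nu> using borel_probD(1)[OF \<nu>] .
  \<comment> \<open>The law after \<open>n\<close> backward steps from a random starting point with
    law \<open>\<nu>\<close>: a measure that represents the \<open>n\<close>-th transpose iterate of
    the functional of \<open>\<nu>\<close>.\<close>
  define N where "N n = \<nu> \<bind> iter_weight_measure f Q n" for n
  have ker: "iter_weight_measure f Q n \<in> \<nu> \<rightarrow>\<^sub>M prob_algebra borel" for n
    using kernel_measurable borel_probD(2)[OF \<nu>] by (simp cong: measurable_cong_sets)
  have \<nu>': "\<nu> \<in> space (prob_algebra \<nu>)" by (simp add: space_prob_algebra \<nu>.prob_space_axioms)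
  have N: "borel_prob (N n)" for n
    using measurable_space[OF measurable_bind_prob_space[OF measurable_const[OF \<nu>'] ker[of n]]] prob_space_bind'[OF \<nu>' ker[of n]] sets_bind'[OF \<nu>' ker[of n]]
    by (auto simp: borel_prob_def N_def)
  have int: "(LINT z|N n. g z) = (LINT w|\<nu>. E n g w)" if g: "g \<in> bcontfun" for n and g :: "complex \<Rightarrow> real"
  proof -
    obtain B where B: "\<And>x. \<bar>g x\<bar> \<le> B" using bcontfun_realE[OF g] by metis
    have "(LINT z|N n. g z) = (LINT w|\<nu>. (LINT z|iter_weight_measure f Q n w. g z))"
      unfolding N_def
    proof (rule integral_bind[where K = borel and B = B and B' = 1])
      show "iter_weight_measure f Q n \<in> \<nu> \<rightarrow>\<^sub>M subprob_algebra borel"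
        by (rule measurable_prob_algebraD[OF ker])
      show "AE w in \<nu>. emeasure (iter_weight_measure f Q n w) (space (iter_weight_measure f Q n w)) \<le> ennreal 1"
        using prob_space.emeasure_space_1[OF borel_probD(1)[OF iter_weight_measure_borel_prob]] by simp
    qed (use B bcontfun_measurable[OF g] \<nu>.finite_measure_axioms in auto)
    then show ?thesis by (simp add: integral_iter_weight_measure[OF bcontfun_measurable[OF g]] E_def)
  qed
  have "measure_functional (N n) = (transpose_op (transfer_op f Q) ^^ n) (measure_functional \<nu>)" for n
  proof (rule blinfun_eqI)
    fix \<phi> :: "complex \<Rightarrow>\<^sub>C complex"
    have "(LINT z|N n. apply_bcontfun \<phi> z) =
        (LINT z|\<nu>. apply_bcontfun ((blinfun_apply (transfer_op f Q) ^^ n) \<phi>) z)"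
      by (intro complex_eqI)
         (simp_all only: Re_Im_LINT_bcontfun[OF N] Re_Im_LINT_transfer[OF \<nu>] int[OF bcontfun_Re_Im(1)] int[OF bcontfun_Re_Im(2)])
    then show "blinfun_apply (measure_functional (N n)) \<phi> =
        blinfun_apply ((transpose_op (transfer_op f Q) ^^ n) (measure_functional \<nu>)) \<phi>"
      by (simp add: transpose_op_power measure_functional_apply N \<nu>)
  qed
  moreover have "converges_weakly N \<mu>"
    unfolding converges_weakly_def
  proof (intro conjI allI N \<mu>)
    fix \<phi> :: "complex \<Rightarrow>\<^sub>C complex"
    show "(\<lambda>n. LINT z|N n. apply_bcontfun \<phi> z) \<longlonglongrightarrow> (LINT z|\<mu>. apply_bcontfun \<phi> z)"
    proof (rule Re_Im_tendsto[OF \<mu> N])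
      fix g :: "complex \<Rightarrow> real" assume g: "g \<in> bcontfun"
      obtain B where B: "\<And>x. \<bar>g x\<bar> \<le> B" using bcontfun_realE[OF g] by metis
      \<comment> \<open>The integrand tends pointwise to a constant under a uniform bound, so no
        tightness is required of the initial measure.\<close>
      have "(\<lambda>n. LINT w|\<nu>. E n g w) \<longlonglongrightarrow> (LINT w|\<nu>. (LINT z|\<mu>. g z))"
        by (rule borel_prob_dominated_convergence[OF \<nu> _ _ lim[OF g] E_bound[OF B]])
           (use bcontfun_measurable[OF E_bcontfun[OF g]] in auto)
      then show "(\<lambda>n. LINT z|N n. g z) \<longlonglongrightarrow> (LINT z|\<mu>. g z)"
        by (simp add: int[OF g] \<nu>.prob_space)
    qed
  qed
  ultimately show ?thesis by blast
qed

end

theorem theorem6p18: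
  fixes f :: "complex \<Rightarrow> complex" and Q :: "complex \<Rightarrow> real"
  assumes "f holomorphic_on UNIV" and "surj f"
    and "\<forall>z. \<not> exceptional f z"
    and "weight_function f Q" and "weakly_continuous f Q"
    and "normal_weight f Q" and "tight_weight f Q"
    and "\<forall>z. Q z \<noteq> 0"
  shows "\<exists>L\<in>Cb_dual.
      (\<forall>\<phi> :: complex \<Rightarrow>\<^sub>C complex. locally_uniform_limit UNIV
         (\<lambda>n. apply_bcontfun ((blinfun_apply (transfer_op f Q) ^^ n) \<phi>))
         (\<lambda>_. blinfun_apply L \<phi>)) \<and>
      (\<exists>\<mu>. borel_prob \<mu> \<and>
         L = measure_functional \<mu> \<and>
         measure_support \<mu> = julia_set f \<and>
         transpose_op (transfer_op f Q) (measure_functional \<mu>) = measure_functional \<mu> \<and>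
         invariant_measure f \<mu> \<and>
         mixing f \<mu> \<and>
         (\<forall>\<nu>. borel_prob \<nu> \<longrightarrow>
            (\<exists>N. (\<forall>n. measure_functional (N n) =
                      (transpose_op (transfer_op f Q) ^^ n) (measure_functional \<nu>)) \<and>
                 converges_weakly N \<mu>)) \<and>
         (\<forall>w. converges_weakly (\<lambda>n. iter_weight_measure f Q n w) \<mu>))"
proof -
  interpret normal_tight_weight f Q using assms by unfold_locales
  obtain \<mu> where "borel_prob \<mu>"
    "\<And>\<phi> w. \<phi> \<in> bcontfun \<Longrightarrow> (\<lambda>n. E n \<phi> w) \<longlonglongrightarrow> (LINT z|\<mu>. \<phi> z)"
    using equilibrium_exists by metis
  then interpret equilibrium f Q \<mu> by unfold_locales
  show ?thesis
  proof (intro bexI[of _ "measure_functional \<mu>"] conjI allI exI[of _ \<mu>] impI)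
    show "locally_uniform_limit UNIV (\<lambda>n. apply_bcontfun ((blinfun_apply (transfer_op f Q) ^^ n) \<phi>))
       (\<lambda>_. blinfun_apply (measure_functional \<mu>) \<phi>)" for \<phi>
      unfolding measure_functional_apply[OF \<mu>] by (rule transfer_locally_uniform)
  qed (use \<mu> support_eq_julia transpose_fixed invariant mixing arbitrary_initial_measure
      iter_weight_measure_weak measure_functional_in_dual in auto)
qed

end
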